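(* Let $\alpha>0$, $\alpha\neq1$, and let $T_u$ be a Toeplitz operator on $A^2(U^\alpha)$ whose symbol $u$ (a measurable function on $U^\alpha$) satisfies, for some $p>4$, $$\sup_{z\in U^\alpha}\big\|u\big(\varphi_{z_2}(\phi_{f_\alpha(z)}(w))\big)\big\|_{L^p(U^\alpha)}<\infty,$$ where the $L^p$ norm is taken in the variable $w$. Then $T_u$ is $L^2$-bounded, i.e. it is a bounded operator on $A^2(U^\alpha)$.
   Context: $U^\alpha=\{z=(z_1,z_2)\in\mathbb C^2: |z_1|^{2/\alpha}+|z_2|^2<1\}$; $d\sigma$ is Lebesgue measure and $L^p(U^\alpha)=L^p(U^\alpha,d\sigma)$. $A^2(U^\alpha)$ is the Bergman space, the closed subspace of holomorphic functions in $L^2(U^\alpha)$, and $K_{U^\alpha}(z;\bar w)$ is its Bergman (reproducing) kernel. The Toeplitz operator with symbol $u$ is $T_ug=P(ug)$, $P$ the Bergman projection, i.e. $T_ug(z)=\int_{U^\alpha}u(w)g(w)K_{U^\alpha}(z;\bar w)\,d\sigma(w)$; this integral formula is the definition for unbounded $u$. $\mathbb D$ is the open unit disc in $\mathbb C$. For $b\in\mathbb D$ define $\varphi_b:U^\alpha\to U^\alpha$ by $$\varphi_b(w_1,w_2)=\Big(w_1\Big(\tfrac{\sqrt{1-|b|^2}}{1-\bar b w_2}\Big)^\alpha,\ \tfrac{b-w_2}{1-\bar b w_2}\Big)$$ (principal branch of the power). For $a\in\mathbb D$ define $\phi_a:U^\alpha\to U^\alpha$ by $\phi_a(w)=(\phi^{(1)}(w),\phi^{(2)}(w))$,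 where $$\phi^{(1)}(w)=\frac{a-w_1}{1-\bar a w_1},\qquad \phi^{(2)}(w)=w_2\,\frac{\sqrt{1-|a|^2}}{1-\bar a w_1}\sqrt{\frac{(1-|w_1|^2)(1-|\phi^{(1)}(w)|^{2/\alpha})}{(1-|w_1|^{2/\alpha})(1-|\phi^{(1)}(w)|^2)}}.$$ For $z=(z_1,z_2)\in U^\alpha$ put $f_\alpha(z)=z_1/(1-|z_2|^2)^{\alpha/2}\in\mathbb D$. *)

theory Defs
  imports "HOL-Analysis.Analysis"
begin

definition U_dom :: "real \<Rightarrow> (complex \<times> complex) set" where
  "U_dom \<alpha> = {z. norm (fst z) powr (2 / \<alpha>) + (norm (snd z))\<^sup>2 < 1}"

text \<open>The \<open>L\<^sup>p\<close> norm over \<open>U\<close> with respect to Lebesgue measure, for finite \<open>p\<close>, as an extended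
  nonnegative real, so that an infinite norm is not collapsed to a real junk value.\<close>

definition Lp_norm :: "real \<Rightarrow> (complex \<times> complex) set \<Rightarrow> (complex \<times> complex \<Rightarrow> complex) \<Rightarrow> ennreal" where
  "Lp_norm p U f =
     (let I = (\<integral>\<^sup>+ w. ennreal (norm (f w) powr p) \<partial>lebesgue_on U)
      in if I = \<infinity> then \<infinity> else ennreal (enn2real I powr (1 / p)))"

text \<open>Holomorphy in two variables: at every point of the open set \<open>U\<close> the function has a
  complex-linear Frechet derivative.\<close>

definition holomorphic2_on ::
    "(complex \<times> complex \<Rightarrow> complex) \<Rightarrow> (complex \<times> complex) set \<Rightarrow> bool" where
  "holomorphic2_on f U \<longleftrightarrow>
     (\<forall>z\<in>U. \<exists>a b. (f has_derivative (\<lambda>h. a * fst h + b * snd h)) (at z))"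

text \<open>Elements are total functions; their values outside \<open>U\<close> are irrelevant.\<close>

definition bergman_space ::
    "(complex \<times> complex) set \<Rightarrow> (complex \<times> complex \<Rightarrow> complex) set" where
  "bergman_space U = {f. holomorphic2_on f U \<and> Lp_norm 2 U f < \<infinity>}"

text \<open>\<open>bergman_kernel U z w\<close> is the reproducing kernel \<open>K(z; w\<^sup>*)\<close>, where \<open>w\<^sup>*\<close> is the conjugate
  of \<open>w\<close>: it is antiholomorphic in \<open>w\<close> and the conjugation is built in. The kernel is set to 0
  off \<open>U \<times> U\<close> to make it unique as a total function.\<close>

definition is_bergman_kernel ::
    "(complex \<times> complex) set \<Rightarrow> (complex \<times> complex \<Rightarrow> complex \<times> complex \<Rightarrow> complex) \<Rightarrow> bool" where
  "is_bergman_kernel U K \<longleftrightarrow>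
     (\<forall>z\<in>U. (\<lambda>w. cnj (K z w)) \<in> bergman_space U \<and>
        (\<forall>g\<in>bergman_space U. g z = (LINT w|lebesgue_on U. g w * K z w))) \<and>
     (\<forall>z w. z \<notin> U \<or> w \<notin> U \<longrightarrow> K z w = 0)"

definition bergman_kernel ::
    "(complex \<times> complex) set \<Rightarrow> complex \<times> complex \<Rightarrow> complex \<times> complex \<Rightarrow> complex" where
  "bergman_kernel U = (THE K. is_bergman_kernel U K)"

definition toeplitz ::
    "(complex \<times> complex) set \<Rightarrow> (complex \<times> complex \<Rightarrow> complex) \<Rightarrow>
     (complex \<times> complex \<Rightarrow> complex) \<Rightarrow> complex \<times> complex \<Rightarrow> complex" where
  "toeplitz U u g z = (LINT w|lebesgue_on U. u w * g w * bergman_kernel U z w)"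

text \<open>The Bochner integral of a non-integrable function is 0, so convergence of the defining
  integral has to be recorded separately.\<close>

definition toeplitz_defined ::
    "(complex \<times> complex) set \<Rightarrow> (complex \<times> complex \<Rightarrow> complex) \<Rightarrow> bool" where
  "toeplitz_defined U u \<longleftrightarrow>
     (\<forall>g\<in>bergman_space U. \<forall>z\<in>U.
        integrable (lebesgue_on U) (\<lambda>w. u w * g w * bergman_kernel U z w))"

definition bounded_on_bergman_space ::
    "(complex \<times> complex) set \<Rightarrow>
     ((complex \<times> complex \<Rightarrow> complex) \<Rightarrow> complex \<times> complex \<Rightarrow> complex) \<Rightarrow> bool" where
  "bounded_on_bergman_space U T \<longleftrightarrow>
     (\<forall>g\<in>bergman_space U. T g \<in> bergman_space U) \<and>
     (\<forall>f\<in>bergman_space U. \<forall>g\<in>bergman_space U. \<forall>z\<in>U. T (\<lambda>w. f w + g w) z = T f z + T g z) \<and>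
     (\<forall>c. \<forall>g\<in>bergman_space U. \<forall>z\<in>U. T (\<lambda>w. c * g w) z = c * T g z) \<and>
     (\<exists>C::real. \<forall>g\<in>bergman_space U. Lp_norm 2 U (T g) \<le> ennreal C * Lp_norm 2 U g)"

text \<open>The power below is the complex \<open>powr\<close>, i.e. the principal branch.\<close>

definition varphi :: "real \<Rightarrow> complex \<Rightarrow> complex \<times> complex \<Rightarrow> complex \<times> complex" where
  "varphi \<alpha> b w =
     (fst w * (of_real (sqrt (1 - (norm b)\<^sup>2)) / (1 - cnj b * snd w)) powr of_real \<alpha>,
      (b - snd w) / (1 - cnj b * snd w))"

definition phi1 :: "complex \<Rightarrow> complex \<times> complex \<Rightarrow> complex" where
  "phi1 a w = (a - fst w) / (1 - cnj a * fst w)"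

definition phi2 :: "real \<Rightarrow> complex \<Rightarrow> complex \<times> complex \<Rightarrow> complex" where
  "phi2 \<alpha> a w =
     snd w * (of_real (sqrt (1 - (norm a)\<^sup>2)) / (1 - cnj a * fst w)) *
     of_real (sqrt (((1 - (norm (fst w))\<^sup>2) * (1 - norm (phi1 a w) powr (2 / \<alpha>))) /
                    ((1 - norm (fst w) powr (2 / \<alpha>)) * (1 - (norm (phi1 a w))\<^sup>2))))"

definition phi :: "real \<Rightarrow> complex \<Rightarrow> complex \<times> complex \<Rightarrow> complex \<times> complex" where
  "phi \<alpha> a w = (phi1 a w, phi2 \<alpha> a w)"

definition f_alpha :: "real \<Rightarrow> complex \<times> complex \<Rightarrow> complex" where
  "f_alpha \<alpha> z = fst z / of_real ((1 - (norm (snd z))\<^sup>2) powr (\<alpha> / 2))"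

end

theory Submission
  imports Defs "HOL-Complex_Analysis.Complex_Analysis"
begin

text \<open>
  Write \<open>U\<close> for the domain, \<open>f\<close> for \<open>f_alpha\<close>, and \<open>\<Phi>\<^sub>v = varphi\<^bsub>v\<^sub>2\<^esub> \<circ> phi\<^bsub>f(v)\<^esub>\<close> for the bijection of \<open>U\<close> that sends the
  origin to \<open>v\<close>. The theorem holds because the hypothesis makes \<open>\<bar>u\<bar> d\<sigma>\<close> a Carleson measure for the
  Bergman space, that is, \<open>\<integral> \<bar>u\<bar> \<bar>g\<bar>\<^sup>2 \<le> C \<parallel>g\<parallel>\<^sup>2\<close> for all \<open>g\<close>.

  \<^bold>\<open>A Carleson inequality bounds the operator.\<close> By the Cauchy--Schwarz inequality for the measure
  \<open>\<bar>u\<bar> d\<sigma>\<close>, the functional \<open>h \<mapsto> \<integral> h cnj (u g)\<close> is bounded on the Bergman space, with norm at most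
  \<open>C \<parallel>g\<parallel>\<close>. The Riesz theorem represents it by an element \<open>G\<close> of the space with \<open>\<parallel>G\<parallel> \<le> C \<parallel>g\<parallel>\<close>, and
  testing it on the reproducing kernels gives \<open>T\<^sub>u g = G\<close> (\<open>toeplitz_bounded_if_carleson\<close>). This yields
  holomorphy of \<open>T\<^sub>u g\<close> and the bound at once. The Riesz theorem and the existence of the
  kernel rest on completeness of the Bergman space (\<open>bergman_complete\<close>) and on boundedness of point
  evaluations (\<open>bergman_local_bound\<close>).

  \<^bold>\<open>The Carleson inequality is local.\<close> Around every \<open>w\<close> in \<open>U\<close> there is a region \<open>tube w\<close>
  whose size is governed by the two distances \<open>1 - \<bar>f(w)\<bar>\<^sup>2\<close> and \<open>1 - \<bar>w\<^sub>2\<bar>\<^sup>2\<close>, whose volume is comparable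
  to a weight \<open>\<beta>(w)\<close>, and over which \<open>\<bar>g\<bar>\<^sup>2\<close> satisfies the sub-mean value inequality
  \<open>\<beta>(w) \<bar>g(w)\<bar>\<^sup>2 \<le> c \<integral>\<^bsub>tube w\<^esub> \<bar>g\<bar>\<^sup>2\<close> (\<open>submean_over_tube\<close>). By Tonelli it remains to bound, uniformly
  in \<open>v\<close>, the integral of \<open>\<bar>u(w)\<bar> / \<beta>(w)\<close> over all \<open>w\<close> with \<open>v \<in> tube w\<close>. For such \<open>w\<close> the quantities
  attached to \<open>v\<close> and to \<open>w\<close> are comparable (\<open>tube_geometry\<close>), so after the substitution
  \<open>w = \<Phi>\<^sub>v(\<xi>)\<close> the Jacobian is at most a constant times \<open>\<beta>(w)\<close>, and the integral is at most a
  constant times \<open>\<integral>\<^sub>U \<bar>u \<circ> \<Phi>\<^sub>v\<bar>\<close> (\<open>carleson_inner_integral\<close>). The hypothesis controls the last integral.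

  The map \<open>phi\<close> is not holomorphic, but each of \<open>varphi\<close> and \<open>phi\<close> acts on one coordinate by a Moebius map
  of the disc and multiplies the other one by a number that depends on the former. The substitution is
  therefore an iterated application of a one-variable formula for holomorphic maps.
\<close>

section \<open>Holomorphic change of variables in the plane\<close>

text \<open>The linear isometry between the complex plane and \<open>real ^ 2\<close>, along which Jacobian determinants and the
  volume formula for images are transported.\<close>

definition vec_of_complex :: "complex \<Rightarrow> real^2" where
  "vec_of_complex z = vector [Re z, Im z]"

definition complex_of_vec :: "real^2 \<Rightarrow> complex" where
  "complex_of_vec v = Complex (v $ 1) (v $ 2)"

lemma complex_of_vec_of_complex [simp]: "complex_of_vec (vec_of_complex z) = z"
  by (simp add: vec_of_complex_def complex_of_vec_def)

lemma vec_of_complex_of_vec [simp]: "vec_of_complex (complex_of_vec v) = v"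
  by (simp add: vec_of_complex_def complex_of_vec_def vec_eq_iff forall_2)

lemma linear_vec_of_complex: "linear vec_of_complex"
  by (rule linearI) (simp_all add: vec_of_complex_def vec_eq_iff forall_2)

lemma linear_complex_of_vec: "linear complex_of_vec"
  by (rule linearI) (simp_all add: complex_of_vec_def complex_eq_iff)

lemma vec_of_complex_measurable [measurable]: "vec_of_complex \<in> borel \<rightarrow>\<^sub>M borel"
  by (intro borel_measurable_continuous_onI linear_continuous_on
            linear_conv_bounded_linear[THEN iffD1] linear_vec_of_complex)

lemma complex_of_vec_measurable [measurable]: "complex_of_vec \<in> borel \<rightarrow>\<^sub>M borel"
  by (intro borel_measurable_continuous_onI linear_continuous_on
            linear_conv_bounded_linear[THEN iffD1] linear_complex_of_vec)

text \<open>The identification with the plane matches boxes with boxes of the same volume, and boxes determine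
  Lebesgue measure.\<close>

lemma lborel_vec_of_complex: "lborel = distr lborel borel vec_of_complex"
proof (rule lborel_eqI)
  fix l u :: "real^2"
  assume le: "\<And>b. b \<in> Basis \<Longrightarrow> l \<bullet> b \<le> u \<bullet> b"
  have le': "l $ i \<le> u $ i" for i
    using le[of "axis i 1"] by (simp add: inner_axis axis_in_Basis_iff)
  have "vec_of_complex -` box l u = box (complex_of_vec l) (complex_of_vec u)"
    by (auto simp: vec_of_complex_def complex_of_vec_def mem_box_cart in_box_complex_iff forall_2)
  then have "emeasure (distr lborel borel vec_of_complex) (box l u)
      = (\<Prod>b\<in>Basis. (complex_of_vec u - complex_of_vec l) \<bullet> b)"
    using le' by (subst emeasure_distr) (auto simp: emeasure_lborel_box_eq Basis_complex_def complex_of_vec_def)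
  also have "\<dots> = (\<Prod>b\<in>Basis. (u - l) \<bullet> b)"
    by (simp add: Basis_complex_def complex_of_vec_def Basis_vec_def UNIV_2 axis_eq_axis inner_axis algebra_simps)
  finally show "emeasure (distr lborel borel vec_of_complex) (box l u) = (\<Prod>b\<in>Basis. (u - l) \<bullet> b)" .
qed simp

lemma emeasure_lebesgue_borel: "A \<in> sets borel \<Longrightarrow> emeasure lebesgue A = emeasure lborel A"
  by simp

text \<open>The real Jacobian determinant of a complex differentiable map is the squared modulus of its
  derivative: multiplication by \<open>d\<close> has the matrix with rows \<open>(Re d, -Im d)\<close> and \<open>(Im d, Re d)\<close>.\<close>

lemma emeasure_image_complex_deriv:
  fixes E :: "complex set" and g d :: "complex \<Rightarrow> complex"
  assumes [measurable]: "E \<in> sets borel" and gE [measurable]: "g ` E \<in> sets borel"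
    and [measurable]: "d \<in> borel_measurable borel"
    and der: "\<And>x. x \<in> E \<Longrightarrow> (g has_field_derivative d x) (at x)" and inj: "inj_on g E"
  shows "emeasure lborel (g ` E) = (\<integral>\<^sup>+x. indicator E x * ennreal ((norm (d x))\<^sup>2) \<partial>lborel)"
proof -
  define S where "S = vec_of_complex ` E"
  define G where "G = vec_of_complex \<circ> g \<circ> complex_of_vec"
  define G' where "G' = (\<lambda>v. vec_of_complex \<circ> (\<lambda>h. d (complex_of_vec v) * h) \<circ> complex_of_vec)"
  have im: "vec_of_complex ` A = complex_of_vec -` A" for A
    by (auto simp: image_iff) (metis vec_of_complex_of_vec)
  have S [measurable]: "S \<in> sets borel"
    unfolding S_def im using measurable_sets[OF complex_of_vec_measurable assms(1)] by simp
  have GS: "G ` S = vec_of_complex ` g ` E"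
    by (auto simp: G_def S_def image_iff)
  have GSb [measurable]: "G ` S \<in> sets borel"
    unfolding GS im using measurable_sets[OF complex_of_vec_measurable gE] by simp
  have bl: "bounded_linear vec_of_complex" "bounded_linear complex_of_vec"
    using linear_vec_of_complex linear_complex_of_vec by (auto simp: linear_conv_bounded_linear)
  have derG: "(G has_derivative G' v) (at v within S)" if "v \<in> S" for v
  proof -
    have "complex_of_vec v \<in> E" using that by (auto simp: S_def)
    then have 1: "(g has_derivative (\<lambda>h. d (complex_of_vec v) * h)) (at (complex_of_vec v))"
      using der by (simp add: has_field_derivative_def)
    have 2: "(complex_of_vec has_derivative complex_of_vec) (at v)"
      using bl(2) by (rule bounded_linear_imp_has_derivative)
    have 3: "(vec_of_complex has_derivative vec_of_complex) (at x)" for x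
      using bl(1) by (rule bounded_linear_imp_has_derivative)
    have "(G has_derivative G' v) (at v)"
      using diff_chain_at[OF 2 diff_chain_at[OF 1 3]] unfolding G_def G'_def o_def .
    then show ?thesis by (rule has_derivative_at_withinI)
  qed
  have det: "\<bar>det (matrix (G' v))\<bar> = (norm (d (complex_of_vec v)))\<^sup>2" for v
  proof -
    have "det (matrix (G' v)) = (Re (d (complex_of_vec v)))\<^sup>2 + (Im (d (complex_of_vec v)))\<^sup>2"
      by (simp add: det_2 matrix_def G'_def vec_of_complex_def complex_of_vec_def axis_def power2_eq_square)
    then show ?thesis by (simp add: cmod_power2)
  qed
  have injG: "inj_on G S"
    using inj by (auto simp: inj_on_def G_def S_def) (metis complex_of_vec_of_complex)
  have em: "emeasure lborel (G ` S) = emeasure lborel (g ` E)"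
    by (subst lborel_vec_of_complex, subst emeasure_distr) (auto simp: GS im vimage_def)
  define J where "J v = (if v \<in> S then (norm (d (complex_of_vec v)))\<^sup>2 else 0)" for v
  have S_iff: "v \<in> S \<longleftrightarrow> complex_of_vec v \<in> E" for v
    unfolding S_def im by simp
  have J [measurable]: "J \<in> borel_measurable borel" unfolding J_def by measurable
  have J0: "0 \<le> J v" for v by (simp add: J_def)
  have key: "G ` S \<in> lmeasurable \<and> measure lebesgue (G ` S) = m \<longleftrightarrow> (J has_integral m) UNIV" for m
    unfolding J_def has_integral_restrict_UNIV det[symmetric]
    by (rule has_measure_differentiable_image[OF _ derG injG]) auto
  (* The isometry preserves the measure, so the integral of J over the plane is the complex integral. *)
  have intJ: "(\<integral>\<^sup>+v. J v \<partial>lborel) = (\<integral>\<^sup>+x. indicator E x * ennreal ((norm (d x))\<^sup>2) \<partial>lborel)"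
  proof -
    have "(\<integral>\<^sup>+v. J v \<partial>lborel) = (\<integral>\<^sup>+x. ennreal (J (vec_of_complex x)) \<partial>lborel)"
      by (subst lborel_vec_of_complex, rule nn_integral_distr) simp_all
    also have "\<dots> = (\<integral>\<^sup>+x. indicator E x * ennreal ((norm (d x))\<^sup>2) \<partial>lborel)"
      by (rule nn_integral_cong) (simp add: J_def S_iff indicator_def)
    finally show ?thesis .
  qed
  have "emeasure lborel (G ` S) = (\<integral>\<^sup>+v. J v \<partial>lborel)"
  proof (cases "(\<integral>\<^sup>+v. J v \<partial>lborel) = \<infinity>")
    case False
    then obtain m where m: "m \<ge> 0" "(\<integral>\<^sup>+v. J v \<partial>lborel) = ennreal m"
      by (cases "\<integral>\<^sup>+v. J v \<partial>lborel") auto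
    then have "(J has_integral m) UNIV"
      by (intro nn_integral_has_integral) (auto simp: J0)
    then have "G ` S \<in> lmeasurable" "measure lebesgue (G ` S) = m" using key[of m] by blast+
    then have "emeasure lebesgue (G ` S) = ennreal m"
      by (metis emeasure_eq_measure2)
    moreover have "emeasure lebesgue (G ` S) = emeasure lborel (G ` S)"
      by (rule emeasure_lebesgue_borel[OF GSb])
    ultimately show ?thesis using m by metis
  next
    case True
    have "emeasure lborel (G ` S) = \<infinity>"
    proof (rule ccontr)
      assume "emeasure lborel (G ` S) \<noteq> \<infinity>"
      moreover have "emeasure lebesgue (G ` S) = emeasure lborel (G ` S)"
        by (rule emeasure_lebesgue_borel[OF GSb])
      ultimately have "emeasure lebesgue (G ` S) < \<infinity>"
        by (simp only: less_top infinity_ennreal_def simp_thms)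
      moreover have "G ` S \<in> sets lebesgue"
        by (rule sets_completionI_sets) (use GSb in simp)
      ultimately have "G ` S \<in> lmeasurable"
        by (simp only: fmeasurable_def mem_Collect_eq simp_thms)
      with key have "(J has_integral measure lebesgue (G ` S)) UNIV" by blast
      from nn_integral_has_integral_lborel[OF J J0 this] True show False by simp
    qed
    with True show ?thesis by simp
  qed
  with em intJ show ?thesis by simp
qed

text \<open>For nonnegative integrands the formula need only be checked on indicator functions, where it is the
  volume formula for images. Images of Borel sets are Borel since the inverse of \<open>g\<close> is continuous.\<close>

lemma nn_integral_complex_substitution:
  fixes S :: "complex set" and g :: "complex \<Rightarrow> complex" and F :: "complex \<Rightarrow> ennreal"
  assumes S: "open S" and hol: "g holomorphic_on S" and inj: "inj_on g S"
    and [measurable]: "F \<in> borel_measurable borel"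
  shows "(\<integral>\<^sup>+y. indicator (g ` S) y * F y \<partial>lborel)
       = (\<integral>\<^sup>+x. indicator S x * (F (g x) * ennreal ((norm (deriv g x))\<^sup>2)) \<partial>lborel)"
proof -
  obtain h where h: "h holomorphic_on (g ` S)" "\<And>z. z \<in> S \<Longrightarrow> h (g z) = z"
    using holomorphic_has_inverse[OF hol S inj] by metis
  have opn: "open (g ` S)" using open_mapping_thm3[OF hol S inj] .
  have [measurable]: "S \<in> sets borel" "g ` S \<in> sets borel" using S opn by auto
  define g0 where "g0 x = indicator S x *\<^sub>R g x" for x
  define d where "d x = indicator S x *\<^sub>R deriv g x" for x
  define h0 where "h0 x = indicator (g ` S) x *\<^sub>R h x" for x
  have [measurable]: "g0 \<in> borel \<rightarrow>\<^sub>M borel"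
    unfolding g0_def using S hol
    by (intro borel_measurable_continuous_on_indicator holomorphic_on_imp_continuous_on) auto
  have [measurable]: "h0 \<in> borel \<rightarrow>\<^sub>M borel"
    unfolding h0_def using opn h
    by (intro borel_measurable_continuous_on_indicator holomorphic_on_imp_continuous_on) auto
  have [measurable]: "d \<in> borel \<rightarrow>\<^sub>M borel"
    unfolding d_def using S hol holomorphic_deriv
    by (intro borel_measurable_continuous_on_indicator holomorphic_on_imp_continuous_on) auto
  define N where "N = density lborel (\<lambda>x. indicator S x * ennreal ((norm (d x))\<^sup>2))"
  have eq: "density lborel (indicator (g ` S)) = distr N borel g0"
  proof (rule measure_eqI)
    fix A assume "A \<in> sets (density lborel (indicator (g ` S) :: complex \<Rightarrow> ennreal))"
    then have [measurable]: "A \<in> sets borel" by simp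
    define E where "E = g0 -` A \<inter> S"
    have [measurable]: "E \<in> sets borel"
      unfolding E_def using measurable_sets[of g0 borel borel A] by auto
    have gE: "g ` E = A \<inter> g ` S" by (auto simp: E_def g0_def)
    have "emeasure (distr N borel g0) A = emeasure N (g0 -` A)"
      by (subst emeasure_distr) (auto simp: N_def)
    also have "\<dots> = (\<integral>\<^sup>+x. indicator S x * ennreal ((norm (d x))\<^sup>2) * indicator (g0 -` A) x \<partial>lborel)"
      unfolding N_def using measurable_sets[of g0 borel borel A] by (subst emeasure_density) auto
    also have "\<dots> = (\<integral>\<^sup>+x. indicator E x * ennreal ((norm (d x))\<^sup>2) \<partial>lborel)"
      by (rule nn_integral_cong) (auto simp: E_def indicator_def)
    also have "\<dots> = emeasure lborel (g ` E)"
    proof (rule emeasure_image_complex_deriv[symmetric])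
      show "(g has_field_derivative d x) (at x)" if "x \<in> E" for x
        using that holomorphic_derivI[OF hol S] by (auto simp: d_def E_def)
      show "inj_on g E" using inj by (rule inj_on_subset) (auto simp: E_def)
    qed (auto simp: gE)
    also have "\<dots> = emeasure (density lborel (indicator (g ` S))) A"
      by (subst emeasure_density)
         (auto simp: gE Int_commute indicator_inter_arith[symmetric])
    finally show "emeasure (density lborel (indicator (g ` S))) A = emeasure (distr N borel g0) A" by simp
  qed (simp add: N_def)
  have "(\<integral>\<^sup>+y. indicator (g ` S) y * F y \<partial>lborel) = (\<integral>\<^sup>+y. F y \<partial>distr N borel g0)"
    by (subst eq[symmetric], subst nn_integral_density) auto
  also have "\<dots> = (\<integral>\<^sup>+x. indicator S x * ennreal ((norm (d x))\<^sup>2) * F (g0 x) \<partial>lborel)"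
    unfolding N_def by (subst nn_integral_distr, simp, simp, subst nn_integral_density) auto
  also have "\<dots> = (\<integral>\<^sup>+x. indicator S x * (F (g x) * ennreal ((norm (deriv g x))\<^sup>2)) \<partial>lborel)"
    by (rule nn_integral_cong) (auto simp: g0_def d_def indicator_def mult.commute)
  finally show ?thesis .
qed

lemma nn_integral_complex_scale:
  fixes c :: complex and F :: "complex \<Rightarrow> ennreal"
  assumes "c \<noteq> 0" and "F \<in> borel_measurable borel"
  shows "(\<integral>\<^sup>+y. F y \<partial>lborel) = (\<integral>\<^sup>+x. F (c * x) * ennreal ((norm c)\<^sup>2) \<partial>lborel)"
proof -
  have "range ((*) c) = UNIV"
    using assms(1) by (auto simp: image_iff intro!: exI[of _ "_ / c"])
  then show ?thesis
    using nn_integral_complex_substitution[of UNIV "(*) c" F] assms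
    by (auto simp: inj_on_def intro!: holomorphic_intros)
qed

text \<open>The algebraic identity from which all distance formulas for the disc involution
  \<open>x \<mapsto> (b - x) / (1 - cnj b * x)\<close> follow.\<close>

lemma moebius_norm_identity:
  fixes b x :: complex
  shows "(norm (1 - cnj b * x))\<^sup>2 - (norm (b - x))\<^sup>2 = (1 - (norm b)\<^sup>2) * (1 - (norm x)\<^sup>2)"
  unfolding cmod_power2 by (simp add: algebra_simps power2_eq_square)

lemma one_minus_cnj_mult_nonzero:
  fixes b x :: complex
  assumes "norm b < 1" "norm x < 1"
  shows "1 - cnj b * x \<noteq> 0"
proof
  assume "1 - cnj b * x = 0"
  with moebius_norm_identity[of b x] have "- (norm (b - x))\<^sup>2 = (1 - (norm b)\<^sup>2) * (1 - (norm x)\<^sup>2)"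
    by simp
  moreover have "(1 - (norm b)\<^sup>2) * (1 - (norm x)\<^sup>2) > 0"
    using assms by (simp add: power_less_one_iff abs_square_less_1)
  ultimately show False by (smt (verit) zero_le_power2)
qed

lemma moebius_one_minus_norm:
  fixes b x :: complex
  assumes "norm b < 1" "norm x < 1"
  shows "1 - (norm ((b - x) / (1 - cnj b * x)))\<^sup>2
       = (1 - (norm b)\<^sup>2) * (1 - (norm x)\<^sup>2) / (norm (1 - cnj b * x))\<^sup>2"
  using moebius_norm_identity[of b x] one_minus_cnj_mult_nonzero[OF assms]
  by (simp add: norm_divide power_divide field_simps)

lemma moebius_in_disc:
  fixes b x :: complex
  assumes "norm b < 1" "norm x < 1"
  shows "norm ((b - x) / (1 - cnj b * x)) < 1"
proof -
  have "0 < 1 - (norm ((b - x) / (1 - cnj b * x)))\<^sup>2"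
    unfolding moebius_one_minus_norm[OF assms] using assms one_minus_cnj_mult_nonzero[OF assms]
    by (simp add: abs_square_less_1)
  then show ?thesis by (simp add: abs_square_less_1)
qed

lemma one_minus_cnj_mult_moebius:
  fixes b x :: complex
  assumes "norm b < 1" "norm x < 1"
  shows "1 - cnj b * ((b - x) / (1 - cnj b * x)) = of_real (1 - (norm b)\<^sup>2) / (1 - cnj b * x)"
  using one_minus_cnj_mult_nonzero[OF assms]
  unfolding of_real_diff of_real_1 complex_norm_square by (simp add: field_simps)

lemma moebius_involution:
  fixes b x :: complex
  assumes "norm b < 1" "norm x < 1"
  shows "(b - (b - x) / (1 - cnj b * x)) / (1 - cnj b * ((b - x) / (1 - cnj b * x))) = x"
proof -
  have b: "1 - b * cnj b \<noteq> 0"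
    using assms(1) abs_square_less_1[of "norm b"]
    by (metis abs_norm_cancel complex_norm_square less_irrefl of_real_eq_1_iff of_real_power right_minus_eq)
  have "b - (b - x) / (1 - cnj b * x) = x * (1 - b * cnj b) / (1 - cnj b * x)"
    using one_minus_cnj_mult_nonzero[OF assms] by (simp add: field_simps)
  then show ?thesis
    unfolding one_minus_cnj_mult_moebius[OF assms] of_real_diff of_real_1 complex_norm_square
    using b one_minus_cnj_mult_nonzero[OF assms] by simp
qed

lemma nn_integral_moebius_disc:
  fixes b :: complex and F :: "complex \<Rightarrow> ennreal"
  assumes b: "norm b < 1" and F: "F \<in> borel_measurable borel"
  shows "(\<integral>\<^sup>+y. indicator (ball 0 1) y * F y \<partial>lborel)
       = (\<integral>\<^sup>+x. indicator (ball 0 1) x * (F ((b - x) / (1 - cnj b * x)) *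
             ennreal (((1 - (norm b)\<^sup>2) / (norm (1 - cnj b * x))\<^sup>2)\<^sup>2)) \<partial>lborel)"
proof -
  define g where "g x = (b - x) / (1 - cnj b * x)" for x
  note nz = one_minus_cnj_mult_nonzero[OF b]
  have g1: "g x \<in> ball 0 1" if "x \<in> ball 0 1" for x
    using moebius_in_disc[OF b] that by (simp add: g_def)
  have gg: "g (g x) = x" if "x \<in> ball 0 1" for x
    using moebius_involution[OF b] that by (simp add: g_def)
  have der: "(g has_field_derivative - of_real (1 - (norm b)\<^sup>2) / (1 - cnj b * x)\<^sup>2) (at x)" if "norm x < 1" for x
    unfolding g_def using nz[OF that]
    unfolding of_real_diff of_real_1 complex_norm_square
    by (auto intro!: derivative_eq_intros simp: power2_eq_square divide_simps)
       (simp add: algebra_simps)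
  have hol: "g holomorphic_on ball 0 1"
    unfolding holomorphic_on_open[OF open_ball]
    using der by (metis mem_ball_0)
  have inj: "inj_on g (ball 0 1)" by (rule inj_on_inverseI[of _ g]) (rule gg)
  have im: "g ` ball 0 1 = ball 0 1"
  proof
    show "g ` ball 0 1 \<subseteq> ball 0 1" using g1 by blast
    show "ball 0 1 \<subseteq> g ` ball 0 1"
    proof
      fix x :: complex assume x: "x \<in> ball 0 1"
      show "x \<in> g ` ball 0 1" using gg[OF x] g1[OF x] by (metis image_eqI)
    qed
  qed
  have "norm (deriv g x) = (1 - (norm b)\<^sup>2) / (norm (1 - cnj b * x))\<^sup>2" if "norm x < 1" for x
  proof -
    have "\<bar>1 - (norm b)\<^sup>2\<bar> = 1 - (norm b)\<^sup>2" using b by (simp add: power_le_one)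
    then show ?thesis
      unfolding DERIV_imp_deriv[OF der[OF that]] norm_divide norm_minus_cancel norm_of_real norm_power
      by (rule arg_cong)
  qed
  then have "indicator (ball 0 1) x * (F (g x) * ennreal ((norm (deriv g x))\<^sup>2))
      = indicator (ball 0 1) x * (F ((b - x) / (1 - cnj b * x)) *
             ennreal (((1 - (norm b)\<^sup>2) / (norm (1 - cnj b * x))\<^sup>2)\<^sup>2))" for x
    by (cases "x \<in> ball 0 1") (simp_all add: g_def)
  then show ?thesis
    using nn_integral_complex_substitution[OF open_ball hol inj F] unfolding im by simp
qed

section \<open>Sub-mean value inequalities\<close>

lemma holomorphic2_compose:
  assumes g: "holomorphic2_on g U" and S: "open S"
    and h: "h1 holomorphic_on S" "h2 holomorphic_on S"
    and U: "\<And>s. s \<in> S \<Longrightarrow> (h1 s, h2 s) \<in> U"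
  shows "(\<lambda>s. g (h1 s, h2 s)) holomorphic_on S"
  unfolding holomorphic_on_open[OF S]
proof
  fix s assume s: "s \<in> S"
  obtain a b where ab: "(g has_derivative (\<lambda>h. a * fst h + b * snd h)) (at (h1 s, h2 s))"
    using g U[OF s] unfolding holomorphic2_on_def by blast
  obtain d1 d2 where d: "(h1 has_field_derivative d1) (at s)" "(h2 has_field_derivative d2) (at s)"
    using h s unfolding holomorphic_on_open[OF S] by blast
  have "((\<lambda>s. (h1 s, h2 s)) has_derivative (\<lambda>t. (d1 * t, d2 * t))) (at s)"
    using d unfolding has_field_derivative_def by (rule has_derivative_Pair)
  from diff_chain_at[OF this ab]
  have "((\<lambda>s. g (h1 s, h2 s)) has_derivative (\<lambda>t. a * (d1 * t) + b * (d2 * t))) (at s)"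
    by (simp add: o_def)
  moreover have "(\<lambda>t. a * (d1 * t) + b * (d2 * t)) = (*) (a * d1 + b * d2)"
    by (auto simp: algebra_simps)
  ultimately show "\<exists>f'. ((\<lambda>s. g (h1 s, h2 s)) has_field_derivative f') (at s)"
    unfolding has_field_derivative_def by auto
qed

lemma holomorphic2_imp_continuous_on: "holomorphic2_on g U \<Longrightarrow> continuous_on U g"
  unfolding holomorphic2_on_def
  by (meson continuous_at_imp_continuous_on has_derivative_continuous)

text \<open>Cauchy's formula on the unit circle says that the value at the centre is the mean over the circle.\<close>

lemma norm_center_le_circle_mean:
  assumes h: "h holomorphic_on ball 0 R" and R: "R > 1"
  shows "ennreal (norm (h 0)) \<le>
    (\<integral>\<^sup>+t. indicator {0..1} t * ennreal (norm (h (exp (2 * of_real pi * \<i> * of_real t)))) \<partial>lborel)"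
proof -
  define e where "e t = exp (2 * of_real pi * \<i> * of_real t)" for t :: real
  have e: "norm (e t) = 1" for t by (simp add: e_def)
  have cont: "continuous_on {0..1} (\<lambda>t. h (e t))"
    unfolding e_def using R e
    by (intro continuous_on_compose2[OF holomorphic_on_imp_continuous_on[OF h]] continuous_intros)
       (auto simp: e_def)
  have 1: "((\<lambda>u. h u / (u - 0)) has_contour_integral (2 * of_real pi * \<i> * h 0)) (circlepath 0 1)"
    using R by (intro Cauchy_integral_circlepath holomorphic_on_imp_continuous_on holomorphic_on_subset[OF h]) auto
  have "((\<lambda>t. (2 * of_real pi * \<i>) * h (e t)) has_integral (2 * of_real pi * \<i> * h 0)) {0..1}"
  proof (rule has_integral_eq[OF _ 1[unfolded has_contour_integral_def]])
    fix t :: real assume t: "t \<in> {0..1}"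
    have "circlepath 0 1 t = e t" by (simp add: circlepath e_def mult_ac)
    moreover have "vector_derivative (circlepath 0 1) (at t within {0..1}) = 2 * of_real pi * \<i> * e t"
      using t by (simp add: vector_derivative_circlepath01 e_def mult_ac)
    moreover have "e t \<noteq> 0" by (simp add: e_def)
    ultimately show "h (circlepath 0 1 t) / (circlepath 0 1 t - 0) *
        vector_derivative (circlepath 0 1) (at t within {0..1}) = (2 * of_real pi * \<i>) * h (e t)"
      by simp
  qed
  from has_integral_mult_right[OF this, of "inverse (2 * of_real pi * \<i>)"]
  have int: "((\<lambda>t. h (e t)) has_integral h 0) {0..1}"
    by (simp add: field_simps)
  have si: "set_integrable lborel {0..1} (\<lambda>t. h (e t))"
    by (rule borel_integrable_atLeastAtMost'[OF cont])
  have "h 0 = (LINT t:{0..1}|lborel. h (e t))"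
    using set_borel_integral_eq_integral(2)[OF si] int by (simp add: integral_unique)
  also have "ennreal (norm \<dots>) \<le> (\<integral>\<^sup>+t. norm (indicator {0..1} t *\<^sub>R h (e t)) \<partial>lborel)"
    unfolding set_lebesgue_integral_def using si
    by (intro integral_norm_bound_ennreal) (simp add: set_integrable_def)
  also have "\<dots> = (\<integral>\<^sup>+t. indicator {0..1} t * ennreal (norm (h (e t))) \<partial>lborel)"
    by (rule nn_integral_cong) (auto simp: indicator_def)
  finally show ?thesis by (simp add: e_def)
qed

lemma nn_integral_lborel_translate:
  fixes c :: "'a::euclidean_space"
  assumes "F \<in> borel_measurable borel"
  shows "(\<integral>\<^sup>+x. F (c + x) \<partial>lborel) = (\<integral>\<^sup>+x. F x \<partial>lborel)"
proof -
  have "(\<integral>\<^sup>+x. F x \<partial>lborel) = (\<integral>\<^sup>+x. F x \<partial>distr lborel borel ((+) c))"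
    by (simp add: lborel_distr_plus)
  also have "\<dots> = (\<integral>\<^sup>+x. F (c + x) \<partial>lborel)"
    using assms by (intro nn_integral_distr) auto
  finally show ?thesis by simp
qed

text \<open>Lebesgue measure is rotation invariant, so the integral over the disc does not change when the
  integrand is replaced by its average over all rotations. After exchanging the integrals, the inner
  one is a circle mean of \<open>\<bar>f\<bar>\<^sup>2 = \<bar>f\<^sup>2\<bar>\<close>, and \<open>f\<^sup>2\<close> is holomorphic.\<close>

lemma holomorphic_submean_disc:
  assumes f: "f holomorphic_on ball c r" and r: "r > 0"
  shows "ennreal (pi * r\<^sup>2 * (norm (f c))\<^sup>2) \<le>
    (\<integral>\<^sup>+z. indicator (ball c r) z * ennreal ((norm (f z))\<^sup>2) \<partial>lborel)"
proof -
  define e where "e t = exp (2 * of_real pi * \<i> * of_real t)" for t :: real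
  have e: "norm (e t) = 1" for t by (simp add: e_def)
  have [measurable]: "e \<in> borel_measurable borel"
    unfolding e_def by (intro borel_measurable_continuous_onI continuous_intros)
  define q where "q z = indicator (ball c r) z * (norm (f z))\<^sup>2" for z
  have "(\<lambda>z. indicator (ball c r) z *\<^sub>R (norm (f z))\<^sup>2) \<in> borel_measurable borel"
    using f by (intro borel_measurable_continuous_on_indicator continuous_intros
                 holomorphic_on_imp_continuous_on) auto
  then have [measurable]: "q \<in> borel_measurable borel" by (simp add: q_def[abs_def])
  have q0: "q z \<ge> 0" for z by (simp add: q_def)
  define I where "I = (\<integral>\<^sup>+z. ennreal (q z) \<partial>lborel)"
  have rot: "I = (\<integral>\<^sup>+z. ennreal (q (c + e t * z)) \<partial>lborel)" for t
  proof -
    have "e t \<noteq> 0" using e[of t] by auto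
    have "I = (\<integral>\<^sup>+z. ennreal (q (c + z)) \<partial>lborel)"
      unfolding I_def by (rule nn_integral_lborel_translate[symmetric]) simp
    also have "\<dots> = (\<integral>\<^sup>+z. ennreal (q (c + e t * z)) * ennreal ((norm (e t))\<^sup>2) \<partial>lborel)"
      using \<open>e t \<noteq> 0\<close> by (rule nn_integral_complex_scale) simp
    finally show ?thesis by (simp add: e)
  qed
  have mean: "indicator (ball 0 r) z * ennreal ((norm (f c))\<^sup>2)
      \<le> (\<integral>\<^sup>+t. indicator {0..1} t * ennreal (q (c + e t * z)) \<partial>lborel)" for z
  proof (cases "z \<in> ball 0 r")
    case True
    \<comment> \<open>The slice \<open>w \<mapsto> f (c + w z)\<close> is holomorphic on a disc larger than the unit disc.\<close>
    define R where "R = (if z = 0 then 2 else r / norm z)"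
    have R: "R > 1" using True by (auto simp: R_def field_simps)
    have in_ball: "c + w * z \<in> ball c r" if "w \<in> ball 0 R" for w
      using that True r by (auto simp: R_def dist_norm norm_mult field_simps split: if_splits)
    have "(\<lambda>w. (f (c + w * z))\<^sup>2) holomorphic_on ball 0 R"
      using in_ball
      by (intro holomorphic_intros holomorphic_on_compose_gen[OF _ f, unfolded o_def]) auto
    from norm_center_le_circle_mean[OF this R]
    have "ennreal ((norm (f c))\<^sup>2) \<le>
      (\<integral>\<^sup>+t. indicator {0..1} t * ennreal ((norm (f (c + e t * z)))\<^sup>2) \<partial>lborel)"
      by (simp add: e_def norm_power)
    also have "\<dots> = (\<integral>\<^sup>+t. indicator {0..1} t * ennreal (q (c + e t * z)) \<partial>lborel)"
      using in_ball[of "e _"] e R by (intro nn_integral_cong) (auto simp: q_def)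
    finally show ?thesis using True by simp
  qed simp
  have "ennreal (pi * r\<^sup>2 * (norm (f c))\<^sup>2) = ennreal ((norm (f c))\<^sup>2) * emeasure lborel (ball (0::complex) r)"
    using r by (simp add: emeasure_ball unit_ball_vol_2 ennreal_mult' [symmetric] mult_ac)
  also have "\<dots> = (\<integral>\<^sup>+z. indicator (ball (0::complex) r) z * ennreal ((norm (f c))\<^sup>2) \<partial>lborel)"
    by (subst nn_integral_multc) (auto simp: mult.commute intro!: borel_measurable_indicator)
  also have "\<dots> \<le> (\<integral>\<^sup>+z. (\<integral>\<^sup>+t. indicator {0..1} t * ennreal (q (c + e t * z)) \<partial>lborel) \<partial>lborel)"
    by (rule nn_integral_mono) (rule mean)
  also have "\<dots> = (\<integral>\<^sup>+t. (\<integral>\<^sup>+z. indicator {0..1} t * ennreal (q (c + e t * z)) \<partial>lborel) \<partial>lborel)"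
    by (rule lborel_pair.Fubini') measurable
  also have "\<dots> = (\<integral>\<^sup>+t. indicator {0..1::real} t * I \<partial>lborel)"
    by (intro nn_integral_cong, subst nn_integral_cmult) (auto simp: rot[symmetric])
  also have "\<dots> = I"
    by (subst nn_integral_multc) auto
  also have "\<dots> = (\<integral>\<^sup>+z. indicator (ball c r) z * ennreal ((norm (f z))\<^sup>2) \<partial>lborel)"
    unfolding I_def by (rule nn_integral_cong) (auto simp: q_def indicator_def)
  finally show ?thesis .
qed

lemma open_hartogs_tube:
  assumes "continuous_on (ball c r) h"
  shows "open {v :: complex \<times> complex. snd v \<in> ball c r \<and> fst v \<in> ball (h (snd v)) \<rho>}"
proof -
  have c: "continuous_on (UNIV \<times> ball c r) (\<lambda>v :: complex \<times> complex. h (snd v))"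
    by (intro continuous_on_compose2[OF assms] continuous_intros) auto
  have "open ((UNIV \<times> ball c r) \<inter> (\<lambda>v. dist (h (snd v)) (fst v)) -` {..<\<rho>})"
    by (intro continuous_open_preimage continuous_intros c open_Times open_lessThan) auto
  also have "(UNIV \<times> ball c r) \<inter> (\<lambda>v. dist (h (snd v)) (fst v)) -` {..<\<rho>} =
      {v :: complex \<times> complex. snd v \<in> ball c r \<and> fst v \<in> ball (h (snd v)) \<rho>}"
    by auto
  finally show ?thesis .
qed

lemma measurable_square_norm_indicator:
  fixes g :: "'a::topological_space \<Rightarrow> 'b::real_normed_vector"
  assumes "open U" "continuous_on U g" "A \<in> sets borel" "A \<subseteq> U"
  shows "(\<lambda>z. indicator A z * ennreal ((norm (g z))\<^sup>2)) \<in> borel_measurable borel"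
proof -
  have "(\<lambda>z. indicator U z *\<^sub>R (norm (g z))\<^sup>2) \<in> borel_measurable borel"
    using assms by (intro borel_measurable_continuous_on_indicator continuous_intros) auto
  then have "(\<lambda>z. indicator A z * ennreal (indicator U z *\<^sub>R (norm (g z))\<^sup>2)) \<in> borel_measurable borel"
    using assms(3) by measurable
  also have "(\<lambda>z. indicator A z * ennreal (indicator U z *\<^sub>R (norm (g z))\<^sup>2)) =
      (\<lambda>z. indicator A z * ennreal ((norm (g z))\<^sup>2))"
    using assms(4) by (auto simp: indicator_def fun_eq_iff)
  finally show ?thesis .
qed

text \<open>A two-variable version on regions fibred in discs over a disc, where the centre of the fibre moves
  holomorphically. The one-variable inequality is applied first on each fibre and then to the
  holomorphic function \<open>y \<mapsto> g (h y, y)\<close> along the curve of centres.\<close>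

lemma holomorphic2_submean_tube:
  assumes g: "holomorphic2_on g U" and U: "open U" and h: "h holomorphic_on ball c r"
    and r: "r > 0" and \<rho>: "\<rho> > 0"
    and E: "E = {v. snd v \<in> ball c r \<and> fst v \<in> ball (h (snd v)) \<rho>}" and EU: "E \<subseteq> U"
  shows "ennreal ((pi * r\<^sup>2) * (pi * \<rho>\<^sup>2) * (norm (g (h c, c)))\<^sup>2) \<le>
    (\<integral>\<^sup>+v. indicator E v * ennreal ((norm (g v))\<^sup>2) \<partial>lborel)"
proof -
  have [measurable]: "E \<in> sets borel"
    unfolding E using open_hartogs_tube[OF holomorphic_on_imp_continuous_on[OF h]] by auto
  have meas: "(\<lambda>v. indicator E v * ennreal ((norm (g v))\<^sup>2)) \<in> borel_measurable borel"
    using U g EU by (intro measurable_square_norm_indicator) (auto intro: holomorphic2_imp_continuous_on)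
  have slice: "indicator (ball c r) y * ennreal (pi * \<rho>\<^sup>2 * (norm (g (h y, y)))\<^sup>2)
      \<le> (\<integral>\<^sup>+x. indicator E (x, y) * ennreal ((norm (g (x, y)))\<^sup>2) \<partial>lborel)" for y
  proof (cases "y \<in> ball c r")
    case True
    have "(\<lambda>x. g (x, y)) holomorphic_on ball (h y) \<rho>"
      using True EU by (intro holomorphic2_compose[OF g] holomorphic_intros) (auto simp: E)
    from holomorphic_submean_disc[OF this \<rho>] True show ?thesis
      by (simp add: E indicator_def)
  qed simp
  have hol: "(\<lambda>y. g (h y, y)) holomorphic_on ball c r"
    using EU \<rho> by (intro holomorphic2_compose[OF g] holomorphic_intros h) (auto simp: E)
  from holomorphic_submean_disc[OF hol r]
  have "ennreal (pi * \<rho>\<^sup>2) * ennreal (pi * r\<^sup>2 * (norm (g (h c, c)))\<^sup>2) \<le>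
    ennreal (pi * \<rho>\<^sup>2) * (\<integral>\<^sup>+y. indicator (ball c r) y * ennreal ((norm (g (h y, y)))\<^sup>2) \<partial>lborel)"
    by (rule mult_left_mono) simp
  also have "\<dots> = (\<integral>\<^sup>+y. ennreal (pi * \<rho>\<^sup>2) * (indicator (ball c r) y * ennreal ((norm (g (h y, y)))\<^sup>2)) \<partial>lborel)"
    using measurable_square_norm_indicator[of "ball c r" "\<lambda>y. g (h y, y)" "ball c r"]
      holomorphic_on_imp_continuous_on[OF hol]
    by (intro nn_integral_cmult[symmetric]) simp
  also have "\<dots> = (\<integral>\<^sup>+y. indicator (ball c r) y * ennreal (pi * \<rho>\<^sup>2 * (norm (g (h y, y)))\<^sup>2) \<partial>lborel)"
    by (rule nn_integral_cong) (auto simp: indicator_def ennreal_mult')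
  also have "\<dots> \<le> (\<integral>\<^sup>+y. (\<integral>\<^sup>+x. indicator E (x, y) * ennreal ((norm (g (x, y)))\<^sup>2) \<partial>lborel) \<partial>lborel)"
    by (rule nn_integral_mono) (rule slice)
  also have "\<dots> = (\<integral>\<^sup>+v. indicator E v * ennreal ((norm (g v))\<^sup>2) \<partial>(lborel \<Otimes>\<^sub>M lborel))"
    by (rule lborel_pair.nn_integral_snd) (use meas in \<open>simp add: lborel_prod\<close>)
  finally show ?thesis
    by (simp add: lborel_prod ennreal_mult'[symmetric] mult_ac)
qed

section \<open>Square integrable functions and the Bergman space\<close>

definition sqnorm :: "'a measure \<Rightarrow> ('a \<Rightarrow> complex) \<Rightarrow> real" where
  "sqnorm M f = (LINT w|M. (norm (f w))\<^sup>2)"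

definition square_integrable :: "'a measure \<Rightarrow> ('a \<Rightarrow> complex) \<Rightarrow> bool" where
  "square_integrable M f \<longleftrightarrow> f \<in> borel_measurable M \<and> integrable M (\<lambda>w. (norm (f w))\<^sup>2)"

lemma square_integrable_iff:
  "square_integrable M f \<longleftrightarrow> f \<in> borel_measurable M \<and> (\<integral>\<^sup>+w. ennreal ((norm (f w))\<^sup>2) \<partial>M) < \<infinity>"
  unfolding square_integrable_def integrable_iff_bounded by auto

lemma sqnorm_nonneg: "sqnorm M f \<ge> 0"
  by (simp add: sqnorm_def)

lemma nn_integral_sqnorm:
  "square_integrable M f \<Longrightarrow> (\<integral>\<^sup>+w. ennreal ((norm (f w))\<^sup>2) \<partial>M) = ennreal (sqnorm M f)"
  unfolding sqnorm_def square_integrable_def by (intro nn_integral_eq_integral) auto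

lemma square_integrable_mult:
  assumes "square_integrable M f" "square_integrable M g"
  shows "integrable M (\<lambda>w. f w * g w)"
proof (rule Bochner_Integration.integrable_bound)
  show "integrable M (\<lambda>w. (norm (f w))\<^sup>2 + (norm (g w))\<^sup>2)"
    using assms by (auto simp: square_integrable_def)
  show "(\<lambda>w. f w * g w) \<in> borel_measurable M"
    using assms by (auto simp: square_integrable_def)
  have "norm (f w * g w) \<le> (norm (f w))\<^sup>2 + (norm (g w))\<^sup>2" for w
  proof -
    have "0 \<le> norm (f w) * norm (g w)" by simp
    then show ?thesis using sum_squares_bound[of "norm (f w)" "norm (g w)"] by (simp only: norm_mult)
  qed
  then show "AE w in M. norm (f w * g w) \<le> norm ((norm (f w))\<^sup>2 + (norm (g w))\<^sup>2)"
    by (auto simp: norm_mult)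
qed

lemma cnj_borel_measurable [measurable]: "cnj \<in> borel \<rightarrow>\<^sub>M borel"
  by (intro borel_measurable_continuous_onI continuous_intros)

lemma square_integrable_cnj [simp]: "square_integrable M (\<lambda>w. cnj (f w)) \<longleftrightarrow> square_integrable M f"
proof -
  have "square_integrable M (\<lambda>w. cnj (f w))" if "square_integrable M f" for f :: "'a \<Rightarrow> complex"
    using that measurable_compose[OF _ cnj_borel_measurable, of f M] by (simp add: square_integrable_def)
  from this[of f] this[of "\<lambda>w. cnj (f w)"] show ?thesis by auto
qed

lemma sqnorm_cnj [simp]: "sqnorm M (\<lambda>w. cnj (f w)) = sqnorm M f"
  by (simp add: sqnorm_def)

lemma square_integrable_add:
  assumes "square_integrable M f" "square_integrable M g"
  shows "square_integrable M (\<lambda>w. f w + g w)"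
  unfolding square_integrable_def
proof
  show "(\<lambda>w. f w + g w) \<in> borel_measurable M"
    using assms by (auto simp: square_integrable_def)
  show "integrable M (\<lambda>w. (norm (f w + g w))\<^sup>2)"
  proof (rule Bochner_Integration.integrable_bound)
    show "integrable M (\<lambda>w. 2 * (norm (f w))\<^sup>2 + 2 * (norm (g w))\<^sup>2)"
      using assms by (auto simp: square_integrable_def)
    show "(\<lambda>w. (norm (f w + g w))\<^sup>2) \<in> borel_measurable M"
      using assms by (auto simp: square_integrable_def)
    have "(norm (f w + g w))\<^sup>2 \<le> 2 * (norm (f w))\<^sup>2 + 2 * (norm (g w))\<^sup>2" for w
    proof -
      have "(norm (f w + g w))\<^sup>2 \<le> (norm (f w) + norm (g w))\<^sup>2"
        by (intro power_mono norm_triangle_ineq) simp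
      also have "\<dots> \<le> 2 * (norm (f w))\<^sup>2 + 2 * (norm (g w))\<^sup>2"
        using sum_squares_bound[of "norm (f w)" "norm (g w)"] by (simp add: power2_sum)
      finally show ?thesis .
    qed
    then show "AE w in M. norm ((norm (f w + g w))\<^sup>2) \<le> norm (2 * (norm (f w))\<^sup>2 + 2 * (norm (g w))\<^sup>2)"
      by auto
  qed
qed

lemma square_integrable_scale:
  "square_integrable M f \<Longrightarrow> square_integrable M (\<lambda>w. c * f w)"
  by (auto simp: square_integrable_def norm_mult power_mult_distrib)

lemma sqnorm_scale: "sqnorm M (\<lambda>w. c * f w) = (norm c)\<^sup>2 * sqnorm M f"
  by (simp add: sqnorm_def norm_mult power_mult_distrib)

lemma sqnorm_add:
  assumes "square_integrable M f" "square_integrable M g"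
  shows "sqnorm M (\<lambda>w. f w + g w) = sqnorm M f + sqnorm M g + 2 * Re (LINT w|M. f w * cnj (g w))"
proof -
  have i: "integrable M (\<lambda>w. f w * cnj (g w))"
    using assms by (intro square_integrable_mult) auto
  define q where "q w = f w * cnj (g w)" for w
  have "(norm (f w + g w))\<^sup>2 = (norm (f w))\<^sup>2 + (norm (g w))\<^sup>2 + 2 * Re (q w)" for w
    unfolding cmod_power2 q_def by (simp add: power2_eq_square algebra_simps)
  then have "sqnorm M (\<lambda>w. f w + g w) = (LINT w|M. (norm (f w))\<^sup>2 + (norm (g w))\<^sup>2 + 2 * Re (q w))"
    by (simp add: sqnorm_def)
  also have "\<dots> = sqnorm M f + sqnorm M g + 2 * (LINT w|M. Re (q w))"
    using assms integrable_Re[OF i, folded q_def] by (simp add: sqnorm_def square_integrable_def)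
  finally show ?thesis using integral_Re[OF i] by (simp only: q_def)
qed

lemma sqnorm_diff:
  assumes "square_integrable M f" "square_integrable M g"
  shows "sqnorm M (\<lambda>w. f w - g w) = sqnorm M f + sqnorm M g - 2 * Re (LINT w|M. f w * cnj (g w))"
  using sqnorm_add[OF assms(1) square_integrable_scale[OF assms(2), of "-1"]] sqnorm_scale[of M "-1" g]
  by simp

text \<open>The product carries no conjugation, so that the inequality serves both for inner products and for
  the weighted products in the Toeplitz integral.\<close>

lemma sqnorm_Cauchy_Schwarz:
  assumes f: "square_integrable M f" and g: "square_integrable M g"
  shows "(norm (LINT w|M. f w * g w))\<^sup>2 \<le> sqnorm M f * sqnorm M g"
proof -
  have "ennreal ((norm (LINT w|M. f w * g w))\<^sup>2) = (ennreal (norm (LINT w|M. f w * g w)))\<^sup>2"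
    by (simp add: ennreal_power)
  also have "\<dots> \<le> (\<integral>\<^sup>+w. norm (f w * g w) \<partial>M)\<^sup>2"
    by (intro power_mono integral_norm_bound_ennreal square_integrable_mult f g) simp
  also have "\<dots> = (\<integral>\<^sup>+w. ennreal (norm (f w)) * ennreal (norm (g w)) \<partial>M)\<^sup>2"
    by (simp add: norm_mult ennreal_mult')
  also have "\<dots> \<le> (\<integral>\<^sup>+w. (ennreal (norm (f w)))\<^sup>2 \<partial>M) * (\<integral>\<^sup>+w. (ennreal (norm (g w)))\<^sup>2 \<partial>M)"
    using f g by (intro Cauchy_Schwarz_nn_integral) (auto simp: square_integrable_def)
  also have "\<dots> = ennreal (sqnorm M f * sqnorm M g)"
    using nn_integral_sqnorm[OF f] nn_integral_sqnorm[OF g]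
    by (simp add: ennreal_power ennreal_mult sqnorm_nonneg)
  finally show ?thesis by (simp add: sqnorm_nonneg)
qed

text \<open>The nonnegative integral does not see the completion of a measure, even for integrands that are not
  measurable. Hence the norms can be computed with Borel measure.\<close>

lemma nn_integral_lebesgue_on:
  fixes f :: "'a::euclidean_space \<Rightarrow> ennreal"
  assumes "U \<in> sets borel"
  shows "(\<integral>\<^sup>+w. f w \<partial>lebesgue_on U) = (\<integral>\<^sup>+w. indicator U w * f w \<partial>lborel)"
  using assms by (subst nn_integral_restrict_space) (auto simp: nn_integral_completion mult.commute)

lemma Lp_norm_2: "Lp_norm 2 U f < \<infinity> \<longleftrightarrow> (\<integral>\<^sup>+ w. ennreal ((norm (f w))\<^sup>2) \<partial>lebesgue_on U) < \<infinity>"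
  by (simp add: Lp_norm_def Let_def top.not_eq_extremum)

lemma continuous_on_imp_lebesgue_on_measurable:
  fixes f :: "'a::euclidean_space \<Rightarrow> complex"
  assumes "open U" "continuous_on U f"
  shows "f \<in> borel_measurable (lebesgue_on U)"
  using assms by (intro continuous_imp_measurable_on_sets_lebesgue) auto

lemma bergman_space_iff:
  assumes "open U"
  shows "f \<in> bergman_space U \<longleftrightarrow> holomorphic2_on f U \<and> square_integrable (lebesgue_on U) f"
proof -
  have "holomorphic2_on f U \<Longrightarrow> f \<in> borel_measurable (lebesgue_on U)"
    by (intro continuous_on_imp_lebesgue_on_measurable assms holomorphic2_imp_continuous_on)
  then show ?thesis
    unfolding bergman_space_def mem_Collect_eq Lp_norm_2 square_integrable_iff by blast
qed

lemma Lp_norm_2_sqnorm: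
  assumes "square_integrable (lebesgue_on U) f"
  shows "Lp_norm 2 U f = ennreal (sqrt (sqnorm (lebesgue_on U) f))"
proof -
  have "(\<integral>\<^sup>+ w. ennreal (norm (f w) powr 2) \<partial>lebesgue_on U) = ennreal (sqnorm (lebesgue_on U) f)"
    using nn_integral_sqnorm[OF assms] by simp
  then show ?thesis
    unfolding Lp_norm_def by (simp add: Let_def powr_half_sqrt sqnorm_nonneg)
qed

lemma holomorphic2_linear:
  assumes "holomorphic2_on f U" "holomorphic2_on g U"
  shows "holomorphic2_on (\<lambda>w. f w + c * g w) U"
  unfolding holomorphic2_on_def
proof
  fix z assume z: "z \<in> U"
  obtain a b where f: "(f has_derivative (\<lambda>h. a * fst h + b * snd h)) (at z)"
    using assms(1) z unfolding holomorphic2_on_def by blast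
  obtain a' b' where g: "(g has_derivative (\<lambda>h. a' * fst h + b' * snd h)) (at z)"
    using assms(2) z unfolding holomorphic2_on_def by blast
  from has_derivative_add[OF f has_derivative_mult_right[OF g, of c]]
  have "((\<lambda>w. f w + c * g w) has_derivative (\<lambda>h. (a + c * a') * fst h + (b + c * b') * snd h)) (at z)"
    by (simp add: algebra_simps)
  then show "\<exists>a b. ((\<lambda>w. f w + c * g w) has_derivative (\<lambda>h. a * fst h + b * snd h)) (at z)"
    by blast
qed

context
  fixes U :: "(complex \<times> complex) set"
  assumes U: "open U"
begin

lemma bergman_linear:
  assumes "f \<in> bergman_space U" "g \<in> bergman_space U"
  shows "(\<lambda>w. f w + c * g w) \<in> bergman_space U"
  using assms by (auto simp: bergman_space_iff[OF U] intro: holomorphic2_linear square_integrable_add square_integrable_scale)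

lemma bergman_add: "f \<in> bergman_space U \<Longrightarrow> g \<in> bergman_space U \<Longrightarrow> (\<lambda>w. f w + g w) \<in> bergman_space U"
  using bergman_linear[of f g 1] by simp

lemma bergman_diff: "f \<in> bergman_space U \<Longrightarrow> g \<in> bergman_space U \<Longrightarrow> (\<lambda>w. f w - g w) \<in> bergman_space U"
  using bergman_linear[of f g "-1"] by simp

lemma bergman_zero: "(\<lambda>w. 0) \<in> bergman_space U"
  by (auto simp: bergman_space_iff[OF U] square_integrable_def holomorphic2_on_def intro!: exI[of _ 0])

lemma bergman_scale: "f \<in> bergman_space U \<Longrightarrow> (\<lambda>w. c * f w) \<in> bergman_space U"
  using bergman_linear[OF bergman_zero, of f c] by simp

lemma bergman_square_integrable: "f \<in> bergman_space U \<Longrightarrow> square_integrable (lebesgue_on U) f"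
  by (simp add: bergman_space_iff[OF U])

text \<open>Point evaluations are bounded, uniformly near each point: the sub-mean value inequality is applied on
  a polydisc of fixed radius around the evaluation point.\<close>

lemma bergman_local_bound:
  assumes z: "z \<in> U"
  obtains r C where "r > 0" "C \<ge> 0" "ball z r \<subseteq> U"
    "\<And>f w. f \<in> bergman_space U \<Longrightarrow> w \<in> ball z r \<Longrightarrow> (norm (f w))\<^sup>2 \<le> C * sqnorm (lebesgue_on U) f"
proof -
  obtain e where e: "e > 0" "ball z e \<subseteq> U" using U z open_contains_ball by blast
  define r where "r = e / 4"
  have r: "r > 0" using e by (simp add: r_def)
  show thesis
  proof
    show "r > 0" by fact
    show "0 \<le> 1 / (pi * r\<^sup>2)\<^sup>2" by simp
    show "ball z r \<subseteq> U" using e by (auto simp: r_def)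
    fix f w assume f: "f \<in> bergman_space U" and w: "w \<in> ball z r"
    define E where "E = {v :: complex \<times> complex. snd v \<in> ball (snd w) r \<and> fst v \<in> ball (fst w) r}"
    have EU: "E \<subseteq> U"
    proof
      fix v assume v: "v \<in> E"
      have "dist w v \<le> dist (fst w) (fst v) + dist (snd w) (snd v)"
        by (simp add: dist_prod_def sqrt_sum_squares_le_sum)
      also have "\<dots> < r + r" using v by (intro add_strict_mono) (auto simp: E_def)
      finally have "dist z v < e" using w e dist_triangle[of z v w] by (simp add: r_def)
      then show "v \<in> U" using e by auto
    qed
    have hol: "holomorphic2_on f U" and si: "square_integrable (lebesgue_on U) f"
      using f by (auto simp: bergman_space_iff[OF U])
    have "ennreal ((pi * r\<^sup>2)\<^sup>2 * (norm (f w))\<^sup>2) \<le>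
      (\<integral>\<^sup>+v. indicator E v * ennreal ((norm (f v))\<^sup>2) \<partial>lborel)"
      using holomorphic2_submean_tube[OF hol U _ r r E_def EU] by (simp add: power2_eq_square mult_ac)
    also have "\<dots> \<le> (\<integral>\<^sup>+v. indicator U v * ennreal ((norm (f v))\<^sup>2) \<partial>lborel)"
      using EU by (intro nn_integral_mono) (auto simp: indicator_def)
    also have "\<dots> = ennreal (sqnorm (lebesgue_on U) f)"
      using U nn_integral_sqnorm[OF si] by (simp add: nn_integral_lebesgue_on)
    finally have "(pi * r\<^sup>2)\<^sup>2 * (norm (f w))\<^sup>2 \<le> sqnorm (lebesgue_on U) f"
      by (simp add: sqnorm_nonneg)
    then show "(norm (f w))\<^sup>2 \<le> 1 / (pi * r\<^sup>2)\<^sup>2 * sqnorm (lebesgue_on U) f"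
      using r by (simp add: field_simps)
  qed
qed

end

text \<open>Cauchy estimates on the two coordinate discs through \<open>z\<close>.\<close>

lemma partial_derivative_bound:
  assumes f: "holomorphic2_on f V" and V: "ball z (2 * r) \<subseteq> V" and r: "r > 0"
    and D: "(f has_derivative (\<lambda>h. a * fst h + b * snd h)) (at z)"
    and B: "\<And>w. w \<in> ball z (2 * r) \<Longrightarrow> norm (f w) \<le> B"
  shows "norm a \<le> B / r" "norm b \<le> B / r"
proof -
  have in1: "(fst z + s, snd z) \<in> ball z (2 * r)" if "norm s < 2 * r" for s
    using that by (cases z) (simp add: dist_prod_def dist_norm)
  have in2: "(fst z, snd z + s) \<in> ball z (2 * r)" if "norm s < 2 * r" for s
    using that by (cases z) (simp add: dist_prod_def dist_norm)
  have h1: "(\<lambda>s. f (fst z + s, snd z)) holomorphic_on ball 0 (2 * r)"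
    using in1 V by (intro holomorphic2_compose[OF f] holomorphic_intros) auto
  have h2: "(\<lambda>s. f (fst z, snd z + s)) holomorphic_on ball 0 (2 * r)"
    using in2 V by (intro holomorphic2_compose[OF f] holomorphic_intros) auto
  have "((\<lambda>s. (fst z + s, snd z)) has_derivative (\<lambda>s. (s, 0))) (at 0)"
    by (auto intro!: derivative_eq_intros)
  from diff_chain_at[OF this, of f "\<lambda>h. a * fst h + b * snd h"] D
  have "((\<lambda>s. f (fst z + s, snd z)) has_field_derivative a) (at 0)"
    by (simp add: o_def has_field_derivative_def)
  then have d1: "deriv (\<lambda>s. f (fst z + s, snd z)) 0 = a" by (rule DERIV_imp_deriv)
  have "((\<lambda>s. (fst z, snd z + s)) has_derivative (\<lambda>s. (0, s))) (at 0)"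
    by (auto intro!: derivative_eq_intros)
  from diff_chain_at[OF this, of f "\<lambda>h. a * fst h + b * snd h"] D
  have "((\<lambda>s. f (fst z, snd z + s)) has_field_derivative b) (at 0)"
    by (simp add: o_def has_field_derivative_def)
  then have d2: "deriv (\<lambda>s. f (fst z, snd z + s)) 0 = b" by (rule DERIV_imp_deriv)
  have sub: "cball 0 r \<subseteq> ball (0::complex) (2 * r)" "ball 0 r \<subseteq> ball (0::complex) (2 * r)" using r by auto
  have "norm ((deriv ^^ 1) (\<lambda>s. f (fst z + s, snd z)) 0) \<le> fact 1 * B / r ^ 1"
    using r B in1 by (intro Cauchy_inequality holomorphic_on_subset[OF h1 sub(2)] holomorphic_on_imp_continuous_on
         holomorphic_on_subset[OF h1 sub(1)]) auto
  then show "norm a \<le> B / r" by (simp add: d1)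
  have "norm ((deriv ^^ 1) (\<lambda>s. f (fst z, snd z + s)) 0) \<le> fact 1 * B / r ^ 1"
    using r B in2 by (intro Cauchy_inequality holomorphic_on_subset[OF h2 sub(2)] holomorphic_on_imp_continuous_on
         holomorphic_on_subset[OF h2 sub(1)]) auto
  then show "norm b \<le> B / r" by (simp add: d2)
qed

section \<open>Completeness of the Bergman space\<close>

lemma holomorphic2_cong:
  assumes "open U" "\<And>w. w \<in> U \<Longrightarrow> f w = g w" "holomorphic2_on f U"
  shows "holomorphic2_on g U"
  unfolding holomorphic2_on_def
proof
  fix z assume z: "z \<in> U"
  then obtain a b where "(f has_derivative (\<lambda>h. a * fst h + b * snd h)) (at z)"
    using assms(3) unfolding holomorphic2_on_def by blast
  then have "(g has_derivative (\<lambda>h. a * fst h + b * snd h)) (at z)"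
    using has_derivative_transform_within_open[OF _ assms(1) z] assms(2) by blast
  then show "\<exists>a b. (g has_derivative (\<lambda>h. a * fst h + b * snd h)) (at z)" by blast
qed

lemma Lp_norm_cong:
  assumes "\<And>w. w \<in> U \<Longrightarrow> f w = g w"
  shows "Lp_norm p U f = Lp_norm p U g"
proof -
  have "(\<integral>\<^sup>+w. ennreal (norm (f w) powr p) \<partial>lebesgue_on U) = (\<integral>\<^sup>+w. ennreal (norm (g w) powr p) \<partial>lebesgue_on U)"
    using assms by (intro nn_integral_cong) simp
  then show ?thesis by (simp add: Lp_norm_def)
qed

lemma bergman_cong:
  assumes "open U" "\<And>w. w \<in> U \<Longrightarrow> f w = g w" "f \<in> bergman_space U"
  shows "g \<in> bergman_space U"
  using assms holomorphic2_cong[of U f g] Lp_norm_cong[of U f g 2] by (auto simp: bergman_space_def)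

text \<open>Norm convergence of Bergman functions implies locally uniform convergence, since point evaluations are
  locally uniformly bounded.\<close>

lemma bergman_cauchy_uniformly:
  assumes U: "open U" and z: "z \<in> U" and f: "\<And>n. f n \<in> bergman_space U"
    and cauchy: "\<And>e. e > 0 \<Longrightarrow> \<exists>K. \<forall>m\<ge>K. \<forall>n\<ge>K. sqnorm (lebesgue_on U) (\<lambda>w. f m w - f n w) < e"
  obtains r where "r > 0" "ball z r \<subseteq> U" "uniformly_Cauchy_on (ball z r) f"
proof -
  obtain r C where r: "r > 0" "C \<ge> 0" "ball z r \<subseteq> U" and
    bd: "\<And>f w. f \<in> bergman_space U \<Longrightarrow> w \<in> ball z r \<Longrightarrow> (norm (f w))\<^sup>2 \<le> C * sqnorm (lebesgue_on U) f"
    using bergman_local_bound[OF U z] by metis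
  have "uniformly_Cauchy_on (ball z r) f"
  proof (rule uniformly_Cauchy_onI)
    fix e :: real assume e: "e > 0"
    have "e\<^sup>2 / (C + 1) > 0" using e r by simp
    from cauchy[OF this] obtain K where
      K: "\<And>m n. m \<ge> K \<Longrightarrow> n \<ge> K \<Longrightarrow> sqnorm (lebesgue_on U) (\<lambda>w. f m w - f n w) < e\<^sup>2 / (C + 1)"
      by blast
    show "\<exists>K. \<forall>x\<in>ball z r. \<forall>m\<ge>K. \<forall>n\<ge>K. dist (f m x) (f n x) < e"
    proof (intro exI ballI allI impI)
      fix x m n assume *: "x \<in> ball z r" "K \<le> m" "K \<le> n"
      have "(norm (f m x - f n x))\<^sup>2 \<le> C * sqnorm (lebesgue_on U) (\<lambda>w. f m w - f n w)"
        using bd[OF bergman_diff[OF U f f] *(1)] .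
      also have "\<dots> \<le> (C + 1) * sqnorm (lebesgue_on U) (\<lambda>w. f m w - f n w)"
        by (intro mult_right_mono sqnorm_nonneg) simp
      also have "\<dots> < e\<^sup>2" using K[OF *(2,3)] r by (simp add: field_simps)
      finally show "dist (f m x) (f n x) < e"
        using e by (simp add: dist_norm power2_less_imp_less)
    qed
  qed
  with r that show thesis by blast
qed

text \<open>Weierstrass' theorem in two variables. By the Cauchy estimates the partial derivatives form locally
  uniform Cauchy sequences too, and the derivative of the limit is the limit of the derivatives.\<close>

lemma holomorphic2_locally_uniform_limit:
  assumes f: "\<And>n. holomorphic2_on (f n) U"
    and lim: "\<And>w. w \<in> U \<Longrightarrow> (\<lambda>n. f n w) \<longlonglongrightarrow> G w"
    and uc: "\<And>z. z \<in> U \<Longrightarrow> \<exists>r>0. ball z r \<subseteq> U \<and> uniformly_Cauchy_on (ball z r) f"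
  shows "holomorphic2_on G U"
proof -
  have "\<exists>a b. \<forall>w\<in>U. (f n has_derivative (\<lambda>h. a w * fst h + b w * snd h)) (at w)" for n
    using f[of n] unfolding holomorphic2_on_def by metis
  then obtain a b where D:
    "\<And>n w. w \<in> U \<Longrightarrow> (f n has_derivative (\<lambda>h. a n w * fst h + b n w * snd h)) (at w)"
    by metis
  show ?thesis
    unfolding holomorphic2_on_def
  proof
    fix z assume z: "z \<in> U"
    then obtain r where r: "r > 0" "ball z r \<subseteq> U" "uniformly_Cauchy_on (ball z r) f"
      using uc by blast
    \<comment> \<open>Discs of radius \<open>2 \<rho>\<close> around points of \<open>ball z \<rho>\<close> stay inside \<open>ball z r\<close>.\<close>
    define \<rho> where "\<rho> = r / 3"
    have \<rho>: "\<rho> > 0" using r by (simp add: \<rho>_def)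
    define S where "S = ball z \<rho>"
    have SU: "S \<subseteq> U" using r by (auto simp: S_def \<rho>_def)
    have close: "\<exists>K. \<forall>w\<in>S. \<forall>m\<ge>K. \<forall>n\<ge>K. norm (a m w - a n w) < e \<and> norm (b m w - b n w) < e"
      if e: "e > 0" for e
    proof -
      obtain K where K: "\<And>w m n. w \<in> ball z r \<Longrightarrow> m \<ge> K \<Longrightarrow> n \<ge> K \<Longrightarrow> dist (f m w) (f n w) < e * \<rho> / 2"
        using r(3) e \<rho> unfolding uniformly_Cauchy_on_def by (metis half_gt_zero mult_pos_pos)
      show ?thesis
      proof (intro exI ballI allI impI)
        fix w m n assume *: "w \<in> S" "K \<le> m" "K \<le> n"
        have sub: "ball w (2 * \<rho>) \<subseteq> ball z r"
        proof
          fix v assume "v \<in> ball w (2 * \<rho>)"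
          then show "v \<in> ball z r"
            using *(1) dist_triangle[of z v w] by (simp add: S_def \<rho>_def)
        qed
        have h: "holomorphic2_on (\<lambda>w. f m w - f n w) U"
          using holomorphic2_linear[OF f[of m] f[of n], of "-1"] by simp
        have "w \<in> U" using * SU by blast
        from has_derivative_diff[OF D[OF this] D[OF this]]
        have d: "((\<lambda>w. f m w - f n w) has_derivative
           (\<lambda>h. (a m w - a n w) * fst h + (b m w - b n w) * snd h)) (at w)"
          by (simp add: algebra_simps)
        have "norm (f m v - f n v) \<le> e * \<rho> / 2" if "v \<in> ball w (2 * \<rho>)" for v
          using K[of v m n] that sub * by (auto simp: dist_norm less_imp_le)
        from partial_derivative_bound[OF h subset_trans[OF sub r(2)] \<rho> d this]
        show "norm (a m w - a n w) < e \<and> norm (b m w - b n w) < e"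
          using \<rho> e by auto
      qed
    qed
    have "uniformly_Cauchy_on S a" "uniformly_Cauchy_on S b"
      unfolding uniformly_Cauchy_on_def dist_norm using close by meson+
    then have ul: "uniform_limit S a (\<lambda>w. lim (\<lambda>n. a n w)) sequentially"
        "uniform_limit S b (\<lambda>w. lim (\<lambda>n. b n w)) sequentially"
      using Cauchy_uniformly_convergent uniformly_convergent_uniform_limit_iff by blast+
    define a' where "a' w = lim (\<lambda>n. a n w)" for w
    define b' where "b' w = lim (\<lambda>n. b n w)" for w
    have "\<exists>g. \<forall>x\<in>S. (\<lambda>n. f n x) \<longlonglongrightarrow> g x \<and>
        (g has_derivative (\<lambda>h. a' x * fst h + b' x * snd h)) (at x within S)"
    proof (rule has_derivative_sequence)
      show "convex S" by (simp add: S_def)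
      show "z \<in> S" using \<rho> by (simp add: S_def)
      show "(\<lambda>n. f n z) \<longlonglongrightarrow> G z" using lim z by blast
      show "(f n has_derivative (\<lambda>h. a n x * fst h + b n x * snd h)) (at x within S)" if "x \<in> S" for n x
        using D SU that by (blast intro: has_derivative_at_withinI)
      fix e :: real assume e: "e > 0"
      have "\<forall>\<^sub>F n in sequentially. \<forall>x\<in>S. dist (a n x) (a' x) < e / 2"
        "\<forall>\<^sub>F n in sequentially. \<forall>x\<in>S. dist (b n x) (b' x) < e / 2"
        using ul e unfolding uniform_limit_iff a'_def b'_def by (meson half_gt_zero)+
      then show "\<forall>\<^sub>F n in sequentially. \<forall>x\<in>S. \<forall>h.
          norm (a n x * fst h + b n x * snd h - (a' x * fst h + b' x * snd h)) \<le> e * norm h"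
      proof eventually_elim
        case (elim n)
        show ?case
        proof (intro ballI allI)
          fix x and h :: "complex \<times> complex" assume x: "x \<in> S"
          have "norm (a n x * fst h + b n x * snd h - (a' x * fst h + b' x * snd h))
              = norm ((a n x - a' x) * fst h + (b n x - b' x) * snd h)"
            by (simp add: algebra_simps)
          also have "\<dots> \<le> norm (a n x - a' x) * norm (fst h) + norm (b n x - b' x) * norm (snd h)"
            by (metis norm_mult norm_triangle_ineq)
          also have "\<dots> \<le> e / 2 * norm h + e / 2 * norm h"
            using elim x e
            norm_fst_le[of "fst h" "snd h"] norm_snd_le[of "snd h" "fst h"]
            by (intro add_mono mult_mono) (auto simp: dist_norm less_imp_le)
          finally show "norm (a n x * fst h + b n x * snd h - (a' x * fst h + b' x * snd h)) \<le> e * norm h"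
            by (simp add: algebra_simps)
        qed
      qed
    qed
    then obtain g where g: "\<And>x. x \<in> S \<Longrightarrow> (\<lambda>n. f n x) \<longlonglongrightarrow> g x"
      "\<And>x. x \<in> S \<Longrightarrow> (g has_derivative (\<lambda>h. a' x * fst h + b' x * snd h)) (at x within S)"
      by blast
    have zS: "z \<in> S" and oS: "open S" using \<rho> by (auto simp: S_def)
    have "(g has_derivative (\<lambda>h. a' z * fst h + b' z * snd h)) (at z)"
      using g(2)[OF zS] at_within_open[OF zS oS] by simp
    moreover have "g x = G x" if "x \<in> S" for x
      using LIMSEQ_unique[OF g(1)[OF that] lim] SU that by blast
    ultimately have "(G has_derivative (\<lambda>h. a' z * fst h + b' z * snd h)) (at z)"
      using has_derivative_transform_within_open[OF _ oS zS] by blast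
    then show "\<exists>a b. (G has_derivative (\<lambda>h. a * fst h + b * snd h)) (at z)" by blast
  qed
qed

text \<open>The limit is built pointwise, from locally uniform convergence. Fatou's lemma turns the Cauchy property
  into convergence in norm.\<close>

lemma bergman_complete:
  assumes U: "open U" and f: "\<And>n. f n \<in> bergman_space U"
    and cauchy: "\<And>e. e > 0 \<Longrightarrow> \<exists>K. \<forall>m\<ge>K. \<forall>n\<ge>K. sqnorm (lebesgue_on U) (\<lambda>w. f m w - f n w) < e"
  obtains G where "G \<in> bergman_space U" "(\<lambda>n. sqnorm (lebesgue_on U) (\<lambda>w. f n w - G w)) \<longlonglongrightarrow> 0"
proof -
  let ?M = "lebesgue_on U"
  define G where "G w = lim (\<lambda>n. f n w)" for w
  have uc: "\<exists>r>0. ball z r \<subseteq> U \<and> uniformly_Cauchy_on (ball z r) f" if z: "z \<in> U" for z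
    using bergman_cauchy_uniformly[OF U z f cauchy] by metis
  have lim: "(\<lambda>n. f n w) \<longlonglongrightarrow> G w" if w: "w \<in> U" for w
  proof -
    obtain r where r: "r > 0" "uniformly_Cauchy_on (ball w r) f" using uc[OF w] by blast
    then have "Cauchy (\<lambda>n. f n w)"
      by (intro uniformly_Cauchy_imp_Cauchy[OF r(2)]) simp
    then show ?thesis unfolding G_def by (simp add: Cauchy_convergent_iff convergent_LIMSEQ_iff)
  qed
  have hol: "holomorphic2_on G U"
  proof (rule holomorphic2_locally_uniform_limit[OF _ lim uc])
    show "holomorphic2_on (f n) U" for n using f[of n] by (simp add: bergman_space_iff[OF U])
  qed
  have meas: "G \<in> borel_measurable ?M" "\<And>n. f n \<in> borel_measurable ?M"
    using continuous_on_imp_lebesgue_on_measurable[OF U holomorphic2_imp_continuous_on[OF hol]]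
      bergman_square_integrable[OF U f] by (simp_all add: square_integrable_def)
  have fatou: "(\<integral>\<^sup>+w. ennreal ((norm (f n w - G w))\<^sup>2) \<partial>?M) \<le> ennreal e"
    if K: "\<And>m. m \<ge> K \<Longrightarrow> sqnorm ?M (\<lambda>w. f n w - f m w) < e" for n K e
  proof -
    have "(\<integral>\<^sup>+w. ennreal ((norm (f n w - G w))\<^sup>2) \<partial>?M) =
        (\<integral>\<^sup>+w. liminf (\<lambda>m. ennreal ((norm (f n w - f m w))\<^sup>2)) \<partial>?M)"
    proof (rule nn_integral_cong)
      fix w assume "w \<in> space ?M"
      then have w: "w \<in> U" by simp
      have "(\<lambda>m. ennreal ((norm (f n w - f m w))\<^sup>2)) \<longlonglongrightarrow> ennreal ((norm (f n w - G w))\<^sup>2)"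
        using lim[OF w] by (intro tendsto_ennrealI tendsto_intros)
      then show "ennreal ((norm (f n w - G w))\<^sup>2) = liminf (\<lambda>m. ennreal ((norm (f n w - f m w))\<^sup>2))"
        by (intro lim_imp_Liminf[symmetric]) auto
    qed
    also have "\<dots> \<le> liminf (\<lambda>m. \<integral>\<^sup>+w. ennreal ((norm (f n w - f m w))\<^sup>2) \<partial>?M)"
      using meas by (intro nn_integral_liminf) auto
    also have "\<dots> = liminf (\<lambda>m. ennreal (sqnorm ?M (\<lambda>w. f n w - f m w)))"
      using bergman_square_integrable[OF U bergman_diff[OF U f f]] by (simp add: nn_integral_sqnorm)
    also have "\<dots> \<le> limsup (\<lambda>m. ennreal (sqnorm ?M (\<lambda>w. f n w - f m w)))"
      by (rule Liminf_le_Limsup) simp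
    also have "\<dots> \<le> ennreal e"
      using K by (intro Limsup_bounded eventually_sequentiallyI[of K] ennreal_leI) (simp add: less_imp_le)
    finally show ?thesis .
  qed
  have diff_hol: "holomorphic2_on (\<lambda>w. f n w - G w) U" for n
    using holomorphic2_linear[OF _ hol, of "f n" "-1"] f[of n] by (simp add: bergman_space_iff[OF U])
  have ev: "\<exists>K. \<forall>n\<ge>K. (\<lambda>w. f n w - G w) \<in> bergman_space U \<and> sqnorm ?M (\<lambda>w. f n w - G w) \<le> e"
    if e: "e > 0" for e
  proof -
    obtain K where K: "\<And>m n. m \<ge> K \<Longrightarrow> n \<ge> K \<Longrightarrow> sqnorm ?M (\<lambda>w. f m w - f n w) < e"
      using cauchy[OF e] by blast
    show ?thesis
    proof (intro exI allI impI)
      fix n assume n: "K \<le> n"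
      have le: "(\<integral>\<^sup>+w. ennreal ((norm (f n w - G w))\<^sup>2) \<partial>?M) \<le> ennreal e"
        using K[OF n] by (intro fatou)
      then have si: "square_integrable ?M (\<lambda>w. f n w - G w)"
        using meas by (auto simp: square_integrable_iff intro: le_less_trans)
      with le e have "sqnorm ?M (\<lambda>w. f n w - G w) \<le> e"
        by (simp add: nn_integral_sqnorm)
      with si show "(\<lambda>w. f n w - G w) \<in> bergman_space U \<and> sqnorm ?M (\<lambda>w. f n w - G w) \<le> e"
        using diff_hol by (simp add: bergman_space_iff[OF U])
    qed
  qed
  obtain n where "(\<lambda>w. f n w - G w) \<in> bergman_space U" using ev[of 1] by auto
  from bergman_diff[OF U f this, of n] have G: "G \<in> bergman_space U" by simp
  have "(\<lambda>n. sqnorm ?M (\<lambda>w. f n w - G w)) \<longlonglongrightarrow> 0"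
  proof (rule LIMSEQ_I)
    fix e :: real assume "e > 0"
    then obtain K where K: "\<And>n. n \<ge> K \<Longrightarrow> sqnorm ?M (\<lambda>w. f n w - G w) \<le> e / 2"
      using ev[of "e / 2"] by auto
    have "norm (sqnorm ?M (\<lambda>w. f n w - G w) - 0) < e" if "n \<ge> K" for n
      using K[OF that] \<open>e > 0\<close> sqnorm_nonneg[of ?M "\<lambda>w. f n w - G w"] by simp
    then show "\<exists>K. \<forall>n\<ge>K. norm (sqnorm ?M (\<lambda>w. f n w - G w) - 0) < e" by blast
  qed
  with G that show thesis by blast
qed

section \<open>Riesz representation, the Bergman kernel and Toeplitz operators\<close>

text \<open>Choosing \<open>t\<close> small with the sign opposite to \<open>d\<close> makes the linear term win.\<close>

lemma quadratic_nonneg_imp_zero: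
  fixes A d :: real
  assumes A: "A \<ge> 0" and pos: "\<And>t. t\<^sup>2 * A + 2 * t * d \<ge> 0"
  shows "d = 0"
proof (rule ccontr)
  assume d: "d \<noteq> 0"
  have "(- d / (A + 1))\<^sup>2 * A + 2 * (- d / (A + 1)) * d = - (d\<^sup>2 * (A + 2)) / (A + 1)\<^sup>2"
  proof -
    have "(- d / B)\<^sup>2 * (B - 1) + 2 * (- d / B) * d = - (d\<^sup>2 * (B + 1)) / B\<^sup>2" if "B \<noteq> 0" for B
      using that by (simp add: field_simps power2_eq_square)
    from this[of "A + 1"] A show ?thesis by (simp add: add.commute)
  qed
  moreover have "- (d\<^sup>2 * (A + 2)) / (A + 1)\<^sup>2 < 0"
    using A d by (intro divide_neg_pos) (auto intro!: mult_pos_pos)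
  ultimately show False using pos[of "- d / (A + 1)"] by simp
qed

text \<open>The representing element minimises the functional \<open>J f = \<parallel>f\<parallel>\<^sup>2 - 2 Re (\<Lambda> f)\<close>. By the parallelogram law
  every minimising sequence is Cauchy. The first-order condition at its limit \<open>G\<close> is
  \<open>Re (\<Lambda> h) = Re \<langle>h, G\<rangle>\<close> for all \<open>h\<close>; replacing \<open>h\<close> by \<open>\<i> h\<close> gives the imaginary parts.\<close>

lemma bergman_riesz:
  assumes U: "open U"
    and add: "\<And>f g. f \<in> bergman_space U \<Longrightarrow> g \<in> bergman_space U \<Longrightarrow> \<Lambda> (\<lambda>w. f w + g w) = \<Lambda> f + \<Lambda> g"
    and scale: "\<And>c f. f \<in> bergman_space U \<Longrightarrow> \<Lambda> (\<lambda>w. c * f w) = c * (\<Lambda> f :: complex)"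
    and bd: "\<And>f. f \<in> bergman_space U \<Longrightarrow> (norm (\<Lambda> f))\<^sup>2 \<le> C * sqnorm (lebesgue_on U) f"
  obtains G where "G \<in> bergman_space U"
    "\<And>f. f \<in> bergman_space U \<Longrightarrow> \<Lambda> f = (LINT w|lebesgue_on U. f w * cnj (G w))"
proof -
  let ?M = "lebesgue_on U"
  let ?A = "bergman_space U"
  let ?N = "sqnorm ?M"
  note si = bergman_square_integrable[OF U]
  define J where "J f = ?N f - 2 * Re (\<Lambda> f)" for f
  have J_lower: "J f \<ge> - \<bar>C\<bar>" if f: "f \<in> ?A" for f
  proof -
    have "(2 * norm (\<Lambda> f))\<^sup>2 = 4 * (norm (\<Lambda> f))\<^sup>2" by (simp add: power_mult_distrib)
    also have "\<dots> \<le> 4 * (\<bar>C\<bar> * ?N f)"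
      using bd[OF f] mult_right_mono[OF abs_ge_self[of C] sqnorm_nonneg[of ?M f]] by linarith
    also have "\<dots> \<le> (\<bar>C\<bar> + ?N f)\<^sup>2"
      using sum_squares_bound[of "\<bar>C\<bar>" "?N f"] by (simp add: power2_sum)
    finally have "2 * norm (\<Lambda> f) \<le> \<bar>C\<bar> + ?N f"
      by (rule power2_le_imp_le) (simp add: sqnorm_nonneg)
    then show ?thesis using complex_Re_le_cmod[of "\<Lambda> f"] by (simp add: J_def)
  qed
  define m where "m = Inf (J ` ?A)"
  have bdd: "bdd_below (J ` ?A)" using J_lower by (auto simp: bdd_below_def)
  have m_le: "m \<le> J f" if "f \<in> ?A" for f
    unfolding m_def using that bdd by (intro cInf_lower) auto
  have "\<exists>f\<in>?A. J f < m + 1 / real (Suc n)" for n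
  proof -
    have "Inf (J ` ?A) < m + 1 / real (Suc n)" by (simp add: m_def)
    moreover have "J ` ?A \<noteq> {}" using bergman_zero[OF U] by blast
    ultimately show ?thesis using cInf_lessD[of "J ` ?A"] by blast
  qed
  then obtain f where f: "\<And>n. f n \<in> ?A" and fJ: "\<And>n. J (f n) < m + 1 / real (Suc n)" by metis
  have para: "?N (\<lambda>w. g w - h w) \<le> 2 * (J g - m) + 2 * (J h - m)" if g: "g \<in> ?A" and h: "h \<in> ?A" for g h
  proof -
    have "m \<le> J (\<lambda>w. (1/2) * (g w + h w))"
      by (intro m_le bergman_scale[OF U] bergman_add[OF U] g h)
    also have "\<dots> = ?N (\<lambda>w. g w + h w) / 4 - Re (\<Lambda> g) - Re (\<Lambda> h)"
      unfolding J_def sqnorm_scale scale[OF bergman_add[OF U g h]] add[OF g h]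
      by (simp add: power2_eq_square add_divide_distrib)
    finally have "4 * m \<le> ?N (\<lambda>w. g w + h w) - 4 * Re (\<Lambda> g) - 4 * Re (\<Lambda> h)" by simp
    with sqnorm_add[OF si[OF g] si[OF h]] sqnorm_diff[OF si[OF g] si[OF h]]
    show ?thesis by (simp add: J_def)
  qed
  have "\<exists>K. \<forall>i\<ge>K. \<forall>j\<ge>K. ?N (\<lambda>w. f i w - f j w) < e" if e: "e > 0" for e
  proof -
    obtain K where K: "1 / real (Suc K) < e / 4" using nat_approx_posE[of "e / 4"] e by auto
    have small: "J (f i) - m < e / 4" if "i \<ge> K" for i
    proof -
      have "1 / real (Suc i) \<le> 1 / real (Suc K)" using that by (simp add: frac_le)
      with K fJ[of i] show ?thesis by linarith
    qed
    have "?N (\<lambda>w. f i w - f j w) < e" if "i \<ge> K" "j \<ge> K" for i j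
    proof (rule le_less_trans[OF para[OF f f]])
      show "2 * (J (f i) - m) + 2 * (J (f j) - m) < e"
        using add_strict_mono[OF small[OF that(1)] small[OF that(2)]] by simp
    qed
    then show ?thesis by blast
  qed
  note f_cauchy = this
  obtain G where G: "G \<in> ?A" and lim: "(\<lambda>n. ?N (\<lambda>w. f n w - G w)) \<longlonglongrightarrow> 0"
    by (rule bergman_complete[OF U f f_cauchy])
  define ip where "ip g h = (LINT w|?M. g w * cnj (h w))" for g h
  have Re_eq: "Re (\<Lambda> h) = Re (ip G h)" if h: "h \<in> ?A" for h
  proof -
    have int: "integrable ?M (\<lambda>w. g w * cnj (h w))" if "g \<in> ?A" for g
      using si[OF that] si[OF h] by (intro square_integrable_mult) auto
    have "(\<lambda>n. norm (ip (f n) h - ip G h)) \<longlonglongrightarrow> 0"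
    proof (rule tendsto_sandwich)
      show "(\<lambda>n. 0) \<longlonglongrightarrow> (0::real)" by simp
      have "(\<lambda>n. sqrt (?N (\<lambda>w. f n w - G w) * ?N h)) \<longlonglongrightarrow> sqrt (0 * ?N h)"
        by (intro tendsto_intros lim)
      then show "(\<lambda>n. sqrt (?N (\<lambda>w. f n w - G w) * ?N h)) \<longlonglongrightarrow> 0" by simp
      have "norm (ip (f n) h - ip G h) \<le> sqrt (?N (\<lambda>w. f n w - G w) * ?N h)" for n
      proof -
        have "ip (f n) h - ip G h = (LINT w|?M. (f n w - G w) * cnj (h w))"
          unfolding ip_def using int[OF f] int[OF G] by (simp add: algebra_simps)
        then show ?thesis
          using sqnorm_Cauchy_Schwarz[of ?M "\<lambda>w. f n w - G w" "\<lambda>w. cnj (h w)"]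
            si[OF bergman_diff[OF U f G]] si[OF h] by (simp add: real_le_rsqrt)
      qed
      then show "\<forall>\<^sub>F n in sequentially. norm (ip (f n) h - ip G h) \<le> sqrt (?N (\<lambda>w. f n w - G w) * ?N h)"
        by simp
    qed simp
    then have ip_lim: "(\<lambda>n. ip (f n) h) \<longlonglongrightarrow> ip G h"
      by (simp add: tendsto_norm_zero_iff LIM_zero_iff)
    have "t\<^sup>2 * ?N h + 2 * t * (Re (ip G h) - Re (\<Lambda> h)) \<ge> 0" for t
    proof (rule LIMSEQ_le)
      show "(\<lambda>n. - 1 / real (Suc n)) \<longlonglongrightarrow> 0"
        using tendsto_minus[OF LIMSEQ_inverse_real_of_nat] by (simp add: inverse_eq_divide)
      show "(\<lambda>n. t\<^sup>2 * ?N h + 2 * t * (Re (ip (f n) h) - Re (\<Lambda> h)))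
          \<longlonglongrightarrow> t\<^sup>2 * ?N h + 2 * t * (Re (ip G h) - Re (\<Lambda> h))"
        by (intro tendsto_intros ip_lim)
      have "- 1 / real (Suc n) \<le> t\<^sup>2 * ?N h + 2 * t * (Re (ip (f n) h) - Re (\<Lambda> h))" for n
      proof -
        have th: "(\<lambda>w. of_real t * h w) \<in> ?A" by (rule bergman_scale[OF U h])
        have "ip (f n) (\<lambda>w. of_real t * h w) = (LINT w|?M. of_real t * (f n w * cnj (h w)))"
          unfolding ip_def by (simp add: mult_ac)
        also have "\<dots> = of_real t * ip (f n) h" unfolding ip_def by simp
        finally have ipt: "ip (f n) (\<lambda>w. of_real t * h w) = of_real t * ip (f n) h" .
        have "m \<le> J (\<lambda>w. f n w + of_real t * h w)"
          by (intro m_le bergman_add[OF U] f th)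
        also have "\<dots> = J (f n) + t\<^sup>2 * ?N h + 2 * t * (Re (ip (f n) h) - Re (\<Lambda> h))"
          unfolding J_def sqnorm_add[OF si[OF f] si[OF th]] add[OF f th] scale[OF h] sqnorm_scale
            ip_def[symmetric] ipt
          by (simp add: algebra_simps)
        finally show ?thesis using fJ[of n] by simp
      qed
      then show "\<exists>N. \<forall>n\<ge>N. - 1 / real (Suc n) \<le> t\<^sup>2 * ?N h + 2 * t * (Re (ip (f n) h) - Re (\<Lambda> h))"
        by blast
    qed
    from quadratic_nonneg_imp_zero[OF sqnorm_nonneg this] show ?thesis by simp
  qed
  have "\<Lambda> h = (LINT w|?M. h w * cnj (G w))" if h: "h \<in> ?A" for h
  proof -
    have flip: "Re (ip G k) = Re (LINT w|?M. k w * cnj (G w))" for k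
    proof -
      have "(LINT w|?M. k w * cnj (G w)) = (LINT w|?M. cnj (G w * cnj (k w)))" by (simp add: mult.commute)
      also have "\<dots> = cnj (ip G k)" unfolding ip_def by (rule Bochner_Integration.integral_cnj)
      finally show ?thesis by simp
    qed
    have "Re (\<Lambda> (\<lambda>w. \<i> * h w)) = Re (LINT w|?M. (\<i> * h w) * cnj (G w))"
      using Re_eq[OF bergman_scale[OF U h]] flip by metis
    also have "(LINT w|?M. (\<i> * h w) * cnj (G w)) = \<i> * (LINT w|?M. h w * cnj (G w))"
      by (simp add: mult.assoc)
    finally have "Im (\<Lambda> h) = Im (LINT w|?M. h w * cnj (G w))"
      by (simp add: scale[OF h])
    with Re_eq[OF h] flip[of h] show ?thesis by (simp add: complex_eq_iff)
  qed
  with G that show thesis by blast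
qed

lemma bergman_eq_zero_of_sqnorm:
  assumes U: "open U" and k: "k \<in> bergman_space U" and z: "sqnorm (lebesgue_on U) k = 0" and w: "w \<in> U"
  shows "k w = 0"
proof -
  obtain r C where "r > 0" "\<And>f v. f \<in> bergman_space U \<Longrightarrow> v \<in> ball w r \<Longrightarrow>
      (norm (f v))\<^sup>2 \<le> C * sqnorm (lebesgue_on U) f"
    using bergman_local_bound[OF U w] by metis
  from this(2)[OF k, of w] \<open>r > 0\<close> z show ?thesis by simp
qed

text \<open>For fixed \<open>z\<close> the difference of the two candidates is a Bergman function that is orthogonal to every
  Bergman function, in particular to itself.\<close>

lemma is_bergman_kernel_unique:
  assumes U: "open U" and K: "is_bergman_kernel U K" and L: "is_bergman_kernel U L"
  shows "K = L"
proof (intro ext)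
  fix z w
  show "K z w = L z w"
  proof (cases "z \<in> U \<and> w \<in> U")
    case True
    define k where "k w = cnj (K z w) - cnj (L z w)" for w
    have kA: "(\<lambda>w. cnj (K z w)) \<in> bergman_space U" "(\<lambda>w. cnj (L z w)) \<in> bergman_space U"
      using K L True by (auto simp: is_bergman_kernel_def)
    have k: "k \<in> bergman_space U"
      unfolding k_def by (rule bergman_diff[OF U kA])
    have "k z = (LINT w|lebesgue_on U. k w * K z w)" "k z = (LINT w|lebesgue_on U. k w * L z w)"
      using K L True k by (auto simp: is_bergman_kernel_def)
    then have "(LINT w|lebesgue_on U. k w * K z w) - (LINT w|lebesgue_on U. k w * L z w) = 0" by simp
    moreover have "integrable (lebesgue_on U) (\<lambda>w. k w * K z w)" "integrable (lebesgue_on U) (\<lambda>w. k w * L z w)"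
      using bergman_square_integrable[OF U k] kA[THEN bergman_square_integrable[OF U]]
      by (intro square_integrable_mult; simp)+
    ultimately have "(LINT w|lebesgue_on U. k w * K z w - k w * L z w) = 0" by simp
    moreover have "k w * K z w - k w * L z w = of_real ((norm (k w))\<^sup>2)" for w
      unfolding complex_norm_square by (simp add: k_def algebra_simps)
    ultimately have "(LINT w|lebesgue_on U. complex_of_real ((norm (k w))\<^sup>2)) = 0"
      by simp
    then have "complex_of_real (sqnorm (lebesgue_on U) k) = 0"
      unfolding sqnorm_def integral_complex_of_real .
    then have "k w = 0"
      using bergman_eq_zero_of_sqnorm[OF U k] True by simp
    then show ?thesis by (simp add: k_def)
  next
    case False
    then show ?thesis using K L unfolding is_bergman_kernel_def by metis
  qed
qed

text \<open>Point evaluation at \<open>z\<close> is a bounded functional, and the kernel is the conjugate of its Riesz representative.\<close>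

lemma is_bergman_kernel_exists:
  assumes U: "open U"
  shows "\<exists>K. is_bergman_kernel U K"
proof -
  have "\<exists>G\<in>bergman_space U. \<forall>f\<in>bergman_space U. f z = (LINT w|lebesgue_on U. f w * cnj (G w))"
    if z: "z \<in> U" for z
  proof -
    obtain r C where r: "r > 0" and bd: "\<And>f v. f \<in> bergman_space U \<Longrightarrow> v \<in> ball z r \<Longrightarrow>
        (norm (f v))\<^sup>2 \<le> C * sqnorm (lebesgue_on U) f"
      using bergman_local_bound[OF U z] by metis
    show ?thesis
    proof (rule bergman_riesz[OF U, of "\<lambda>f. f z" C])
      show "(norm (f z))\<^sup>2 \<le> C * sqnorm (lebesgue_on U) f" if "f \<in> bergman_space U" for f
        using bd[OF that, of z] r by simp
    qed (simp_all, blast)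
  qed
  then obtain G where G: "\<And>z. z \<in> U \<Longrightarrow> G z \<in> bergman_space U"
    "\<And>z f. z \<in> U \<Longrightarrow> f \<in> bergman_space U \<Longrightarrow> f z = (LINT w|lebesgue_on U. f w * cnj (G z w))"
    by metis
  define K where "K z w = (if z \<in> U \<and> w \<in> U then cnj (G z w) else 0)" for z w
  have "is_bergman_kernel U K"
    unfolding is_bergman_kernel_def
  proof (intro conjI ballI allI impI)
    fix z assume z: "z \<in> U"
    show "(\<lambda>w. cnj (K z w)) \<in> bergman_space U"
      by (rule bergman_cong[OF U _ G(1)[OF z]]) (simp add: K_def z)
    fix g assume g: "g \<in> bergman_space U"
    have "(LINT w|lebesgue_on U. g w * K z w) = (LINT w|lebesgue_on U. g w * cnj (G z w))"
      by (rule Bochner_Integration.integral_cong) (auto simp: K_def z)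
    then show "g z = (LINT w|lebesgue_on U. g w * K z w)" using G(2)[OF z g] by simp
  qed (auto simp: K_def)
  then show ?thesis by blast
qed

lemma is_bergman_kernel_bergman_kernel:
  assumes "open U"
  shows "is_bergman_kernel U (bergman_kernel U)"
  unfolding bergman_kernel_def
proof -
  obtain K where K: "is_bergman_kernel U K" using is_bergman_kernel_exists[OF assms] by blast
  show "is_bergman_kernel U (THE K. is_bergman_kernel U K)"
    by (rule theI[of _ K]) (rule K, rule is_bergman_kernel_unique[OF assms _ K])
qed

text \<open>The reduction of the theorem to an integral inequality. Since \<open>\<bar>u\<bar>\<close> is a Carleson density, multiplication by
  \<open>sqrt \<bar>u\<bar>\<close> maps the Bergman space boundedly into the square integrable functions. All
  integrals are split accordingly, \<open>u = v s\<close> with \<open>\<bar>v\<bar> = s\<close> and \<open>s\<^sup>2 = \<bar>u\<bar>\<close>.\<close>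

lemma toeplitz_bounded_if_carleson:
  assumes U: "open U" and u: "u \<in> borel_measurable (lebesgue_on U)" and C: "C \<ge> 0"
    and carleson: "\<And>g. g \<in> bergman_space U \<Longrightarrow>
      (\<integral>\<^sup>+w. ennreal (norm (u w) * (norm (g w))\<^sup>2) \<partial>lebesgue_on U) \<le> ennreal (C * sqnorm (lebesgue_on U) g)"
  shows "toeplitz_defined U u \<and> bounded_on_bergman_space U (toeplitz U u)"
proof -
  let ?M = "lebesgue_on U"
  let ?A = "bergman_space U"
  let ?N = "sqnorm ?M"
  note si = bergman_square_integrable[OF U]
  \<comment> \<open>At zeros of \<open>u\<close> the quotient \<open>v\<close> is 0 by the convention for division, as it should be.\<close>
  define s where "s w = complex_of_real (sqrt (norm (u w)))" for w
  define v where "v w = u w / s w" for w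
  have meas [measurable]: "s \<in> borel_measurable ?M" "v \<in> borel_measurable ?M"
    unfolding s_def v_def using u by measurable
  have vs: "v w * s w = u w" for w by (simp add: v_def s_def)
  have nv: "norm (v w) = norm (s w)" for w
    by (simp add: v_def s_def norm_divide real_div_sqrt)
  have weighted: "square_integrable ?M (\<lambda>w. x w * g w) \<and> ?N (\<lambda>w. x w * g w) \<le> C * ?N g"
    if x: "x \<in> borel_measurable ?M" "\<And>w. norm (x w) = norm (s w)" and g: "g \<in> ?A" for x g
  proof -
    have "(norm (x w * g w))\<^sup>2 = norm (u w) * (norm (g w))\<^sup>2" for w
      using x(2)[of w] by (simp add: norm_mult power_mult_distrib s_def)
    then have le: "(\<integral>\<^sup>+w. ennreal ((norm (x w * g w))\<^sup>2) \<partial>?M) \<le> ennreal (C * ?N g)"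
      using carleson[OF g] by simp
    have "square_integrable ?M (\<lambda>w. x w * g w)"
      unfolding square_integrable_iff
    proof
      show "(\<lambda>w. x w * g w) \<in> borel_measurable ?M"
        using x(1) si[OF g] by (auto simp: square_integrable_def)
      show "(\<integral>\<^sup>+w. ennreal ((norm (x w * g w))\<^sup>2) \<partial>?M) < \<infinity>"
        using le by (rule le_less_trans) simp
    qed
    with le show ?thesis
      using C sqnorm_nonneg[of ?M g] by (simp add: nn_integral_sqnorm)
  qed
  note ws = weighted[OF meas(1) refl] and wv = weighted[OF meas(2) nv]
  have int: "integrable ?M (\<lambda>w. u w * g w * cnj (k w))" if g: "g \<in> ?A" and k: "k \<in> ?A" for g k
  proof -
    have "integrable ?M (\<lambda>w. (v w * g w) * cnj (s w * k w))"
      using wv[OF g] ws[OF k] square_integrable_cnj[of ?M "\<lambda>w. s w * k w"]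
      by (intro square_integrable_mult) (simp_all only: simp_thms)
    moreover have "(v w * g w) * cnj (s w * k w) = u w * g w * cnj (k w)" for w
      using vs[of w, symmetric] by (simp add: s_def)
    ultimately show ?thesis by (simp only:)
  qed
  note ker = is_bergman_kernel_bergman_kernel[OF U, unfolded is_bergman_kernel_def]
  have kA: "(\<lambda>w. cnj (bergman_kernel U z w)) \<in> ?A" if "z \<in> U" for z
    using ker that by blast
  have rep: "g z = (LINT w|?M. g w * bergman_kernel U z w)" if "z \<in> U" "g \<in> ?A" for g z
    using ker that by blast
  have intK: "integrable ?M (\<lambda>w. u w * g w * bergman_kernel U z w)" if g: "g \<in> ?A" and z: "z \<in> U" for g z
    using int[OF g kA[OF z]] by simp
  have G_ex: "\<exists>G\<in>?A. (\<forall>z\<in>U. toeplitz U u g z = G z) \<and> ?N G \<le> C\<^sup>2 * ?N g" if g: "g \<in> ?A" for g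
  proof -
    define \<Lambda> where "\<Lambda> f = (LINT w|?M. f w * cnj (u w * g w))" for f
    have int': "integrable ?M (\<lambda>w. f w * cnj (u w * g w))" if f: "f \<in> ?A" for f
    proof -
      have "integrable ?M (\<lambda>w. cnj (u w * g w * cnj (f w)))"
        using int[OF g f] by (rule integrable_cnj)
      then show ?thesis by (simp add: mult_ac)
    qed
    have bd: "(norm (\<Lambda> f))\<^sup>2 \<le> C\<^sup>2 * ?N g * ?N f" if f: "f \<in> ?A" for f
    proof -
      have "cnj (u w) = cnj (v w) * s w" for w
        using arg_cong[OF vs[of w], of cnj] by (simp add: s_def)
      then have "f w * cnj (u w * g w) = (s w * f w) * cnj (v w * g w)" for w
        by simp
      then have "\<Lambda> f = (LINT w|?M. (s w * f w) * cnj (v w * g w))" unfolding \<Lambda>_def by (simp only:)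
      then have "(norm (\<Lambda> f))\<^sup>2 \<le> ?N (\<lambda>w. s w * f w) * ?N (\<lambda>w. v w * g w)"
        using sqnorm_Cauchy_Schwarz[of ?M "\<lambda>w. s w * f w" "\<lambda>w. cnj (v w * g w)"] ws[OF f] wv[OF g]
          sqnorm_cnj[of ?M "\<lambda>w. v w * g w"] square_integrable_cnj[of ?M "\<lambda>w. v w * g w"]
        by (simp only: simp_thms)
      also have "\<dots> \<le> (C * ?N f) * (C * ?N g)"
        using ws[OF f] wv[OF g] C sqnorm_nonneg by (intro mult_mono) auto
      finally show ?thesis by (simp add: power2_eq_square mult_ac)
    qed
    obtain G where G: "G \<in> ?A" and GL: "\<And>f. f \<in> ?A \<Longrightarrow> \<Lambda> f = (LINT w|?M. f w * cnj (G w))"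
    proof (rule bergman_riesz[OF U, of \<Lambda> "C\<^sup>2 * ?N g"])
      show "\<Lambda> (\<lambda>w. f w + h w) = \<Lambda> f + \<Lambda> h" if "f \<in> ?A" "h \<in> ?A" for f h
        unfolding \<Lambda>_def using int'[OF that(1)] int'[OF that(2)] by (simp add: distrib_right)
      show "\<Lambda> (\<lambda>w. c * f w) = c * \<Lambda> f" if "f \<in> ?A" for c f
        unfolding \<Lambda>_def by (simp add: mult.assoc)
    qed (use bd in auto)
    have "toeplitz U u g z = G z" if z: "z \<in> U" for z
    proof -
      let ?k = "\<lambda>w. cnj (bergman_kernel U z w)"
      have "toeplitz U u g z = (LINT w|?M. cnj (?k w * cnj (u w * g w)))"
        unfolding toeplitz_def by (simp add: mult_ac)
      also have "\<dots> = cnj (\<Lambda> ?k)" unfolding \<Lambda>_def by (rule Bochner_Integration.integral_cnj)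
      also have "\<dots> = (LINT w|?M. cnj (?k w * cnj (G w)))"
        unfolding GL[OF kA[OF z]] by (rule Bochner_Integration.integral_cnj[symmetric])
      also have "\<dots> = G z" unfolding rep[OF z G] by (simp add: mult_ac)
      finally show ?thesis .
    qed
    moreover have "?N G \<le> C\<^sup>2 * ?N g"
    proof (cases "?N G = 0")
      case False
      have "\<Lambda> G = (LINT w|?M. of_real ((norm (G w))\<^sup>2))"
        unfolding GL[OF G] complex_norm_square ..
      then have "\<Lambda> G = of_real (?N G)" by (simp add: sqnorm_def del: of_real_power)
      then have "?N G * ?N G \<le> C\<^sup>2 * ?N g * ?N G"
        using bd[OF G] by (simp add: power2_eq_square)
      then show ?thesis using False sqnorm_nonneg[of ?M G] by simp
    qed (simp add: sqnorm_nonneg)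
    ultimately show ?thesis using G by blast
  qed
  have "toeplitz_defined U u"
    unfolding toeplitz_defined_def using intK by blast
  moreover have "bounded_on_bergman_space U (toeplitz U u)"
    unfolding bounded_on_bergman_space_def
  proof (intro conjI ballI allI)
    show "toeplitz U u g \<in> ?A" if g: "g \<in> ?A" for g
    proof -
      obtain G where G: "G \<in> ?A" "\<forall>z\<in>U. toeplitz U u g z = G z" using G_ex[OF g] by blast
      show ?thesis by (rule bergman_cong[OF U _ G(1)]) (simp add: G(2))
    qed
    show "toeplitz U u (\<lambda>w. f w + g w) z = toeplitz U u f z + toeplitz U u g z"
      if "f \<in> ?A" "g \<in> ?A" "z \<in> U" for f g z
      unfolding toeplitz_def using intK[OF that(1,3)] intK[OF that(2,3)]
      by (simp add: distrib_left distrib_right)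
    show "toeplitz U u (\<lambda>w. c * g w) z = c * toeplitz U u g z"
      if "g \<in> ?A" "z \<in> U" for c g z
    proof -
      have "toeplitz U u (\<lambda>w. c * g w) z = (LINT w|?M. c * (u w * g w * bergman_kernel U z w))"
        unfolding toeplitz_def by (simp add: mult_ac)
      then show ?thesis unfolding toeplitz_def by simp
    qed
    show "\<exists>B. \<forall>g\<in>?A. Lp_norm 2 U (toeplitz U u g) \<le> ennreal B * Lp_norm 2 U g"
    proof (intro exI ballI)
      fix g assume g: "g \<in> ?A"
      obtain G where G: "G \<in> ?A" "\<forall>z\<in>U. toeplitz U u g z = G z" "?N G \<le> C\<^sup>2 * ?N g"
        using G_ex[OF g] by blast
      have "Lp_norm 2 U (toeplitz U u g) = Lp_norm 2 U G"
        using G by (intro Lp_norm_cong) auto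
      also have "\<dots> = ennreal (sqrt (?N G))" by (rule Lp_norm_2_sqnorm[OF si[OF G(1)]])
      also have "\<dots> \<le> ennreal (sqrt (C\<^sup>2 * ?N g))"
        using G(3) by (intro ennreal_leI real_sqrt_le_mono)
      also have "\<dots> = ennreal C * ennreal (sqrt (?N g))"
        using C by (simp add: real_sqrt_mult ennreal_mult sqnorm_nonneg)
      also have "\<dots> = ennreal C * Lp_norm 2 U g" by (simp add: Lp_norm_2_sqnorm[OF si[OF g]])
      finally show "Lp_norm 2 U (toeplitz U u g) \<le> ennreal C * Lp_norm 2 U g" .
    qed
  qed
  ultimately show ?thesis ..
qed

section \<open>The domain and its maps\<close>

text \<open>A Bernoulli type bound. Near \<open>y = 1\<close> it follows from \<open>exp x \<ge> 1 + x\<close> and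
  \<open>ln (1 / y) \<le> 1 / y - 1\<close>; for \<open>y < 1 / 2\<close> the left side is at most 1 and the factor 2 suffices. Applied with exponents
  \<open>\<gamma>\<close> and \<open>1 / \<gamma>\<close>, it makes \<open>1 - y powr \<gamma>\<close> and \<open>1 - y\<close> comparable.\<close>

lemma one_minus_powr_le:
  fixes y \<gamma> :: real
  assumes y: "0 \<le> y" "y < 1" and \<gamma>: "\<gamma> > 0"
  shows "1 - y powr \<gamma> \<le> (2 + 2 * \<gamma>) * (1 - y)"
proof (cases "y < 1 / 2")
  case True
  have "1 - y powr \<gamma> \<le> 2 * (1 - y)" using True powr_ge_zero[of y \<gamma>] by argo
  also have "\<dots> \<le> (2 + 2 * \<gamma>) * (1 - y)" using y \<gamma> by (intro mult_right_mono) auto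
  finally show ?thesis .
next
  case False
  then have y': "y \<ge> 1 / 2" by simp
  have "ln (1 / y) \<le> 1 / y - 1" using y' by (intro ln_le_minus_one) auto
  then have "- ln y \<le> (1 - y) / y" using y' by (simp add: ln_div diff_divide_distrib)
  also have "\<dots> \<le> 2 * (1 - y)" using y y' mult_left_mono[of 1 "2 * y" "1 - y"] by (simp add: field_simps)
  finally have "\<gamma> * (- ln y) \<le> \<gamma> * (2 * (1 - y))" using \<gamma> by (intro mult_left_mono) auto
  moreover have "y powr \<gamma> \<ge> 1 + \<gamma> * ln y"
    using y' exp_ge_add_one_self[of "\<gamma> * ln y"] by (simp add: powr_def)
  ultimately have "1 - y powr \<gamma> \<le> 2 * \<gamma> * (1 - y)" by (simp add: algebra_simps)
  also have "\<dots> \<le> (2 + 2 * \<gamma>) * (1 - y)" using y \<gamma> by (intro mult_right_mono) auto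
  finally show ?thesis .
qed

lemma powr_one_minus_ge:
  fixes t \<beta> :: real
  assumes t: "0 \<le> t" "t \<le> 1 / 2" and \<beta>: "\<beta> > 0"
  shows "1 - 2 * \<beta> * t \<le> (1 - t) powr \<beta>"
proof -
  have "ln (1 / (1 - t)) \<le> 1 / (1 - t) - 1" using t by (intro ln_le_minus_one) auto
  then have "- ln (1 - t) \<le> t / (1 - t)" using t by (simp add: ln_div field_simps)
  also have "\<dots> \<le> 2 * t" using t mult_left_mono[of 1 "2 * (1 - t)" t] by (simp add: field_simps)
  finally have "\<beta> * (- ln (1 - t)) \<le> \<beta> * (2 * t)" using \<beta> by (intro mult_left_mono) auto
  moreover have "(1 - t) powr \<beta> \<ge> 1 + \<beta> * ln (1 - t)"
    using t exp_ge_add_one_self[of "\<beta> * ln (1 - t)"] by (simp add: powr_def)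
  ultimately show ?thesis by simp
qed

lemma complex_powr_of_real_mult:
  assumes "r > 0"
  shows "(of_real r * z) powr (of_real \<alpha> :: complex) = of_real (r powr \<alpha>) * z powr of_real \<alpha>"
proof (cases "z = 0")
  case False
  have "(of_real r * z) powr (of_real \<alpha> :: complex) = exp (of_real \<alpha> * (of_real (ln r) + Ln z))"
    using assms False by (simp add: powr_def Ln_times_of_real Ln_of_real)
  also have "\<dots> = of_real (r powr \<alpha>) * z powr of_real \<alpha>"
    using assms False by (simp add: powr_def distrib_left exp_add flip: exp_of_real)
  finally show ?thesis .
qed simp

lemma complex_powr_inverse:
  assumes "Re z > 0"
  shows "z powr \<alpha> * (1 / z) powr (\<alpha> :: complex) = 1"
proof -
  have "z \<noteq> 0" "z \<notin> \<real>\<^sub>\<le>\<^sub>0" using assms by (auto simp: complex_nonpos_Reals_iff)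
  then show ?thesis by (simp add: powr_def Ln_inverse exp_minus flip: inverse_eq_divide)
qed

lemma norm_complex_powr_of_real: "norm (z powr (of_real \<alpha> :: complex)) = norm z powr \<alpha>"
  by (cases "z = 0") (simp_all add: powr_def)

text \<open>The two boundary distances of a point: \<open>sdefect\<close> measures how far the second coordinate is from the
  unit circle, and \<open>fdefect\<close> how far \<open>f_alpha\<close> is from it, which is the distance of the first coordinate
  from the boundary relative to the size of the slice.\<close>

definition sdefect :: "complex \<times> complex \<Rightarrow> real" where
  "sdefect z = 1 - (norm (snd z))\<^sup>2"

definition fdefect :: "real \<Rightarrow> complex \<times> complex \<Rightarrow> real" where
  "fdefect \<alpha> z = 1 - (norm (f_alpha \<alpha> z))\<^sup>2"

lemma norm_f_alpha: "norm (f_alpha \<alpha> z) = norm (fst z) / sdefect z powr (\<alpha> / 2)"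
  by (simp add: f_alpha_def sdefect_def norm_divide)

text \<open>In the coordinates \<open>f_alpha\<close> and \<open>snd\<close> the domain becomes the bidisc condition.\<close>

lemma U_dom_iff:
  assumes \<alpha>: "\<alpha> > 0"
  shows "z \<in> U_dom \<alpha> \<longleftrightarrow> norm (snd z) < 1 \<and> norm (f_alpha \<alpha> z) < 1"
proof (cases "norm (snd z) < 1")
  case False
  then have "(norm (snd z))\<^sup>2 \<ge> 1" by (simp add: one_le_power)
  then have "z \<notin> U_dom \<alpha>"
    using powr_ge_zero[of "norm (fst z)" "2 / \<alpha>"] by (simp add: U_dom_def del: powr_ge_zero)
  with False show ?thesis by simp
next
  case True
  then have q: "sdefect z > 0" by (simp add: sdefect_def abs_square_less_1)
  have "z \<in> U_dom \<alpha> \<longleftrightarrow> norm (fst z) powr (2 / \<alpha>) < sdefect z"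
    by (auto simp: U_dom_def sdefect_def)
  also have "\<dots> \<longleftrightarrow> norm (fst z) powr (2 / \<alpha>) < (sdefect z powr (\<alpha> / 2)) powr (2 / \<alpha>)"
    using q \<alpha> by (simp add: powr_powr)
  also have "\<dots> \<longleftrightarrow> norm (fst z) < sdefect z powr (\<alpha> / 2)"
    using \<alpha> powr_less_mono2[of "2 / \<alpha>" "norm (fst z)" "sdefect z powr (\<alpha> / 2)"]
      powr_mono2[of "2 / \<alpha>" "sdefect z powr (\<alpha> / 2)" "norm (fst z)"] by force
  also have "\<dots> \<longleftrightarrow> norm (f_alpha \<alpha> z) < 1"
    using q by (simp add: norm_f_alpha)
  finally show ?thesis using True by simp
qed

lemma open_U_dom:
  assumes "\<alpha> > 0" shows "open (U_dom \<alpha>)"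
  unfolding U_dom_def using assms
  by (intro open_Collect_less continuous_intros continuous_on_powr') auto

lemma U_dom_bounded:
  assumes "\<alpha> > 0" "z \<in> U_dom \<alpha>"
  shows "norm (fst z) < 1" "norm (snd z) < 1"
proof -
  show "norm (snd z) < 1" using assms U_dom_iff by blast
  have "norm (fst z) powr (2 / \<alpha>) < 1 powr (2 / \<alpha>)"
    using assms(2) by (simp add: U_dom_def) (smt (verit) zero_le_power2)
  then show "norm (fst z) < 1"
    using assms(1) powr_mono2[of "2 / \<alpha>" 1 "norm (fst z)"] by force
qed

lemma sdefect_pos: "\<alpha> > 0 \<Longrightarrow> z \<in> U_dom \<alpha> \<Longrightarrow> sdefect z > 0"
  using U_dom_bounded(2)[of \<alpha> z] by (simp add: sdefect_def abs_square_less_1)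

lemma fdefect_pos: "\<alpha> > 0 \<Longrightarrow> z \<in> U_dom \<alpha> \<Longrightarrow> fdefect \<alpha> z > 0"
  by (simp add: fdefect_def abs_square_less_1 U_dom_iff)

lemma Re_one_minus_cnj_mult_pos:
  fixes b x :: complex
  assumes "norm b < 1" "norm x < 1"
  shows "Re (1 - cnj b * x) > 0"
proof -
  have "norm (cnj b * x) < 1"
    using mult_strict_mono'[OF assms] by (simp add: norm_mult)
  then show ?thesis
    using complex_Re_le_cmod[of "cnj b * x"] by simp
qed

lemma Re_divide_one_minus_cnj_mult_pos:
  fixes b x :: complex
  assumes "norm b < 1" "norm x < 1" "r > 0"
  shows "Re (of_real r / (1 - cnj b * x)) > 0"
  using Re_one_minus_cnj_mult_pos[OF assms(1,2)] assms(3)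
  by (simp add: Re_divide zero_less_divide_iff sum_power2_gt_zero_iff)

text \<open>The second coordinate is the Moebius involution of the disc. On the first one the two factors are
  reciprocal numbers in the right half plane, where principal powers of reciprocals multiply to 1.\<close>

lemma varphi_involution:
  assumes b: "norm b < 1" and x: "norm (snd x) < 1"
  shows "varphi \<alpha> b (varphi \<alpha> b x) = x"
proof -
  define s where "s = complex_of_real (sqrt (1 - (norm b)\<^sup>2))"
  define z where "z = s / (1 - cnj b * snd x)"
  have pos: "sqrt (1 - (norm b)\<^sup>2) > 0" using b by (simp add: abs_square_less_1)
  have ss: "s * s = of_real (1 - (norm b)\<^sup>2)"
    using pos unfolding s_def of_real_mult[symmetric] by simp
  have s0: "s \<noteq> 0" using pos by (simp add: s_def)
  have "s / (1 - cnj b * ((b - snd x) / (1 - cnj b * snd x))) = 1 / z"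
    unfolding one_minus_cnj_mult_moebius[OF b x] ss[symmetric] z_def using s0 by simp
  moreover have "z powr \<alpha> * (1 / z) powr \<alpha> = 1"
    using Re_divide_one_minus_cnj_mult_pos[OF b x pos] by (intro complex_powr_inverse) (simp add: z_def s_def)
  ultimately have "fst (varphi \<alpha> b (varphi \<alpha> b x)) = fst x"
    by (simp add: varphi_def z_def s_def mult.assoc)
  moreover have "snd (varphi \<alpha> b (varphi \<alpha> b x)) = snd x"
    using moebius_involution[OF b x] by (simp add: varphi_def)
  ultimately show ?thesis by (simp add: prod_eq_iff)
qed

text \<open>The factor of \<open>varphi\<close> on the first coordinate is exactly what compensates the change of
  \<open>1 - \<bar>z\<^sub>2\<bar>\<^sup>2\<close> under the Moebius map, so \<open>varphi\<close> moves points along level sets of \<open>\<bar>f_alpha\<bar>\<close>.\<close>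

lemma norm_f_alpha_varphi:
  assumes b: "norm b < 1" and x: "norm (snd x) < 1"
  shows "norm (f_alpha \<alpha> (varphi \<alpha> b x)) = norm (f_alpha \<alpha> x)"
proof -
  define s where "s = sqrt (1 - (norm b)\<^sup>2)"
  define t where "t = s / norm (1 - cnj b * snd x)"
  have s: "s > 0" using b by (simp add: s_def abs_square_less_1)
  have t: "t > 0" using s one_minus_cnj_mult_nonzero[OF b x] by (simp add: t_def)
  have q: "sdefect x > 0" using x by (simp add: sdefect_def abs_square_less_1)
  have "sdefect (varphi \<alpha> b x) = t\<^sup>2 * sdefect x"
    using s moebius_one_minus_norm[OF b x]
    by (simp add: sdefect_def varphi_def t_def s_def power_divide)
  moreover have "(t\<^sup>2 * sdefect x) powr (\<alpha> / 2) = t powr \<alpha> * sdefect x powr (\<alpha> / 2)"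
    using t q by (simp add: powr_mult powr_powr flip: powr_numeral)
  moreover have "norm (fst (varphi \<alpha> b x)) = norm (fst x) * t powr \<alpha>"
    using s by (simp add: varphi_def norm_mult norm_complex_powr_of_real norm_divide t_def s_def)
  ultimately show ?thesis using t by (simp add: norm_f_alpha)
qed

lemma varphi_in_U_dom:
  assumes "\<alpha> > 0" "norm b < 1" "x \<in> U_dom \<alpha>"
  shows "varphi \<alpha> b x \<in> U_dom \<alpha>"
  using assms moebius_in_disc[of b "snd x"] norm_f_alpha_varphi[of b x \<alpha>]
  by (simp add: U_dom_iff) (simp add: varphi_def)

text \<open>The number by which \<open>phi\<close> multiplies the second coordinate; it depends on the first coordinate only.\<close>

definition phi_factor :: "real \<Rightarrow> complex \<Rightarrow> complex \<Rightarrow> complex" where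
  "phi_factor \<alpha> a x = phi2 \<alpha> a (x, 1)"

lemma phi2_factor: "phi2 \<alpha> a w = snd w * phi_factor \<alpha> a (fst w)"
  by (simp add: phi_factor_def phi2_def phi1_def)

text \<open>The Moebius identity cancels all terms with exponent 2. What remains shows that \<open>phi\<close> preserves the
  ratio \<open>\<bar>w\<^sub>2\<bar>\<^sup>2 / (1 - \<bar>w\<^sub>1\<bar> powr (2 / \<alpha>))\<close>, which is less than 1 exactly on the domain.\<close>

lemma norm_phi_factor:
  assumes \<alpha>: "\<alpha> > 0" and a: "norm a < 1" and x: "norm x < 1"
  defines "y \<equiv> (a - x) / (1 - cnj a * x)"
  shows "(norm (phi_factor \<alpha> a x))\<^sup>2 = (1 - norm y powr (2 / \<alpha>)) / (1 - norm x powr (2 / \<alpha>))"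
    and "phi_factor \<alpha> a x \<noteq> 0"
proof -
  have y: "norm y < 1" unfolding y_def by (rule moebius_in_disc[OF a x])
  have pow: "t powr (2 / \<alpha>) < 1" if "0 \<le> t" "t < 1" for t :: real
    using powr_less_mono2[of "2 / \<alpha>" t 1] that \<alpha> by simp
  have pos: "1 - (norm a)\<^sup>2 > 0" "1 - (norm x)\<^sup>2 > 0" "1 - (norm y)\<^sup>2 > 0"
    "1 - norm x powr (2 / \<alpha>) > 0" "1 - norm y powr (2 / \<alpha>) > 0"
    using a x y pow[of "norm x"] pow[of "norm y"] by (simp_all add: abs_square_less_1)
  have nz: "norm (1 - cnj a * x) > 0" using one_minus_cnj_mult_nonzero[OF a x] by simp
  have id: "1 - (norm y)\<^sup>2 = (1 - (norm a)\<^sup>2) * (1 - (norm x)\<^sup>2) / (norm (1 - cnj a * x))\<^sup>2"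
    unfolding y_def by (rule moebius_one_minus_norm[OF a x])
  have "(norm (phi_factor \<alpha> a x))\<^sup>2 = (1 - (norm a)\<^sup>2) / (norm (1 - cnj a * x))\<^sup>2 *
     (((1 - (norm x)\<^sup>2) * (1 - norm y powr (2 / \<alpha>))) / ((1 - norm x powr (2 / \<alpha>)) * (1 - (norm y)\<^sup>2)))"
    using pos by (simp add: phi_factor_def phi2_def phi1_def norm_mult norm_divide power_mult_distrib
        power_divide y_def[symmetric])
  also have "\<dots> = (1 - norm y powr (2 / \<alpha>)) / (1 - norm x powr (2 / \<alpha>))"
    unfolding id using pos nz by simp
  finally show *: "(norm (phi_factor \<alpha> a x))\<^sup>2 = (1 - norm y powr (2 / \<alpha>)) / (1 - norm x powr (2 / \<alpha>))" .
  show "phi_factor \<alpha> a x \<noteq> 0"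
  proof
    assume "phi_factor \<alpha> a x = 0"
    with * pos show False by simp
  qed
qed

lemma phi_in_U_domD:
  assumes \<alpha>: "\<alpha> > 0" and a: "norm a < 1" and \<xi>: "norm (fst \<xi>) < 1" and mem: "phi \<alpha> a \<xi> \<in> U_dom \<alpha>"
  shows "\<xi> \<in> U_dom \<alpha>"
proof -
  define y where "y = (a - fst \<xi>) / (1 - cnj a * fst \<xi>)"
  have y: "norm y < 1" unfolding y_def by (rule moebius_in_disc[OF a \<xi>])
  have pow: "t powr (2 / \<alpha>) < 1" if "0 \<le> t" "t < 1" for t :: real
    using powr_less_mono2[of "2 / \<alpha>" t 1] that \<alpha> by simp
  have pos: "1 - norm (fst \<xi>) powr (2 / \<alpha>) > 0" "1 - norm y powr (2 / \<alpha>) > 0"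
    using \<xi> y pow[of "norm (fst \<xi>)"] pow[of "norm y"] by simp_all
  have "norm y powr (2 / \<alpha>) + (norm (snd \<xi>))\<^sup>2 * ((1 - norm y powr (2 / \<alpha>)) / (1 - norm (fst \<xi>) powr (2 / \<alpha>))) < 1"
    using mem norm_phi_factor(1)[OF \<alpha> a \<xi>, folded y_def]
    by (simp add: U_dom_def phi_def phi2_factor phi1_def y_def norm_mult power_mult_distrib)
  then have "(1 - norm y powr (2 / \<alpha>)) * ((norm (snd \<xi>))\<^sup>2 / (1 - norm (fst \<xi>) powr (2 / \<alpha>))) < (1 - norm y powr (2 / \<alpha>)) * 1"
    by (simp add: mult_ac)
  then have "(norm (snd \<xi>))\<^sup>2 / (1 - norm (fst \<xi>) powr (2 / \<alpha>)) < 1"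
    using pos(2) by (simp only: mult_less_cancel_left_pos)
  then show ?thesis using pos(1) by (simp add: U_dom_def field_simps)
qed

section \<open>Tubes adapted to the domain\<close>

text \<open>Small enough for the error terms in \<open>tube_geometry\<close>, which carry the factors \<open>4\<close>, \<open>\<alpha>\<close> and
  \<open>2 powr (\<alpha> / 2)\<close>.\<close>

definition tube_size :: "real \<Rightarrow> real" where
  "tube_size \<alpha> = 1 / (8 * (4 + \<alpha> + 2 powr (\<alpha> / 2)))"

text \<open>The region on which the sub-mean value inequality at \<open>w\<close> is used. With \<open>\<delta> = fdefect w\<close> and
  \<open>q = sdefect w\<close>, its extent is \<open>\<delta> q powr (\<alpha> / 2)\<close> in the first direction and \<open>sqrt \<delta> q\<close> in the second one: \<open>\<delta>\<close> and
  \<open>sqrt \<delta>\<close> are the normal and tangential scales at a boundary point. A polydisc of these dimensions would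
  leave the domain, because the boundary is tilted. The fibre centres therefore follow the holomorphic
  curve \<open>y \<mapsto> w\<^sub>1 ((1 - cnj w\<^sub>2 y) / q) powr \<alpha>\<close>, which is the image under \<open>varphi\<close> of a disc with constant first coordinate and stays
  close to the level set of \<open>f_alpha\<close> through \<open>w\<close>.\<close>

definition tube :: "real \<Rightarrow> complex \<times> complex \<Rightarrow> (complex \<times> complex) set" where
  "tube \<alpha> w = {v.
     snd v \<in> ball (snd w) (tube_size \<alpha> * sqrt (fdefect \<alpha> w) * sdefect w) \<and>
     fst v \<in> ball (fst w * ((1 - cnj (snd w) * snd v) / of_real (sdefect w)) powr of_real \<alpha>)
        (tube_size \<alpha> * fdefect \<alpha> w * sdefect w powr (\<alpha> / 2))}"

lemma tube_size_bounds:
  assumes "\<alpha> > 0"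
  shows "tube_size \<alpha> > 0" "tube_size \<alpha> \<le> 1 / 32" "tube_size \<alpha> * \<alpha> \<le> 1 / 8"
    "tube_size \<alpha> * (4 + 2 powr (\<alpha> / 2)) \<le> 1 / 8"
proof -
  have pos: "2 powr (\<alpha> / 2) > (0::real)" by simp
  show "tube_size \<alpha> > 0" using assms pos by (simp add: tube_size_def add_pos_pos)
  show "tube_size \<alpha> \<le> 1 / 32" unfolding tube_size_def using assms pos by (intro frac_le) auto
  show "tube_size \<alpha> * \<alpha> \<le> 1 / 8" "tube_size \<alpha> * (4 + 2 powr (\<alpha> / 2)) \<le> 1 / 8"
    using assms pos by (simp_all add: tube_size_def divide_simps add_pos_pos)
qed

text \<open>Points \<open>v\<close> of the tube at \<open>w\<close> see \<open>w\<close> at bounded distance after normalisation: moving \<open>v\<^sub>2\<close> to the origin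
  by \<open>varphi\<close> takes \<open>v\<close> to \<open>(a, 0)\<close> and \<open>w\<close> to a point \<open>x\<close> with \<open>\<bar>a - x\<^sub>1\<bar> \<le> 1 - \<bar>a\<bar>\<^sup>2\<close>.
  The squared pseudohyperbolic distance \<open>t\<close> of the second coordinates is at most a small multiple of \<open>\<delta>\<close>,
  and everything is expressed through \<open>T = (1 - t) powr (\<alpha> / 2)\<close>. The normalised fibre centre \<open>A\<close> has modulus
  \<open>\<bar>f w\<bar> / T\<close>, and \<open>x\<^sub>1 = T\<^sup>2 A\<close>; since \<open>1 - T\<close> is of order \<open>\<delta>\<close>, the numbers \<open>a\<close>, \<open>A\<close> and \<open>x\<^sub>1\<close> agree up to a
  small multiple of \<open>\<delta>\<close>.\<close>

lemma tube_geometry: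
  assumes \<alpha>: "\<alpha> > 0" and w: "w \<in> U_dom \<alpha>" and v: "v \<in> tube \<alpha> w"
  defines "x \<equiv> varphi \<alpha> (snd v) w" and "a \<equiv> f_alpha \<alpha> v"
  shows "v \<in> U_dom \<alpha>"
    and "norm (a - fst x) \<le> 1 - (norm a)\<^sup>2"
    and "1 - (norm a)\<^sup>2 \<le> 2 * fdefect \<alpha> w"
    and "(norm (1 - cnj (snd v) * snd w))\<^sup>2 \<le> 2 * sdefect w * sdefect v"
proof -
  define c where "c = tube_size \<alpha>"
  note cb = tube_size_bounds[OF \<alpha>, folded c_def]
  define \<delta> where "\<delta> = fdefect \<alpha> w"
  define q where "q = sdefect w"
  define k where "k = sdefect v"
  define f where "f = norm (f_alpha \<alpha> w)"
  define d where "d = norm (snd w - snd v)"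
  define p where "p = 1 - cnj (snd w) * snd v"
  have w2: "norm (snd w) < 1" and f1: "f < 1" and f0: "f \<ge> 0"
    using w U_dom_iff[OF \<alpha>] by (auto simp: f_def)
  have q: "q > 0" using sdefect_pos[OF \<alpha> w] by (simp add: q_def)
  have \<delta>: "\<delta> > 0" using fdefect_pos[OF \<alpha> w] by (simp add: \<delta>_def)
  have \<delta>f: "\<delta> = 1 - f\<^sup>2" by (simp add: \<delta>_def f_def fdefect_def)
  have \<delta>1: "\<delta> \<le> 1" by (simp add: \<delta>f)
  have v': "d < c * sqrt \<delta> * q"
    "norm (fst w * (p / of_real q) powr of_real \<alpha> - fst v) < c * \<delta> * q powr (\<alpha> / 2)"
    using v by (auto simp: tube_def d_def c_def \<delta>_def q_def p_def dist_norm)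
  have d0: "d \<ge> 0" by (simp add: d_def)
  have "c * sqrt \<delta> * q \<le> c * 1 * q" using cb q \<delta>1 by (intro mult_right_mono mult_left_mono) auto
  also have "\<dots> \<le> 1 / 32 * q" using cb q by simp
  finally have dq: "d \<le> q / 32" using v' by simp
  have qle: "q \<le> 2 * (1 - norm (snd w))"
  proof -
    have "q = (1 + norm (snd w)) * (1 - norm (snd w))"
      by (simp add: q_def sdefect_def algebra_simps power2_eq_square)
    also have "\<dots> \<le> 2 * (1 - norm (snd w))" using w2 by (intro mult_right_mono) auto
    finally show ?thesis .
  qed
  have v2: "norm (snd v) < 1"
  proof -
    have "norm (snd v) \<le> norm (snd w) + d"
      unfolding d_def by (metis norm_triangle_sub norm_minus_commute add.commute)
    with dq qle w2 show ?thesis by (simp add: field_simps)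
  qed
  have k: "k > 0" using v2 by (simp add: k_def sdefect_def abs_square_less_1)
  have p_ge: "31 / 32 * q \<le> norm p"
  proof -
    have "p = of_real q + cnj (snd w) * (snd w - snd v)"
      unfolding q_def sdefect_def of_real_diff complex_norm_square by (simp add: p_def algebra_simps)
    then have "norm p \<ge> norm (of_real q :: complex) - norm (cnj (snd w) * (snd w - snd v))"
      using norm_diff_ineq by metis
    moreover have "norm (cnj (snd w) * (snd w - snd v)) \<le> 1 * d"
      unfolding norm_mult d_def complex_mod_cnj using w2 by (intro mult_right_mono) auto
    ultimately show ?thesis using dq q by simp
  qed
  then have p0: "norm p > 0" "p \<noteq> 0" using q by auto
  define t where "t = (d / norm p)\<^sup>2"
  have t_eq: "1 - t = q * k / (norm p)\<^sup>2"
    using moebius_one_minus_norm[OF w2 v2]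
    by (simp add: t_def d_def p_def q_def k_def sdefect_def norm_divide)
  have t0: "t \<ge> 0" by (simp add: t_def)
  have t_le: "t \<le> 2 * c\<^sup>2 * \<delta>"
  proof -
    have "d / norm p \<le> (c * sqrt \<delta> * q) / (31 / 32 * q)"
      using v'(1) p_ge q d0 by (intro frac_le) auto
    also have "\<dots> = 32 / 31 * (c * sqrt \<delta>)" using q by simp
    finally have "t \<le> (32 / 31 * (c * sqrt \<delta>))\<^sup>2"
      unfolding t_def using d0 p0 by (intro power_mono) auto
    also have "\<dots> = (32 / 31)\<^sup>2 * (c\<^sup>2 * \<delta>)" using \<delta> by (simp add: power_mult_distrib power2_eq_square)
    also have "\<dots> \<le> 2 * (c\<^sup>2 * \<delta>)" using \<delta> by (intro mult_right_mono) (auto simp: power2_eq_square)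
    also have "\<dots> = 2 * c\<^sup>2 * \<delta>" by simp
    finally show ?thesis .
  qed
  have c2: "c\<^sup>2 \<le> 1 / 32 * c" using cb mult_right_mono[of c "1/32" c] by (simp add: power2_eq_square)
  have cd: "c * \<delta> \<le> 1 / 32"
    using mult_mono[of c "1/32" \<delta> 1] cb \<delta> \<delta>1 by simp
  have c2d: "c\<^sup>2 * \<delta> \<le> 1 / 32 * (c * \<delta>)" using mult_right_mono[OF c2, of \<delta>] \<delta> by simp
  have t_half: "t \<le> 1 / 2" using t_le c2d cd by simp
  have p_sq: "(norm p)\<^sup>2 \<le> 2 * q * k"
  proof -
    have "(1 - t) * (norm p)\<^sup>2 = q * k" using t_eq p0 by simp
    moreover have "1 / 2 * (norm p)\<^sup>2 \<le> (1 - t) * (norm p)\<^sup>2" using t_half by (intro mult_right_mono) auto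
    ultimately show ?thesis by simp
  qed
  have qk: "q \<le> 2 * k"
  proof -
    have "(31 / 32 * q)\<^sup>2 \<le> (norm p)\<^sup>2" using p_ge q by (intro power_mono) auto
    then have "15 / 16 * (31 / 32 * q)\<^sup>2 \<le> (1 - t) * (norm p)\<^sup>2"
      using t_le c2d cd by (intro mult_mono) auto
    also have "\<dots> = q * k" using t_eq p0 by simp
    finally have "15 / 16 * (31 / 32)\<^sup>2 * q * q \<le> k * q" by (simp add: power2_eq_square mult_ac)
    then have "15 / 16 * (31 / 32)\<^sup>2 * q \<le> k" using q by (simp only: mult_le_cancel_right_pos)
    then show ?thesis using q by (simp add: power2_eq_square)
  qed
  \<comment> \<open>As \<open>t\<close> is at most a multiple of \<open>c\<^sup>2 \<delta>\<close>, the extra factor \<open>c\<close> absorbs the constant \<open>\<alpha>\<close>.\<close>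
  define T where "T = (1 - t) powr (\<alpha> / 2)"
  have T_ge: "T \<ge> 1 - c * \<delta>"
  proof -
    have "\<alpha> * t \<le> \<alpha> * (2 * c\<^sup>2 * \<delta>)" using t_le \<alpha> by (intro mult_left_mono) auto
    also have "\<dots> = (c * \<alpha>) * (2 * (c * \<delta>))" by (simp add: power2_eq_square)
    also have "\<dots> \<le> 1 / 8 * (2 * (c * \<delta>))" using cb \<delta> by (intro mult_right_mono) auto
    also have "\<dots> \<le> c * \<delta>" using cb \<delta> by simp
    finally show ?thesis
      using powr_one_minus_ge[OF t0 t_half, of "\<alpha> / 2"] \<alpha> by (simp add: T_def)
  qed
  have T1: "T \<le> 1" unfolding T_def using t0 t_half \<alpha> by (intro powr_le1) auto
  have T34: "T \<ge> 3 / 4" using T_ge cd by simp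
  define Z where "Z = (p / of_real q) powr of_real \<alpha>"
  define m where "m = k powr (\<alpha> / 2)"
  define A where "A = fst w * Z / of_real m"
  have m0: "m > 0" using k by (simp add: m_def)
  have a_eq: "a = fst v / of_real m" by (simp add: a_def f_alpha_def m_def k_def sdefect_def)
  have aA: "norm (a - A) \<le> c * \<delta> * 2 powr (\<alpha> / 2)"
  proof -
    have "norm (a - A) = norm (fst w * Z - fst v) / m"
      unfolding a_eq A_def diff_divide_distrib[symmetric] using m0 by (simp add: norm_divide norm_minus_commute)
    also have "\<dots> \<le> c * \<delta> * q powr (\<alpha> / 2) / m"
      using v'(2) m0 by (intro divide_right_mono) (auto simp: Z_def)
    also have "\<dots> = c * \<delta> * (q / k) powr (\<alpha> / 2)"
      using q k by (simp add: m_def powr_divide)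
    also have "\<dots> \<le> c * \<delta> * 2 powr (\<alpha> / 2)"
      using qk q k \<alpha> cb \<delta> by (intro mult_left_mono powr_mono2) (auto simp: field_simps)
    finally show ?thesis .
  qed
  have x_eq: "fst x = of_real (T\<^sup>2) * A"
  proof -
    \<comment> \<open>The base of the power in \<open>varphi\<close> is a positive multiple of the base in the tube, so that the
      principal powers are related by a real factor.\<close>
    define l where "l = (1 - t) / sqrt k"
    have l0: "l > 0" using t_half k by (simp add: l_def)
    have cp: "1 - cnj (snd v) * snd w = cnj p" by (simp add: p_def mult.commute)
    have pp: "p * cnj p = of_real ((norm p)\<^sup>2)" by (rule complex_norm_square[symmetric])
    have ll: "l * (norm p)\<^sup>2 = q * sqrt k"
      unfolding l_def t_eq using p0 k by (simp add: field_simps)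
    have "of_real (sqrt k) = of_real l * (p / of_real q) * cnj p"
    proof -
      have "of_real l * (p / of_real q) * cnj p = of_real (l * (norm p)\<^sup>2) / (of_real q :: complex)"
        unfolding of_real_mult pp[symmetric] by simp
      also have "\<dots> = of_real (sqrt k)" unfolding ll using q by simp
      finally show ?thesis by simp
    qed
    then have base: "of_real (sqrt k) / (1 - cnj (snd v) * snd w) = of_real l * (p / of_real q)"
      unfolding cp using p0 by simp
    have "fst x = fst w * (of_real (l powr \<alpha>) * Z)"
      unfolding x_def varphi_def fst_conv Z_def complex_powr_of_real_mult[OF l0, symmetric] base[symmetric]
      by (simp add: k_def sdefect_def)
    moreover have "l powr \<alpha> = T\<^sup>2 / m"
    proof -
      have "sqrt k powr \<alpha> = m" using k by (simp add: m_def powr_powr flip: powr_half_sqrt)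
      moreover have "(1 - t) powr \<alpha> = T\<^sup>2" using t_half by (simp add: T_def powr_powr flip: powr_numeral)
      ultimately show ?thesis using t_half k by (simp add: l_def powr_divide)
    qed
    ultimately show ?thesis by (simp add: A_def)
  qed
  have nA: "norm A * T = f"
  proof -
    have nZ: "norm Z = norm p powr \<alpha> / q powr \<alpha>"
      using q p0 by (simp add: Z_def norm_complex_powr_of_real norm_divide powr_divide)
    have "T = (q powr (\<alpha> / 2) * m) / (norm p powr 2) powr (\<alpha> / 2)"
      using q k p0 by (simp add: T_def t_eq m_def powr_divide powr_mult)
    also have "(norm p powr 2) powr (\<alpha> / 2) = norm p powr \<alpha>" unfolding powr_powr by simp
    finally have T: "T = (q powr (\<alpha> / 2) * m) / norm p powr \<alpha>" .
    have "q powr \<alpha> = q powr (\<alpha> / 2) * q powr (\<alpha> / 2)" by (simp flip: powr_add)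
    then have "norm A * T = norm (fst w) / q powr (\<alpha> / 2)"
      unfolding A_def T norm_divide norm_mult nZ using m0 q p0 by simp
    then show ?thesis by (simp add: f_def norm_f_alpha q_def)
  qed
  have A_le: "norm A \<le> 4 / 3"
  proof -
    have "norm A * (3 / 4) \<le> norm A * T" using T34 by (intro mult_left_mono) auto
    with nA f1 show ?thesis by simp
  qed
  have T_gap: "1 - T \<le> c * \<delta>" using T_ge by simp
  have Af: "norm A - f \<le> 2 * (c * \<delta>)" "norm A - f \<ge> 0"
  proof -
    have eq: "norm A - f = norm A * (1 - T)" using nA by (simp add: algebra_simps)
    have "norm A * (1 - T) \<le> 4 / 3 * (c * \<delta>)" using A_le T_gap T1 by (intro mult_mono) auto
    also have "\<dots> \<le> 2 * (c * \<delta>)" using cb \<delta> by simp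
    finally show "norm A - f \<le> 2 * (c * \<delta>)" using eq by simp
    show "norm A - f \<ge> 0" unfolding eq using T1 by (intro mult_nonneg_nonneg) auto
  qed
  have xA: "norm (A - fst x) \<le> 4 * (c * \<delta>)"
  proof -
    have "A - fst x = of_real (1 - T\<^sup>2) * A" by (simp add: x_eq algebra_simps)
    then have "norm (A - fst x) = \<bar>1 - T\<^sup>2\<bar> * norm A"
      by (simp only: norm_mult norm_of_real)
    also have "1 - T\<^sup>2 = (1 - T) * (1 + T)" by (simp add: power2_eq_square algebra_simps)
    also have "\<bar>(1 - T) * (1 + T)\<bar> = (1 - T) * (1 + T)" using T1 T34 by simp
    also have "(1 - T) * (1 + T) * norm A \<le> (c * \<delta>) * 2 * (4 / 3)"
      using A_le T_gap T1 T34 cb \<delta> by (intro mult_mono) auto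
    also have "\<dots> \<le> 4 * (c * \<delta>)" using cb \<delta> by simp
    finally show ?thesis .
  qed
  have cL: "c * \<delta> * (4 + 2 powr (\<alpha> / 2)) \<le> \<delta> / 8"
    using mult_right_mono[OF cb(4), of \<delta>] \<delta> by (simp add: mult_ac)
  have ax: "norm (a - fst x) \<le> \<delta> / 8"
  proof -
    have "norm (a - fst x) \<le> norm (a - A) + norm (A - fst x)" using norm_triangle_ineq[of "a - A" "A - fst x"] by simp
    also have "\<dots> \<le> c * \<delta> * (4 + 2 powr (\<alpha> / 2))" using aA xA by (simp add: algebra_simps)
    finally show ?thesis using cL by simp
  qed
  have af: "\<bar>norm a - f\<bar> \<le> \<delta> / 8"
  proof -
    have "\<bar>norm a - norm A\<bar> \<le> c * \<delta> * 2 powr (\<alpha> / 2)" using norm_triangle_ineq3[of a A] aA by simp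
    with Af have "\<bar>norm a - f\<bar> \<le> c * \<delta> * (4 + 2 powr (\<alpha> / 2))" using cb \<delta> by (simp add: algebra_simps)
    then show ?thesis using cL by simp
  qed
  have "\<bar>(norm a)\<^sup>2 - f\<^sup>2\<bar> = \<bar>norm a - f\<bar> * (norm a + f)"
  proof -
    have "(norm a)\<^sup>2 - f\<^sup>2 = (norm a - f) * (norm a + f)" by (simp add: power2_eq_square algebra_simps)
    then show ?thesis using f0 by (simp add: abs_mult)
  qed
  also have "\<dots> \<le> \<delta> / 8 * 4"
  proof (rule mult_mono)
    have "norm a - f \<le> \<delta> / 8" by (rule order_trans[OF abs_ge_self af])
    then show "norm a + f \<le> 4" using f1 \<delta>1 by simp
  qed (use af f0 \<delta> in auto)
  finally have a2: "\<bar>(norm a)\<^sup>2 - f\<^sup>2\<bar> \<le> \<delta> / 2" by simp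
  have "1 - (norm a)\<^sup>2 = \<delta> - ((norm a)\<^sup>2 - f\<^sup>2)" by (simp add: \<delta>f)
  then have da: "\<delta> / 2 \<le> 1 - (norm a)\<^sup>2" "1 - (norm a)\<^sup>2 \<le> 2 * \<delta>"
    using abs_le_D1[OF a2] abs_le_D2[OF a2] \<delta> by argo+
  show "norm (a - fst x) \<le> 1 - (norm a)\<^sup>2" using ax da \<delta> by simp
  show "1 - (norm a)\<^sup>2 \<le> 2 * fdefect \<alpha> w" using da by (simp add: \<delta>_def)
  have "(norm a)\<^sup>2 < 1" using da \<delta> by simp
  then have "norm a < 1" by (simp add: abs_square_less_1)
  then show "v \<in> U_dom \<alpha>" using v2 by (simp add: U_dom_iff[OF \<alpha>] a_def)
  have "norm (1 - cnj (snd v) * snd w) = norm p"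
  proof -
    have "1 - cnj (snd v) * snd w = cnj p" by (simp add: p_def mult.commute)
    then show ?thesis by simp
  qed
  then show "(norm (1 - cnj (snd v) * snd w))\<^sup>2 \<le> 2 * sdefect w * sdefect v"
    using p_sq by (simp add: q_def k_def)
qed

section \<open>Integration along the maps varphi and phi\<close>

lemma fst_snd_borel_measurable [measurable]:
  "fst \<in> (borel :: ('a::second_countable_topology \<times> 'b::second_countable_topology) measure) \<rightarrow>\<^sub>M borel"
  "snd \<in> (borel :: ('a \<times> 'b) measure) \<rightarrow>\<^sub>M borel"
  by (intro borel_measurable_continuous_onI continuous_intros)+

text \<open>Jacobian of \<open>varphi\<close>: the squared modulus of the factor on the first coordinate times that of the
  derivative of the Moebius map in the second one.\<close>

definition jac_varphi :: "real \<Rightarrow> complex \<Rightarrow> complex \<Rightarrow> real" where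
  "jac_varphi \<alpha> b y = (sqrt (1 - (norm b)\<^sup>2) / norm (1 - cnj b * y)) powr (2 * \<alpha>) *
     ((1 - (norm b)\<^sup>2) / (norm (1 - cnj b * y))\<^sup>2)\<^sup>2"

definition jac_phi :: "real \<Rightarrow> complex \<Rightarrow> complex \<Rightarrow> real" where
  "jac_phi \<alpha> a x = ((1 - (norm a)\<^sup>2) / (norm (1 - cnj a * x))\<^sup>2)\<^sup>2 * (norm (phi_factor \<alpha> a x))\<^sup>2"

lemma jac_nonneg: "jac_varphi \<alpha> b y \<ge> 0" "jac_phi \<alpha> a x \<ge> 0"
  by (simp_all add: jac_varphi_def jac_phi_def)

lemma varphi_measurable [measurable]: "varphi \<alpha> b \<in> borel \<rightarrow>\<^sub>M borel"
  unfolding varphi_def[abs_def] by (simp flip: borel_prod)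

lemma phi_factor_measurable [measurable]: "phi_factor \<alpha> a \<in> borel \<rightarrow>\<^sub>M borel"
  unfolding phi_factor_def[abs_def] phi2_def phi1_def fst_conv snd_conv by measurable

lemma phi_measurable [measurable]: "phi \<alpha> a \<in> borel \<rightarrow>\<^sub>M borel"
  unfolding phi_def[abs_def] phi2_factor phi1_def by (simp flip: borel_prod)

lemma jac_measurable [measurable]:
  "jac_varphi \<alpha> b \<in> borel_measurable borel" "jac_phi \<alpha> a \<in> borel_measurable borel"
  unfolding jac_varphi_def[abs_def] jac_phi_def[abs_def] by measurable

lemma nn_integral_lborel_fst_snd:
  fixes F :: "complex \<times> complex \<Rightarrow> ennreal"
  assumes "F \<in> borel_measurable borel"
  shows "(\<integral>\<^sup>+w. F w \<partial>lborel) = (\<integral>\<^sup>+y. (\<integral>\<^sup>+x. F (x, y) \<partial>lborel) \<partial>lborel)"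
    and "(\<integral>\<^sup>+w. F w \<partial>lborel) = (\<integral>\<^sup>+x. (\<integral>\<^sup>+y. F (x, y) \<partial>lborel) \<partial>lborel)"
proof -
  have F: "F \<in> borel_measurable (lborel \<Otimes>\<^sub>M lborel)" using assms by (simp add: lborel_prod)
  show "(\<integral>\<^sup>+w. F w \<partial>lborel) = (\<integral>\<^sup>+y. (\<integral>\<^sup>+x. F (x, y) \<partial>lborel) \<partial>lborel)"
    using lborel_pair.nn_integral_snd[OF F] by (simp add: lborel_prod)
  show "(\<integral>\<^sup>+w. F w \<partial>lborel) = (\<integral>\<^sup>+x. (\<integral>\<^sup>+y. F (x, y) \<partial>lborel) \<partial>lborel)"
    using lborel.nn_integral_fst[OF F] by (simp add: lborel_prod)
qed

text \<open>For a fixed second coordinate the map is a scaling in the first one, so the formula follows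
  from Tonelli's theorem, the Moebius substitution outside and the scaling substitution inside.\<close>

lemma nn_integral_varphi:
  fixes F :: "complex \<times> complex \<Rightarrow> ennreal"
  assumes b: "norm b < 1" and F: "F \<in> borel_measurable borel"
  shows "(\<integral>\<^sup>+w. indicator (UNIV \<times> ball 0 1) w * F w \<partial>lborel)
       = (\<integral>\<^sup>+x. indicator (UNIV \<times> ball 0 1) x * (F (varphi \<alpha> b x) * ennreal (jac_varphi \<alpha> b (snd x))) \<partial>lborel)"
proof -
  have D [measurable]: "UNIV \<times> ball 0 1 \<in> sets (borel :: (complex \<times> complex) measure)"
    by (intro borel_open open_Times) auto
  note F [measurable]
  have Fp: "F \<in> borel_measurable (borel \<Otimes>\<^sub>M borel)" using F by (simp add: borel_prod)
  define s where "s = complex_of_real (sqrt (1 - (norm b)\<^sup>2))"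
  define h where "h y = (s / (1 - cnj b * y)) powr of_real \<alpha>" for y
  define m where "m y = (b - y) / (1 - cnj b * y)" for y
  define G where "G y = (\<integral>\<^sup>+x. F (x, y) \<partial>lborel)" for y
  have G [measurable]: "G \<in> borel_measurable borel"
    unfolding G_def using Fp by measurable
  have s: "s \<noteq> 0" using b by (auto simp: s_def abs_square_eq_1)
  have "(\<integral>\<^sup>+w. indicator (UNIV \<times> ball 0 1) w * F w \<partial>lborel)
      = (\<integral>\<^sup>+y. (\<integral>\<^sup>+x. indicator (ball 0 1) y * F (x, y) \<partial>lborel) \<partial>lborel)"
    by (subst nn_integral_lborel_fst_snd(1)) (auto intro!: nn_integral_cong simp: indicator_def)
  also have "\<dots> = (\<integral>\<^sup>+y. indicator (ball 0 1) y * G y \<partial>lborel)"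
    unfolding G_def using Fp by (intro nn_integral_cong nn_integral_cmult) measurable
  also have "\<dots> = (\<integral>\<^sup>+y. indicator (ball 0 1) y * (G (m y) *
      ennreal (((1 - (norm b)\<^sup>2) / (norm (1 - cnj b * y))\<^sup>2)\<^sup>2)) \<partial>lborel)"
    unfolding m_def by (rule nn_integral_moebius_disc[OF b G])
  also have "\<dots> = (\<integral>\<^sup>+y. (\<integral>\<^sup>+x. indicator (ball 0 1) y * (F (varphi \<alpha> b (x, y)) * ennreal (jac_varphi \<alpha> b y)) \<partial>lborel) \<partial>lborel)"
  proof (rule nn_integral_cong)
    fix y :: complex
    define j where "j = ((1 - (norm b)\<^sup>2) / (norm (1 - cnj b * y))\<^sup>2)\<^sup>2"
    show "indicator (ball 0 1) y * (G (m y) * ennreal (((1 - (norm b)\<^sup>2) / (norm (1 - cnj b * y))\<^sup>2)\<^sup>2)) =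
      (\<integral>\<^sup>+x. indicator (ball 0 1) y * (F (varphi \<alpha> b (x, y)) * ennreal (jac_varphi \<alpha> b y)) \<partial>lborel)"
    proof (cases "y \<in> ball 0 1")
      case True
      then have h0: "h y \<noteq> 0" using one_minus_cnj_mult_nonzero[OF b, of y] s by (simp add: h_def)
      have Fy: "(\<lambda>x. F (x, m y)) \<in> borel_measurable borel" using Fp by measurable
      have "G (m y) = (\<integral>\<^sup>+x. F (h y * x, m y) * ennreal ((norm (h y))\<^sup>2) \<partial>lborel)"
        unfolding G_def by (rule nn_integral_complex_scale[OF h0 Fy])
      then have "G (m y) * ennreal j = (\<integral>\<^sup>+x. F (h y * x, m y) * ennreal ((norm (h y))\<^sup>2) * ennreal j \<partial>lborel)"
        using Fp by (simp add: nn_integral_multc)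
      also have "\<dots> = (\<integral>\<^sup>+x. F (varphi \<alpha> b (x, y)) * ennreal (jac_varphi \<alpha> b y) \<partial>lborel)"
      proof (rule nn_integral_cong)
        fix x
        have "(norm (h y))\<^sup>2 = (norm (s / (1 - cnj b * y)) powr \<alpha>) powr 2"
          by (simp add: h_def norm_complex_powr_of_real)
        also have "\<dots> = norm (s / (1 - cnj b * y)) powr (2 * \<alpha>)" by (simp only: powr_powr mult.commute)
        also have "norm (s / (1 - cnj b * y)) = sqrt (1 - (norm b)\<^sup>2) / norm (1 - cnj b * y)"
          using b by (simp add: s_def norm_divide abs_square_le_1)
        finally have "jac_varphi \<alpha> b y = (norm (h y))\<^sup>2 * j" by (simp add: jac_varphi_def j_def)
        moreover have "varphi \<alpha> b (x, y) = (h y * x, m y)"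
          by (simp add: varphi_def h_def m_def s_def mult.commute)
        ultimately show "F (h y * x, m y) * ennreal ((norm (h y))\<^sup>2) * ennreal j
            = F (varphi \<alpha> b (x, y)) * ennreal (jac_varphi \<alpha> b y)"
          by (simp add: ennreal_mult j_def mult.assoc)
      qed
      finally show ?thesis using True by (simp add: j_def)
    qed simp
  qed
  also have "\<dots> = (\<integral>\<^sup>+x. indicator (UNIV \<times> ball 0 1) x * (F (varphi \<alpha> b x) * ennreal (jac_varphi \<alpha> b (snd x))) \<partial>lborel)"
  proof (subst nn_integral_lborel_fst_snd(1))
    show "(\<lambda>x. indicator (UNIV \<times> ball 0 1) x * (F (varphi \<alpha> b x) * ennreal (jac_varphi \<alpha> b (snd x)))) \<in> borel_measurable borel"
      by measurable
  qed (auto intro!: nn_integral_cong simp: indicator_def)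
  finally show ?thesis .
qed

text \<open>As for \<open>varphi\<close>, with the coordinates exchanged. The scaling factor of the second coordinate
  is not holomorphic in the first one, but it is constant on each fibre, which is all that enters.\<close>

lemma nn_integral_phi:
  fixes F :: "complex \<times> complex \<Rightarrow> ennreal"
  assumes \<alpha>: "\<alpha> > 0" and a: "norm a < 1" and F: "F \<in> borel_measurable borel"
  shows "(\<integral>\<^sup>+w. indicator (ball 0 1 \<times> UNIV) w * F w \<partial>lborel)
       = (\<integral>\<^sup>+x. indicator (ball 0 1 \<times> UNIV) x * (F (phi \<alpha> a x) * ennreal (jac_phi \<alpha> a (fst x))) \<partial>lborel)"
proof -
  have D [measurable]: "ball 0 1 \<times> UNIV \<in> sets (borel :: (complex \<times> complex) measure)"
    by (intro borel_open open_Times) auto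
  note F [measurable]
  have Fp: "F \<in> borel_measurable (borel \<Otimes>\<^sub>M borel)" using F by (simp add: borel_prod)
  define h where "h = phi_factor \<alpha> a"
  define m where "m y = (a - y) / (1 - cnj a * y)" for y
  define G where "G x = (\<integral>\<^sup>+y. F (x, y) \<partial>lborel)" for x
  have G [measurable]: "G \<in> borel_measurable borel"
    unfolding G_def using Fp by measurable
  have "(\<integral>\<^sup>+w. indicator (ball 0 1 \<times> UNIV) w * F w \<partial>lborel)
      = (\<integral>\<^sup>+x. (\<integral>\<^sup>+y. indicator (ball 0 1) x * F (x, y) \<partial>lborel) \<partial>lborel)"
    by (subst nn_integral_lborel_fst_snd(2)) (auto intro!: nn_integral_cong simp: indicator_def)
  also have "\<dots> = (\<integral>\<^sup>+x. indicator (ball 0 1) x * G x \<partial>lborel)"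
    unfolding G_def using Fp by (intro nn_integral_cong nn_integral_cmult) measurable
  also have "\<dots> = (\<integral>\<^sup>+x. indicator (ball 0 1) x * (G (m x) *
      ennreal (((1 - (norm a)\<^sup>2) / (norm (1 - cnj a * x))\<^sup>2)\<^sup>2)) \<partial>lborel)"
    unfolding m_def by (rule nn_integral_moebius_disc[OF a G])
  also have "\<dots> = (\<integral>\<^sup>+x. (\<integral>\<^sup>+y. indicator (ball 0 1) x * (F (phi \<alpha> a (x, y)) * ennreal (jac_phi \<alpha> a x)) \<partial>lborel) \<partial>lborel)"
  proof (rule nn_integral_cong)
    fix x :: complex
    define j where "j = ((1 - (norm a)\<^sup>2) / (norm (1 - cnj a * x))\<^sup>2)\<^sup>2"
    show "indicator (ball 0 1) x * (G (m x) * ennreal (((1 - (norm a)\<^sup>2) / (norm (1 - cnj a * x))\<^sup>2)\<^sup>2)) =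
      (\<integral>\<^sup>+y. indicator (ball 0 1) x * (F (phi \<alpha> a (x, y)) * ennreal (jac_phi \<alpha> a x)) \<partial>lborel)"
    proof (cases "x \<in> ball 0 1")
      case True
      then have h0: "h x \<noteq> 0" using norm_phi_factor(2)[OF \<alpha> a, of x] by (simp add: h_def)
      have Fy: "(\<lambda>y. F (m x, y)) \<in> borel_measurable borel" using Fp by measurable
      have "G (m x) = (\<integral>\<^sup>+y. F (m x, h x * y) * ennreal ((norm (h x))\<^sup>2) \<partial>lborel)"
        unfolding G_def by (rule nn_integral_complex_scale[OF h0 Fy])
      then have "G (m x) * ennreal j = (\<integral>\<^sup>+y. F (m x, h x * y) * ennreal ((norm (h x))\<^sup>2) * ennreal j \<partial>lborel)"
        using Fp by (simp add: nn_integral_multc)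
      also have "\<dots> = (\<integral>\<^sup>+y. F (phi \<alpha> a (x, y)) * ennreal (jac_phi \<alpha> a x) \<partial>lborel)"
      proof (rule nn_integral_cong)
        fix y
        have "jac_phi \<alpha> a x = (norm (h x))\<^sup>2 * j" by (simp add: jac_phi_def j_def h_def)
        moreover have "phi \<alpha> a (x, y) = (m x, h x * y)"
          by (simp add: phi_def phi2_factor phi1_def h_def m_def mult.commute)
        ultimately show "F (m x, h x * y) * ennreal ((norm (h x))\<^sup>2) * ennreal j
            = F (phi \<alpha> a (x, y)) * ennreal (jac_phi \<alpha> a x)"
          by (simp add: ennreal_mult j_def mult.assoc)
      qed
      finally show ?thesis using True by (simp add: j_def)
    qed simp
  qed
  also have "\<dots> = (\<integral>\<^sup>+x. indicator (ball 0 1 \<times> UNIV) x * (F (phi \<alpha> a x) * ennreal (jac_phi \<alpha> a (fst x))) \<partial>lborel)"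
  proof (subst nn_integral_lborel_fst_snd(2))
    show "(\<lambda>x. indicator (ball 0 1 \<times> UNIV) x * (F (phi \<alpha> a x) * ennreal (jac_phi \<alpha> a (fst x)))) \<in> borel_measurable borel"
      by measurable
  qed (auto intro!: nn_integral_cong simp: indicator_def)
  finally show ?thesis .
qed

text \<open>At the image point \<open>m = (b - y) / (1 - cnj b * y)\<close> the Jacobian is
  \<open>(\<bar>1 - cnj b * m\<bar>\<^sup>2 / (1 - \<bar>b\<bar>\<^sup>2)) powr (\<alpha> + 2)\<close>.\<close>

lemma jac_varphi_bound:
  assumes \<alpha>: "\<alpha> > 0" and b: "norm b < 1" and y: "norm y < 1" and q: "q > 0"
    and le: "(norm (1 - cnj b * ((b - y) / (1 - cnj b * y))))\<^sup>2 \<le> 2 * q * (1 - (norm b)\<^sup>2)"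
  shows "jac_varphi \<alpha> b y \<le> 2 powr (\<alpha> + 2) * q powr (\<alpha> + 2)"
proof -
  define k where "k = 1 - (norm b)\<^sup>2"
  have k: "k > 0" using b by (simp add: k_def abs_square_less_1)
  define r where "r = norm (1 - cnj b * y)"
  have r: "r > 0" using one_minus_cnj_mult_nonzero[OF b y] by (simp add: r_def)
  have "norm (1 - cnj b * ((b - y) / (1 - cnj b * y))) = k / r"
    unfolding one_minus_cnj_mult_moebius[OF b y] norm_divide norm_of_real k_def[symmetric] r_def[symmetric]
    using k by simp
  with le have "(k / r)\<^sup>2 \<le> 2 * q * k" by (simp add: k_def)
  then have le': "k / r\<^sup>2 \<le> 2 * q" using k r by (simp add: power_divide power2_eq_square field_simps)
  have "jac_varphi \<alpha> b y = (sqrt k / r) powr (2 * \<alpha>) * (k / r\<^sup>2)\<^sup>2"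
    by (simp add: jac_varphi_def k_def r_def)
  also have "sqrt k / r = (k / r\<^sup>2) powr (1 / 2)"
    using k r by (simp add: powr_half_sqrt real_sqrt_divide)
  also have "((k / r\<^sup>2) powr (1 / 2)) powr (2 * \<alpha>) = (k / r\<^sup>2) powr \<alpha>" by (simp add: powr_powr)
  also have "(k / r\<^sup>2)\<^sup>2 = (k / r\<^sup>2) powr 2" using k r by simp
  also have "(k / r\<^sup>2) powr \<alpha> * (k / r\<^sup>2) powr 2 = (k / r\<^sup>2) powr (\<alpha> + 2)" by (rule powr_add[symmetric])
  also have "\<dots> \<le> (2 * q) powr (\<alpha> + 2)" using le' k r \<alpha> by (intro powr_mono2) auto
  also have "\<dots> = 2 powr (\<alpha> + 2) * q powr (\<alpha> + 2)" using q by (simp add: powr_mult)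
  finally show ?thesis .
qed

text \<open>With \<open>k = 1 - \<bar>a\<bar>\<^sup>2\<close> and \<open>r = \<bar>1 - cnj a * x\<bar>\<close>, the nearness assumption gives \<open>k / r\<^sup>2 \<le> 4 k\<close>. Both the
  derivative of the Moebius map and, by \<open>one_minus_powr_le\<close>, the squared factor are controlled by
  \<open>k / r\<^sup>2\<close>, with total exponent 3.\<close>

lemma jac_phi_bound:
  assumes \<alpha>: "\<alpha> > 0" and a: "norm a < 1" and x: "norm x < 1" and \<delta>: "\<delta> > 0"
    and near: "norm (a - (a - x) / (1 - cnj a * x)) \<le> 1 - (norm a)\<^sup>2"
    and le: "1 - (norm a)\<^sup>2 \<le> 2 * \<delta>"
  shows "jac_phi \<alpha> a x \<le> 512 * (2 + 2 * \<alpha> + 2 / \<alpha>)\<^sup>2 * \<delta> ^ 3"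
proof -
  define k where "k = 1 - (norm a)\<^sup>2"
  have k: "k > 0" using a by (simp add: k_def abs_square_less_1)
  define r where "r = norm (1 - cnj a * x)"
  have r: "r > 0" using one_minus_cnj_mult_nonzero[OF a x] by (simp add: r_def)
  define y where "y = (a - x) / (1 - cnj a * x)"
  have y: "norm y < 1" unfolding y_def by (rule moebius_in_disc[OF a x])
  define K where "K = 2 + 2 * \<alpha> + 2 / \<alpha>"
  have K0: "K > 0" using \<alpha> by (simp add: K_def add_pos_pos)
  have yr: "norm (1 - cnj a * y) = k / r"
    unfolding y_def one_minus_cnj_mult_moebius[OF a x] norm_divide norm_of_real k_def[symmetric] r_def[symmetric]
    using k by simp
  have "1 - cnj a * y = of_real k + cnj a * (a - y)"
    unfolding k_def of_real_diff complex_norm_square by (simp add: algebra_simps)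
  then have "k / r \<le> norm (of_real k :: complex) + norm (cnj a * (a - y))"
    using norm_triangle_ineq[of "of_real k" "cnj a * (a - y)"] yr by simp
  also have "norm (cnj a * (a - y)) \<le> 1 * k"
    unfolding norm_mult complex_mod_cnj using a near by (intro mult_mono) (auto simp: k_def y_def)
  finally have "k / r \<le> 2 * k" using k by simp
  then have "1 / r \<le> 2" using k r by (simp add: field_simps)
  then have "(1 / r)\<^sup>2 \<le> 2\<^sup>2" using r by (intro power_mono) auto
  then have "k * (1 / r)\<^sup>2 \<le> k * 4" using k by (intro mult_left_mono) auto
  then have kr: "k / r\<^sup>2 \<le> 4 * k" by (simp add: power_divide)
  have kr8: "k / r\<^sup>2 \<le> 8 * \<delta>" using kr le by (simp add: k_def)
  have pow: "t powr (2 / \<alpha>) < 1" if "0 \<le> t" "t < 1" for t :: real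
    using powr_less_mono2[of "2 / \<alpha>" t 1] that \<alpha> by simp
  have upper: "1 - norm y powr (2 / \<alpha>) \<le> K * (1 - (norm y)\<^sup>2)"
  proof -
    have "1 - ((norm y)\<^sup>2) powr (1 / \<alpha>) \<le> (2 + 2 * (1 / \<alpha>)) * (1 - (norm y)\<^sup>2)"
      using y \<alpha> by (intro one_minus_powr_le) (auto simp: abs_square_less_1)
    also have "\<dots> \<le> K * (1 - (norm y)\<^sup>2)"
      using y \<alpha> by (intro mult_right_mono) (auto simp: K_def abs_square_le_1)
    also have "((norm y)\<^sup>2) powr (1 / \<alpha>) = norm y powr (2 / \<alpha>)"
      by (simp add: powr_powr flip: powr_numeral)
    finally show ?thesis .
  qed
  have lower: "1 - (norm x)\<^sup>2 \<le> K * (1 - norm x powr (2 / \<alpha>))"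
  proof -
    have "1 - (norm x powr (2 / \<alpha>)) powr \<alpha> \<le> (2 + 2 * \<alpha>) * (1 - norm x powr (2 / \<alpha>))"
      using pow[of "norm x"] x \<alpha> by (intro one_minus_powr_le) auto
    also have "\<dots> \<le> K * (1 - norm x powr (2 / \<alpha>))"
      using pow[of "norm x"] x \<alpha> by (intro mult_right_mono) (auto simp: K_def)
    also have "(norm x powr (2 / \<alpha>)) powr \<alpha> = (norm x)\<^sup>2" using \<alpha> by (simp add: powr_powr)
    finally show ?thesis .
  qed
  have px: "1 - norm x powr (2 / \<alpha>) > 0" "1 - (norm x)\<^sup>2 > 0"
    using pow[of "norm x"] x by (auto simp: abs_square_less_1)
  have "(norm (phi_factor \<alpha> a x))\<^sup>2 = (1 - norm y powr (2 / \<alpha>)) / (1 - norm x powr (2 / \<alpha>))"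
    unfolding y_def by (rule norm_phi_factor(1)[OF \<alpha> a x])
  also have "\<dots> \<le> K * (1 - (norm y)\<^sup>2) / (1 - norm x powr (2 / \<alpha>))"
    using upper px by (intro divide_right_mono) auto
  also have "1 - (norm y)\<^sup>2 = (k / r\<^sup>2) * (1 - (norm x)\<^sup>2)"
    unfolding y_def moebius_one_minus_norm[OF a x] by (simp add: k_def r_def)
  also have "K * ((k / r\<^sup>2) * (1 - (norm x)\<^sup>2)) / (1 - norm x powr (2 / \<alpha>))
      \<le> K * ((k / r\<^sup>2) * (K * (1 - norm x powr (2 / \<alpha>)))) / (1 - norm x powr (2 / \<alpha>))"
    using lower px K0 k r by (intro divide_right_mono mult_left_mono) auto
  also have "\<dots> = K\<^sup>2 * (k / r\<^sup>2)" using px by (simp add: power2_eq_square)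
  finally have fac: "(norm (phi_factor \<alpha> a x))\<^sup>2 \<le> K\<^sup>2 * (k / r\<^sup>2)" .
  have "jac_phi \<alpha> a x \<le> (k / r\<^sup>2)\<^sup>2 * (K\<^sup>2 * (k / r\<^sup>2))"
    unfolding jac_phi_def k_def[symmetric] r_def[symmetric] using fac by (intro mult_left_mono) auto
  also have "\<dots> = K\<^sup>2 * (k / r\<^sup>2) ^ 3" by (simp add: power2_eq_square power3_eq_cube)
  also have "\<dots> \<le> K\<^sup>2 * (8 * \<delta>) ^ 3" using kr8 k r by (intro mult_left_mono power_mono) auto
  also have "\<dots> = 512 * K\<^sup>2 * \<delta> ^ 3" by (simp add: power_mult_distrib)
  finally show ?thesis by (simp add: K_def)
qed

section \<open>The Carleson estimate\<close>

text \<open>The volume of the tube up to a constant factor.\<close>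

definition tube_weight :: "real \<Rightarrow> complex \<times> complex \<Rightarrow> real" where
  "tube_weight \<alpha> w = fdefect \<alpha> w ^ 3 * sdefect w powr (\<alpha> + 2)"

lemma tube_weight_pos: "\<alpha> > 0 \<Longrightarrow> w \<in> U_dom \<alpha> \<Longrightarrow> tube_weight \<alpha> w > 0"
  using fdefect_pos[of \<alpha> w] sdefect_pos[of \<alpha> w] by (simp add: tube_weight_def)

lemma submean_over_tube:
  assumes \<alpha>: "\<alpha> > 0" and g: "holomorphic2_on g (U_dom \<alpha>)" and w: "w \<in> U_dom \<alpha>"
  shows "ennreal (pi\<^sup>2 * tube_size \<alpha> ^ 4 * tube_weight \<alpha> w * (norm (g w))\<^sup>2) \<le>
    (\<integral>\<^sup>+v. indicator (tube \<alpha> w) v * ennreal ((norm (g v))\<^sup>2) \<partial>lborel)"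
proof -
  define c where "c = tube_size \<alpha>"
  define \<delta> where "\<delta> = fdefect \<alpha> w"
  define q where "q = sdefect w"
  have pos: "c > 0" "\<delta> > 0" "q > 0"
    using tube_size_bounds(1)[OF \<alpha>] fdefect_pos[OF \<alpha> w] sdefect_pos[OF \<alpha> w]
    by (simp_all add: c_def \<delta>_def q_def)
  define h where "h y = fst w * ((1 - cnj (snd w) * y) / of_real q) powr of_real \<alpha>" for y
  define r where "r = c * sqrt \<delta> * q"
  define \<rho> where "\<rho> = c * \<delta> * q powr (\<alpha> / 2)"
  have r: "r > 0" "\<rho> > 0" using pos by (simp_all add: r_def \<rho>_def)
  have tube: "tube \<alpha> w = {v. snd v \<in> ball (snd w) r \<and> fst v \<in> ball (h (snd v)) \<rho>}"
    by (simp add: tube_def r_def \<rho>_def h_def c_def \<delta>_def q_def)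
  have sub: "tube \<alpha> w \<subseteq> U_dom \<alpha>" using tube_geometry(1)[OF \<alpha> w] by blast
  have disc: "norm y < 1" if "y \<in> ball (snd w) r" for y
  proof -
    have "(h y, y) \<in> tube \<alpha> w" using that r by (simp add: tube)
    then show ?thesis using sub U_dom_bounded(2)[OF \<alpha>] by force
  qed
  have base: "(1 - cnj (snd w) * y) / of_real q \<notin> \<real>\<^sub>\<le>\<^sub>0" if y: "y \<in> ball (snd w) r" for y
  proof -
    have "Re (1 - cnj (snd w) * y) > 0"
      by (rule Re_one_minus_cnj_mult_pos[OF U_dom_bounded(2)[OF \<alpha> w] disc[OF y]])
    then show ?thesis using pos by (auto simp: complex_nonpos_Reals_iff divide_le_0_iff not_le)
  qed
  have hol: "h holomorphic_on ball (snd w) r"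
    unfolding h_def using base pos by (intro holomorphic_intros) auto
  have center: "h (snd w) = fst w"
  proof -
    have "1 - cnj (snd w) * snd w = of_real q"
      unfolding q_def sdefect_def of_real_diff complex_norm_square by (simp add: mult.commute)
    then show ?thesis using pos by (simp add: h_def)
  qed
  have "(pi * r\<^sup>2) * (pi * \<rho>\<^sup>2) = pi\<^sup>2 * c ^ 4 * tube_weight \<alpha> w"
  proof -
    have "r\<^sup>2 = c\<^sup>2 * \<delta> * q\<^sup>2" using pos by (simp add: r_def power_mult_distrib)
    moreover have "\<rho>\<^sup>2 = c\<^sup>2 * \<delta>\<^sup>2 * q powr \<alpha>"
      using pos by (simp add: \<rho>_def power_mult_distrib powr_powr flip: powr_numeral[of "q powr (\<alpha> / 2)"])
    moreover have "q powr (\<alpha> + 2) = q powr \<alpha> * q\<^sup>2" using pos by (simp add: powr_add)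
    ultimately show ?thesis
      by (simp add: tube_weight_def \<delta>_def[symmetric] q_def[symmetric] power2_eq_square power3_eq_cube
          power4_eq_xxxx)
  qed
  then show ?thesis
    using holomorphic2_submean_tube[OF g open_U_dom[OF \<alpha>] hol r tube sub] center by (simp add: c_def)
qed

lemma defect_measurable [measurable]:
  "sdefect \<in> borel_measurable borel" "fdefect \<alpha> \<in> borel_measurable borel"
  "tube_weight \<alpha> \<in> borel_measurable borel"
proof -
  show s [measurable]: "sdefect \<in> borel_measurable borel" unfolding sdefect_def[abs_def] by measurable
  show f [measurable]: "fdefect \<alpha> \<in> borel_measurable borel"
    unfolding fdefect_def[abs_def] norm_f_alpha by measurable
  show "tube_weight \<alpha> \<in> borel_measurable borel" unfolding tube_weight_def[abs_def] by measurable
qed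

lemma tube_measurable:
  assumes f: "f \<in> M \<rightarrow>\<^sub>M borel" and g: "g \<in> M \<rightarrow>\<^sub>M borel"
  shows "Measurable.pred M (\<lambda>z. g z \<in> tube \<alpha> (f z))"
proof -
  define f1 f2 g1 g2 where "f1 z = fst (f z)" and "f2 z = snd (f z)"
    and "g1 z = fst (g z)" and "g2 z = snd (g z)" for z
  define d q where "d z = fdefect \<alpha> (f z)" and "q z = sdefect (f z)" for z
  have [measurable]: "f1 \<in> borel_measurable M" "f2 \<in> borel_measurable M"
      "g1 \<in> borel_measurable M" "g2 \<in> borel_measurable M"
      "d \<in> borel_measurable M" "q \<in> borel_measurable M"
    unfolding f1_def[abs_def] f2_def[abs_def] g1_def[abs_def] g2_def[abs_def] d_def[abs_def] q_def[abs_def]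
    by (rule measurable_compose[OF f] measurable_compose[OF g], rule fst_snd_borel_measurable defect_measurable)+
  have "Measurable.pred M (\<lambda>z. norm (f2 z - g2 z) < tube_size \<alpha> * sqrt (d z) * q z \<and>
     norm (f1 z * ((1 - cnj (f2 z) * g2 z) / of_real (q z)) powr of_real \<alpha> - g1 z)
       < tube_size \<alpha> * d z * q z powr (\<alpha> / 2))"
    by measurable
  then show ?thesis
    by (simp add: tube_def dist_norm f1_def f2_def g1_def g2_def d_def q_def)
qed

text \<open>The substitution \<open>w = \<Phi>\<^sub>v(\<xi>)\<close> is carried out in two steps. The Jacobian of \<open>varphi\<close> absorbs the power of
  \<open>sdefect\<close> in the weight and that of \<open>phi\<close> the power of \<open>fdefect\<close>.\<close>

lemma carleson_inner_integral:
  fixes u :: "complex \<times> complex \<Rightarrow> ennreal"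
  assumes \<alpha>: "\<alpha> > 0" and v: "v \<in> U_dom \<alpha>" and u [measurable]: "u \<in> borel_measurable borel"
  shows "(\<integral>\<^sup>+w. indicator {w \<in> U_dom \<alpha>. v \<in> tube \<alpha> w} w * (u w * ennreal (1 / tube_weight \<alpha> w)) \<partial>lborel)
    \<le> ennreal (2 powr (\<alpha> + 2) * (512 * (2 + 2 * \<alpha> + 2 / \<alpha>)\<^sup>2)) *
      (\<integral>\<^sup>+\<xi>. indicator (U_dom \<alpha>) \<xi> * u (varphi \<alpha> (snd v) (phi \<alpha> (f_alpha \<alpha> v) \<xi>)) \<partial>lborel)"
    (is "?L \<le> ennreal (?C1 * ?C2) * ?R")
proof -
  let ?U = "U_dom \<alpha>"
  define b where "b = snd v"
  define a where "a = f_alpha \<alpha> v"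
  have b: "norm b < 1" and a: "norm a < 1" using v U_dom_iff[OF \<alpha>] by (auto simp: a_def b_def)
  have U [measurable]: "?U \<in> sets borel" using open_U_dom[OF \<alpha>] by simp
  define W where "W = {w \<in> ?U. v \<in> tube \<alpha> w}"
  have W [measurable]: "W \<in> sets borel"
  proof -
    have "{w \<in> space borel. w \<in> ?U \<and> v \<in> tube \<alpha> w} \<in> sets borel"
      using tube_measurable[of "\<lambda>w. w" borel "\<lambda>w. v" \<alpha>] by measurable
    then show ?thesis by (simp add: W_def)
  qed
  define F where "F w = indicator W w * (u w * ennreal (1 / tube_weight \<alpha> w))" for w
  have F [measurable]: "F \<in> borel_measurable borel" unfolding F_def by measurable
  define H where "H x = indicator ?U x * (indicator W (varphi \<alpha> b x) *
     (u (varphi \<alpha> b x) * ennreal (1 / fdefect \<alpha> (varphi \<alpha> b x) ^ 3)))" for x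
  have H [measurable]: "H \<in> borel_measurable borel" unfolding H_def by measurable
  have geo: "v \<in> ?U" "norm (a - fst (varphi \<alpha> b w)) \<le> 1 - (norm a)\<^sup>2" "1 - (norm a)\<^sup>2 \<le> 2 * fdefect \<alpha> w"
    "(norm (1 - cnj b * snd w))\<^sup>2 \<le> 2 * sdefect w * (1 - (norm b)\<^sup>2)"
    "fdefect \<alpha> w > 0" "sdefect w > 0" "norm (snd w) < 1" if "w \<in> W" for w
    using tube_geometry[OF \<alpha>, of w v] that fdefect_pos[OF \<alpha>] sdefect_pos[OF \<alpha>] U_dom_bounded(2)[OF \<alpha>]
    by (auto simp: W_def a_def b_def sdefect_def)
  have step1: "indicator (UNIV \<times> ball 0 1) x * (F (varphi \<alpha> b x) * ennreal (jac_varphi \<alpha> b (snd x)))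
      \<le> ennreal ?C1 * (indicator (ball 0 1 \<times> UNIV) x * H x)" for x
  proof (cases "snd x \<in> ball 0 1 \<and> varphi \<alpha> b x \<in> W")
    case True
    then have x2: "norm (snd x) < 1" and xW: "varphi \<alpha> b x \<in> W" by auto
    define w where "w = varphi \<alpha> b x"
    have wW: "w \<in> W" using xW by (simp add: w_def)
    have inv: "varphi \<alpha> b w = x" unfolding w_def by (rule varphi_involution[OF b x2])
    have xU: "x \<in> ?U" using varphi_in_U_dom[OF \<alpha> b, of w] wW by (simp add: inv W_def)
    have sw: "snd w = (b - snd x) / (1 - cnj b * snd x)" by (simp add: w_def varphi_def)
    note g = geo[OF wW]
    have "jac_varphi \<alpha> b (snd x) \<le> ?C1 * sdefect w powr (\<alpha> + 2)"
      using g(4,6) unfolding sw by (intro jac_varphi_bound[OF \<alpha> b x2]) auto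
    then have "1 / tube_weight \<alpha> w * jac_varphi \<alpha> b (snd x) \<le> 1 / tube_weight \<alpha> w * (?C1 * sdefect w powr (\<alpha> + 2))"
      using g(5,6) by (intro mult_left_mono) (auto simp: tube_weight_def)
    also have "\<dots> = ?C1 * (1 / fdefect \<alpha> w ^ 3)"
      using g(5,6) by (simp add: tube_weight_def)
    finally have "ennreal (1 / tube_weight \<alpha> w * jac_varphi \<alpha> b (snd x)) \<le> ennreal (?C1 * (1 / fdefect \<alpha> w ^ 3))"
      by (rule ennreal_leI)
    then have "ennreal (1 / tube_weight \<alpha> w) * ennreal (jac_varphi \<alpha> b (snd x))
        \<le> ennreal ?C1 * ennreal (1 / fdefect \<alpha> w ^ 3)"
      using g(5,6) by (simp add: ennreal_mult'[symmetric] tube_weight_def jac_nonneg)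
    then have "u w * (ennreal (1 / tube_weight \<alpha> w) * ennreal (jac_varphi \<alpha> b (snd x)))
        \<le> u w * (ennreal ?C1 * ennreal (1 / fdefect \<alpha> w ^ 3))"
      by (rule mult_left_mono) simp
    then show ?thesis
      using True xU U_dom_bounded(1)[OF \<alpha> xU] wW
      by (simp add: F_def H_def w_def[symmetric] indicator_def mem_Times_iff mult_ac)
  qed (auto simp: F_def indicator_def)
  have step2: "indicator (ball 0 1 \<times> UNIV) \<xi> * (H (phi \<alpha> a \<xi>) * ennreal (jac_phi \<alpha> a (fst \<xi>)))
      \<le> ennreal ?C2 * (indicator ?U \<xi> * u (varphi \<alpha> b (phi \<alpha> a \<xi>)))" for \<xi>
  proof (cases "fst \<xi> \<in> ball 0 1 \<and> phi \<alpha> a \<xi> \<in> ?U \<and> varphi \<alpha> b (phi \<alpha> a \<xi>) \<in> W")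
    case True
    then have x1: "norm (fst \<xi>) < 1" by auto
    define x where "x = phi \<alpha> a \<xi>"
    define w where "w = varphi \<alpha> b x"
    have wW: "w \<in> W" and xU: "x \<in> ?U" using True by (auto simp: w_def x_def)
    have inv: "varphi \<alpha> b w = x"
      unfolding w_def by (rule varphi_involution[OF b U_dom_bounded(2)[OF \<alpha> xU]])
    have \<xi>U: "\<xi> \<in> ?U" using phi_in_U_domD[OF \<alpha> a x1] xU by (simp add: x_def)
    have fx: "fst x = (a - fst \<xi>) / (1 - cnj a * fst \<xi>)" by (simp add: x_def phi_def phi1_def)
    note g = geo[OF wW, unfolded inv]
    have "jac_phi \<alpha> a (fst \<xi>) \<le> ?C2 * fdefect \<alpha> w ^ 3"
      using g(2,3,5) unfolding fx by (intro jac_phi_bound[OF \<alpha> a x1])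
    then have "1 / fdefect \<alpha> w ^ 3 * jac_phi \<alpha> a (fst \<xi>) \<le> ?C2"
      using g(5) by (simp add: field_simps)
    then have "ennreal (1 / fdefect \<alpha> w ^ 3) * ennreal (jac_phi \<alpha> a (fst \<xi>)) \<le> ennreal ?C2"
      using g(5) by (simp add: ennreal_mult'[symmetric] jac_nonneg ennreal_leI)
    then have "u w * (ennreal (1 / fdefect \<alpha> w ^ 3) * ennreal (jac_phi \<alpha> a (fst \<xi>))) \<le> u w * ennreal ?C2"
      by (rule mult_left_mono) simp
    then show ?thesis
      using True \<xi>U xU wW by (simp add: H_def x_def[symmetric] w_def[symmetric] indicator_def mem_Times_iff mult_ac)
  qed (auto simp: H_def indicator_def)
  have "?L = (\<integral>\<^sup>+w. F w \<partial>lborel)" by (simp add: F_def W_def)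
  also have "\<dots> = (\<integral>\<^sup>+w. indicator (UNIV \<times> ball 0 1) w * F w \<partial>lborel)"
    using geo(7) by (intro nn_integral_cong) (auto simp: F_def indicator_def mem_Times_iff)
  also have "\<dots> = (\<integral>\<^sup>+x. indicator (UNIV \<times> ball 0 1) x * (F (varphi \<alpha> b x) * ennreal (jac_varphi \<alpha> b (snd x))) \<partial>lborel)"
    by (rule nn_integral_varphi[OF b F])
  also have "\<dots> \<le> (\<integral>\<^sup>+x. ennreal ?C1 * (indicator (ball 0 1 \<times> UNIV) x * H x) \<partial>lborel)"
    by (rule nn_integral_mono) (rule step1)
  also have "\<dots> = ennreal ?C1 * (\<integral>\<^sup>+x. indicator (ball 0 1 \<times> UNIV) x * H x \<partial>lborel)"
  proof (rule nn_integral_cmult)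
    have [measurable]: "ball 0 1 \<times> UNIV \<in> sets (borel :: (complex \<times> complex) measure)"
      by (intro borel_open open_Times) auto
    show "(\<lambda>x. indicator (ball 0 1 \<times> UNIV) x * H x) \<in> borel_measurable lborel" by measurable
  qed
  also have "(\<integral>\<^sup>+x. indicator (ball 0 1 \<times> UNIV) x * H x \<partial>lborel)
      = (\<integral>\<^sup>+\<xi>. indicator (ball 0 1 \<times> UNIV) \<xi> * (H (phi \<alpha> a \<xi>) * ennreal (jac_phi \<alpha> a (fst \<xi>))) \<partial>lborel)"
    by (rule nn_integral_phi[OF \<alpha> a H])
  also have "\<dots> \<le> (\<integral>\<^sup>+\<xi>. ennreal ?C2 * (indicator ?U \<xi> * u (varphi \<alpha> b (phi \<alpha> a \<xi>))) \<partial>lborel)"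
    by (rule nn_integral_mono) (rule step2)
  also have "\<dots> = ennreal ?C2 * (\<integral>\<^sup>+\<xi>. indicator ?U \<xi> * u (varphi \<alpha> b (phi \<alpha> a \<xi>)) \<partial>lborel)"
    by (rule nn_integral_cmult) measurable
  finally have "?L \<le> ennreal ?C1 * (ennreal ?C2 * ?R)"
    by (simp add: a_def b_def mult_left_mono)
  also have "\<dots> = ennreal (?C1 * ?C2) * ?R"
    by (simp add: ennreal_mult mult.assoc)
  finally show ?thesis .
qed

text \<open>The value \<open>\<bar>g w\<bar>\<^sup>2\<close> is replaced by its average over the tube at \<open>w\<close>; Tonelli's theorem then moves the
  integral of \<open>u\<close> inside, where \<open>carleson_inner_integral\<close> bounds it uniformly.\<close>

lemma carleson_estimate:
  assumes \<alpha>: "\<alpha> > 0"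
  obtains C where "C > 0"
    "\<And>u B g. u \<in> borel_measurable borel \<Longrightarrow> B \<ge> 0 \<Longrightarrow>
      (\<And>v. v \<in> U_dom \<alpha> \<Longrightarrow>
        (\<integral>\<^sup>+\<xi>. indicator (U_dom \<alpha>) \<xi> * u (varphi \<alpha> (snd v) (phi \<alpha> (f_alpha \<alpha> v) \<xi>)) \<partial>lborel) \<le> ennreal B) \<Longrightarrow>
      g \<in> bergman_space (U_dom \<alpha>) \<Longrightarrow>
      (\<integral>\<^sup>+w. indicator (U_dom \<alpha>) w * (u w * ennreal ((norm (g w))\<^sup>2)) \<partial>lborel)
        \<le> ennreal (C * B * sqnorm (lebesgue_on (U_dom \<alpha>)) g)"
proof -
  let ?U = "U_dom \<alpha>"
  define C1 where "C1 = 2 powr (\<alpha> + 2) * (512 * (2 + 2 * \<alpha> + 2 / \<alpha>)\<^sup>2)"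
  define C0 where "C0 = pi\<^sup>2 * tube_size \<alpha> ^ 4"
  have C1: "C1 > 0" using \<alpha> by (auto simp: C1_def add_pos_pos intro!: mult_pos_pos zero_less_power)
  have C0: "C0 > 0" using tube_size_bounds(1)[OF \<alpha>] by (simp add: C0_def)
  have U [measurable]: "?U \<in> sets borel" using open_U_dom[OF \<alpha>] by simp
  show thesis
  proof (rule that[of "C1 / C0"])
    show "C1 / C0 > 0" using C1 C0 by simp
    fix u :: "complex \<times> complex \<Rightarrow> ennreal" and B g
    assume u [measurable]: "u \<in> borel_measurable borel" and B: "B \<ge> (0::real)"
      and hyp: "\<And>v. v \<in> ?U \<Longrightarrow>
        (\<integral>\<^sup>+\<xi>. indicator ?U \<xi> * u (varphi \<alpha> (snd v) (phi \<alpha> (f_alpha \<alpha> v) \<xi>)) \<partial>lborel) \<le> ennreal B"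
      and g: "g \<in> bergman_space ?U"
    have hol: "holomorphic2_on g ?U" and si: "square_integrable (lebesgue_on ?U) g"
      using g by (simp_all add: bergman_space_iff[OF open_U_dom[OF \<alpha>]])
    define G where "G v = indicator ?U v * ennreal ((norm (g v))\<^sup>2)" for v
    have G [measurable]: "G \<in> borel_measurable borel"
      unfolding G_def by (rule measurable_square_norm_indicator[OF open_U_dom[OF \<alpha>]
            holomorphic2_imp_continuous_on[OF hol] U order_refl])
    have N: "(\<integral>\<^sup>+v. G v \<partial>lborel) = ennreal (sqnorm (lebesgue_on ?U) g)"
      using nn_integral_sqnorm[OF si] by (simp add: G_def nn_integral_lebesgue_on)
    define k where "k w v = (if w \<in> ?U \<and> v \<in> tube \<alpha> w then 1 else 0 :: ennreal)" for w v
    have k [measurable]: "(\<lambda>z. k (f z) (h z)) \<in> borel_measurable M"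
      if [measurable]: "f \<in> M \<rightarrow>\<^sub>M borel" "h \<in> M \<rightarrow>\<^sub>M borel" for f h and M :: "'z measure"
      unfolding k_def using tube_measurable[OF that, of \<alpha>] by measurable
    have point: "indicator ?U w * (u w * ennreal ((norm (g w))\<^sup>2)) \<le>
      ennreal (1 / C0) * (\<integral>\<^sup>+v. u w * ennreal (1 / tube_weight \<alpha> w) * (k w v * G v) \<partial>lborel)" for w
    proof (cases "w \<in> ?U")
      case True
      define t where "t = tube_weight \<alpha> w"
      have t: "t > 0" using tube_weight_pos[OF \<alpha> True] by (simp add: t_def)
      have "ennreal (C0 * t * (norm (g w))\<^sup>2) \<le> (\<integral>\<^sup>+v. indicator (tube \<alpha> w) v * ennreal ((norm (g v))\<^sup>2) \<partial>lborel)"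
        using submean_over_tube[OF \<alpha> hol True] by (simp add: C0_def t_def)
      also have "\<dots> = (\<integral>\<^sup>+v. k w v * G v \<partial>lborel)"
        using True tube_geometry(1)[OF \<alpha> True]
        by (intro nn_integral_cong) (auto simp: k_def G_def indicator_def)
      finally have "ennreal (1 / (C0 * t)) * ennreal (C0 * t * (norm (g w))\<^sup>2)
          \<le> ennreal (1 / (C0 * t)) * (\<integral>\<^sup>+v. k w v * G v \<partial>lborel)"
        by (rule mult_left_mono) simp
      also have "ennreal (1 / (C0 * t)) * ennreal (C0 * t * (norm (g w))\<^sup>2) = ennreal ((norm (g w))\<^sup>2)"
        using C0 t by (simp add: ennreal_mult'[symmetric])
      also have "ennreal (1 / (C0 * t)) = ennreal (1 / C0) * ennreal (1 / t)"
        using C0 t by (simp add: ennreal_mult'[symmetric])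
      finally have "u w * ennreal ((norm (g w))\<^sup>2) \<le>
          u w * (ennreal (1 / C0) * ennreal (1 / t) * (\<integral>\<^sup>+v. k w v * G v \<partial>lborel))"
        by (rule mult_left_mono) simp
      also have "\<dots> = ennreal (1 / C0) * ((u w * ennreal (1 / t)) * (\<integral>\<^sup>+v. k w v * G v \<partial>lborel))"
        by (simp add: mult_ac)
      also have "(u w * ennreal (1 / t)) * (\<integral>\<^sup>+v. k w v * G v \<partial>lborel)
          = (\<integral>\<^sup>+v. u w * ennreal (1 / t) * (k w v * G v) \<partial>lborel)"
        by (rule nn_integral_cmult[symmetric]) measurable
      finally show ?thesis using True by (simp add: t_def)
    qed simp
    have "(\<integral>\<^sup>+w. indicator ?U w * (u w * ennreal ((norm (g w))\<^sup>2)) \<partial>lborel)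
      \<le> (\<integral>\<^sup>+w. ennreal (1 / C0) * (\<integral>\<^sup>+v. u w * ennreal (1 / tube_weight \<alpha> w) * (k w v * G v) \<partial>lborel) \<partial>lborel)"
      by (rule nn_integral_mono) (rule point)
    also have "\<dots> = ennreal (1 / C0) * (\<integral>\<^sup>+w. (\<integral>\<^sup>+v. u w * ennreal (1 / tube_weight \<alpha> w) * (k w v * G v) \<partial>lborel) \<partial>lborel)"
      by (rule nn_integral_cmult) measurable
    also have "(\<integral>\<^sup>+w. (\<integral>\<^sup>+v. u w * ennreal (1 / tube_weight \<alpha> w) * (k w v * G v) \<partial>lborel) \<partial>lborel)
      = (\<integral>\<^sup>+v. (\<integral>\<^sup>+w. u w * ennreal (1 / tube_weight \<alpha> w) * (k w v * G v) \<partial>lborel) \<partial>lborel)"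
      by (rule lborel_pair.Fubini'[symmetric]) measurable
    also have "\<dots> \<le> (\<integral>\<^sup>+v. G v * ennreal (C1 * B) \<partial>lborel)"
    proof (rule nn_integral_mono)
      fix v
      have "(\<integral>\<^sup>+w. u w * ennreal (1 / tube_weight \<alpha> w) * (k w v * G v) \<partial>lborel)
          = (\<integral>\<^sup>+w. G v * (indicator {w \<in> ?U. v \<in> tube \<alpha> w} w * (u w * ennreal (1 / tube_weight \<alpha> w))) \<partial>lborel)"
        by (rule nn_integral_cong) (simp add: k_def indicator_def mult_ac)
      also have "\<dots> = G v * (\<integral>\<^sup>+w. indicator {w \<in> ?U. v \<in> tube \<alpha> w} w * (u w * ennreal (1 / tube_weight \<alpha> w)) \<partial>lborel)"
      proof (rule nn_integral_cmult)
        have "{w \<in> space borel. w \<in> ?U \<and> v \<in> tube \<alpha> w} \<in> sets borel"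
          using tube_measurable[of "\<lambda>w. w" borel "\<lambda>w. v" \<alpha>] by measurable
        then have [measurable]: "{w \<in> ?U. v \<in> tube \<alpha> w} \<in> sets borel" by simp
        show "(\<lambda>w. indicator {w \<in> ?U. v \<in> tube \<alpha> w} w * (u w * ennreal (1 / tube_weight \<alpha> w))) \<in> borel_measurable lborel"
          by measurable
      qed
      also have "\<dots> \<le> G v * ennreal (C1 * B)"
      proof (cases "v \<in> ?U")
        case True
        have "(\<integral>\<^sup>+w. indicator {w \<in> ?U. v \<in> tube \<alpha> w} w * (u w * ennreal (1 / tube_weight \<alpha> w)) \<partial>lborel)
          \<le> ennreal C1 * ennreal B"
          using carleson_inner_integral[OF \<alpha> True u, folded C1_def]
            mult_left_mono[OF hyp[OF True], of "ennreal C1"] by (meson order_trans zero_le)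
        then show ?thesis using C1 B by (intro mult_left_mono) (simp_all add: ennreal_mult)
      qed (simp add: G_def)
      finally show "(\<integral>\<^sup>+w. u w * ennreal (1 / tube_weight \<alpha> w) * (k w v * G v) \<partial>lborel) \<le> G v * ennreal (C1 * B)" .
    qed
    also have "\<dots> = ennreal (sqnorm (lebesgue_on ?U) g) * ennreal (C1 * B)"
      by (subst nn_integral_multc) (auto simp: N)
    finally have "(\<integral>\<^sup>+w. indicator ?U w * (u w * ennreal ((norm (g w))\<^sup>2)) \<partial>lborel)
      \<le> ennreal (1 / C0) * (ennreal (sqnorm (lebesgue_on ?U) g) * ennreal (C1 * B))"
      by (simp add: mult_left_mono)
    also have "\<dots> = ennreal (C1 / C0 * B * sqnorm (lebesgue_on ?U) g)"
      using C0 C1 B sqnorm_nonneg[of "lebesgue_on ?U" g]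
      by (simp add: ennreal_mult'[symmetric] mult_ac)
    finally show "(\<integral>\<^sup>+w. indicator ?U w * (u w * ennreal ((norm (g w))\<^sup>2)) \<partial>lborel)
        \<le> ennreal (C1 / C0 * B * sqnorm (lebesgue_on ?U) g)" .
  qed
qed

text \<open>Lebesgue measurability may be lost under composition with \<open>\<Phi>\<^sub>v\<close>, Borel measurability is not. A pointwise
  minorant, rather than a function equal almost everywhere, keeps the integrals of its compositions
  below those of the original function by monotonicity alone.\<close>

lemma borel_minorant_AE_eq:
  fixes f :: "'a::euclidean_space \<Rightarrow> real"
  assumes S [measurable]: "S \<in> sets borel" and f: "f \<in> borel_measurable (lebesgue_on S)" and f0: "\<And>w. f w \<ge> 0"
  obtains h where "h \<in> borel_measurable borel" "\<And>w. 0 \<le> h w" "\<And>w. h w \<le> f w"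
    "AE w in lborel. w \<in> S \<longrightarrow> h w = f w"
proof -
  define F where "F w = indicator S w *\<^sub>R f w" for w
  have "F \<in> borel_measurable lebesgue"
    using f S unfolding F_def by (subst (asm) borel_measurable_restrict_space_iff) auto
  then obtain g where g: "g \<in> borel_measurable lborel" "AE w in lborel. F w = g w"
    using completion_ex_borel_measurable_real[of F lborel] by auto
  then obtain N where N: "{w. F w \<noteq> g w} \<subseteq> N" "N \<in> null_sets lborel"
    by (auto elim!: AE_E simp: null_sets_def)
  have Nb [measurable]: "N \<in> sets borel" using N(2) by auto
  define h where "h w = indicator (- N) w * g w" for w
  have eq: "h w = F w" if "w \<notin> N" for w
  proof -
    have "F w = g w" using that N(1) by blast
    then show ?thesis using that by (simp add: h_def)
  qed
  have z: "h w = 0" if "w \<in> N" for w using that by (simp add: h_def)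
  have F0: "0 \<le> F w" "F w \<le> f w" for w using f0[of w] by (auto simp: F_def indicator_def)
  show thesis
  proof
    show "h \<in> borel_measurable borel" unfolding h_def using g(1) by measurable
    show "0 \<le> h w" "h w \<le> f w" for w
      using eq[of w] z[of w] F0[of w] f0[of w] by (cases "w \<in> N"; simp)+
    show "AE w in lborel. w \<in> S \<longrightarrow> h w = f w"
      using AE_not_in[OF N(2)] by eventually_elim (simp add: eq F_def)
  qed
qed

theorem corollary3p2:
  fixes \<alpha> p :: real and u :: "complex \<times> complex \<Rightarrow> complex"
  assumes "\<alpha> > 0" and "\<alpha> \<noteq> 1"
    and "u \<in> borel_measurable (lebesgue_on (U_dom \<alpha>))"
    and "p > 4"
    and "(SUP z\<in>U_dom \<alpha>. Lp_norm p (U_dom \<alpha>)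
            (\<lambda>w. u (varphi \<alpha> (snd z) (phi \<alpha> (f_alpha \<alpha> z) w)))) < \<infinity>"
  shows "toeplitz_defined (U_dom \<alpha>) u \<and>
         bounded_on_bergman_space (U_dom \<alpha>) (toeplitz (U_dom \<alpha>) u)"
proof -
  note \<alpha> = assms(1)
  let ?U = "U_dom \<alpha>"
  let ?\<Phi> = "\<lambda>z w. varphi \<alpha> (snd z) (phi \<alpha> (f_alpha \<alpha> z) w)"
  have U [measurable]: "?U \<in> sets borel" using open_U_dom[OF \<alpha>] by simp
  have fin: "emeasure lborel ?U < \<infinity>"
  proof (rule emeasure_bounded_finite, rule boundedI)
    fix z assume "z \<in> ?U"
    then show "norm z \<le> 1 + 1"
      using U_dom_bounded[OF \<alpha>, of z] norm_Pair_le[of "fst z" "snd z"] by simp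
  qed
  define S where "S = (SUP z\<in>?U. Lp_norm p ?U (\<lambda>w. u (?\<Phi> z w)))"
  define B where "B = measure lborel ?U + enn2real S powr p"
  have S: "S < \<infinity>" using assms(5) by (simp add: S_def)
  have "(\<lambda>w. norm (u w)) \<in> borel_measurable (lebesgue_on ?U)" using assms(3) by measurable
  then obtain h where h [measurable]: "h \<in> borel_measurable borel" and h0: "\<And>w. 0 \<le> h w"
    and hle: "\<And>w. h w \<le> norm (u w)" and hAE: "AE w in lborel. w \<in> ?U \<longrightarrow> h w = norm (u w)"
    by (rule borel_minorant_AE_eq[OF U]) auto
  have avg: "(\<integral>\<^sup>+\<xi>. indicator ?U \<xi> * ennreal (h (?\<Phi> v \<xi>)) \<partial>lborel) \<le> ennreal B" if v: "v \<in> ?U" for v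
  proof -
    define I where "I = (\<integral>\<^sup>+w. ennreal (norm (u (?\<Phi> v w)) powr p) \<partial>lebesgue_on ?U)"
    have "Lp_norm p ?U (\<lambda>w. u (?\<Phi> v w)) \<le> S" unfolding S_def using v by (intro SUP_upper) auto
    then have le: "(if I = \<infinity> then \<infinity> else ennreal (enn2real I powr (1 / p))) \<le> S"
      by (simp only: Lp_norm_def I_def Let_def)
    have I: "I \<le> ennreal (enn2real S powr p)"
    proof -
      have "I \<noteq> \<infinity>" using le S by auto
      then obtain i where i: "I = ennreal i" "i \<ge> 0" by (cases I) auto
      obtain s where s: "S = ennreal s" "s \<ge> 0" using S by (cases S) auto
      have "i powr (1 / p) \<le> s" using le i s by simp
      then have "(i powr (1 / p)) powr p \<le> s powr p" using assms(4) by (intro powr_mono2) auto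
      then show ?thesis using i s assms(4) by (simp add: powr_powr ennreal_leI)
    qed
    \<comment> \<open>On a set of finite measure the \<open>L\<^sup>p\<close> norm controls the integral; the crude bound below suffices.\<close>
    have le_powr: "t \<le> 1 + t powr p" if "t \<ge> 0" for t :: real
    proof (cases "t \<le> 1")
      case False
      then have "t powr 1 \<le> t powr p" using assms(4) by (intro powr_mono) auto
      then show ?thesis using that by simp
    qed (simp add: add_increasing2)
    have "(\<integral>\<^sup>+\<xi>. indicator ?U \<xi> * ennreal (h (?\<Phi> v \<xi>)) \<partial>lborel)
        \<le> (\<integral>\<^sup>+\<xi>. indicator ?U \<xi> + indicator ?U \<xi> * ennreal (h (?\<Phi> v \<xi>) powr p) \<partial>lborel)"
    proof (rule nn_integral_mono)
      fix \<xi>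
      have "ennreal (h (?\<Phi> v \<xi>)) \<le> 1 + ennreal (h (?\<Phi> v \<xi>) powr p)"
        using ennreal_leI[OF le_powr[OF h0[of "?\<Phi> v \<xi>"]]] by (simp add: ennreal_plus)
      then show "indicator ?U \<xi> * ennreal (h (?\<Phi> v \<xi>))
          \<le> indicator ?U \<xi> + indicator ?U \<xi> * ennreal (h (?\<Phi> v \<xi>) powr p)"
        by (simp add: indicator_def)
    qed
    also have "\<dots> = emeasure lborel ?U + (\<integral>\<^sup>+\<xi>. indicator ?U \<xi> * ennreal (h (?\<Phi> v \<xi>) powr p) \<partial>lborel)"
      by (subst nn_integral_add) auto
    also have "(\<integral>\<^sup>+\<xi>. indicator ?U \<xi> * ennreal (h (?\<Phi> v \<xi>) powr p) \<partial>lborel) \<le> I"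
      unfolding I_def nn_integral_lebesgue_on[OF U]
      using h0 hle assms(4) by (intro nn_integral_mono mult_left_mono ennreal_leI powr_mono2) auto
    also note I
    also have "emeasure lborel ?U + ennreal (enn2real S powr p) = ennreal B"
      using fin by (simp add: B_def emeasure_eq_ennreal_measure top.not_eq_extremum)
    finally show ?thesis by (simp add: add_left_mono)
  qed
  have B0: "B \<ge> 0" by (simp add: B_def)
  obtain C where C: "C > 0" and
    est: "\<And>u B g. u \<in> borel_measurable borel \<Longrightarrow> B \<ge> 0 \<Longrightarrow>
      (\<And>v. v \<in> ?U \<Longrightarrow> (\<integral>\<^sup>+\<xi>. indicator ?U \<xi> * u (?\<Phi> v \<xi>) \<partial>lborel) \<le> ennreal B) \<Longrightarrow>
      g \<in> bergman_space ?U \<Longrightarrow>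
      (\<integral>\<^sup>+w. indicator ?U w * (u w * ennreal ((norm (g w))\<^sup>2)) \<partial>lborel)
        \<le> ennreal (C * B * sqnorm (lebesgue_on ?U) g)"
    by (rule carleson_estimate[OF \<alpha>]) blast
  show ?thesis
  proof (rule toeplitz_bounded_if_carleson[OF open_U_dom[OF \<alpha>] assms(3)])
    show "0 \<le> C * B" using C B0 by simp
    fix g assume g: "g \<in> bergman_space ?U"
    have "(\<integral>\<^sup>+w. ennreal (norm (u w) * (norm (g w))\<^sup>2) \<partial>lebesgue_on ?U)
        = (\<integral>\<^sup>+w. indicator ?U w * (ennreal (h w) * ennreal ((norm (g w))\<^sup>2)) \<partial>lborel)"
      unfolding nn_integral_lebesgue_on[OF U]
      by (rule nn_integral_cong_AE, use hAE in eventually_elim)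
         (auto simp: indicator_def ennreal_mult)
    also have "\<dots> \<le> ennreal (C * B * sqnorm (lebesgue_on ?U) g)"
      using avg by (intro est B0 g) auto
    finally show "(\<integral>\<^sup>+w. ennreal (norm (u w) * (norm (g w))\<^sup>2) \<partial>lebesgue_on ?U)
        \<le> ennreal (C * B * sqnorm (lebesgue_on ?U) g)" .
  qed
qed

end
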